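(* Let $A\subset TM\setminus\mathbf 0$ and let $\nabla$ be an $A$-anisotropic connection, with torsion $\mathcal T$, vertical derivative $P$ and curvature tensor $R$. If $\gamma:[a,b]\to M$ is an auto-parallel curve of $\nabla$, $D_\gamma$ is the induced covariant derivative along $\gamma$ and $J$ is a Jacobi field along $\gamma$, then $$(D^{\dot\gamma}_\gamma)^2J=R_{\dot\gamma}(\dot\gamma,J)\dot\gamma-P_{\dot\gamma}\big(\dot\gamma,\dot\gamma,D^{\dot\gamma}_\gamma J+\mathcal T_{\dot\gamma}(J,\dot\gamma)\big)-(\nabla_{\dot\gamma}\mathcal T)_{\dot\gamma}(J,\dot\gamma)-\mathcal T_{\dot\gamma}(D^{\dot\gamma}_\gamma J,\dot\gamma).$$ In particular, if $\nabla$ is torsion-free and $P_v(v,v,u)=0$ for all $v\in A$ and $u\in T_{\pi(v)}M$, then $$(D^{\dot\gamma}_\gamma)^2J=R_{\dot\gamma}(\dot\gamma,J)\dot\gamma.$$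
   Context: $M$ is a smooth manifold, $\pi:TM\to M$ its tangent bundle, $\mathbf 0$ its zero section, $A\subset TM$ an open subset with $\pi(A)=M$, $\mathcal F(\cdot)$ denotes smooth real functions, $\mathfrak X(\cdot)$ smooth vector fields. $\mathfrak T^1_0(M,A)$ is the set of smooth maps $v\in A\mapsto\mathcal X_v\in T_{\pi(v)}M$; vector fields $X$ on $M$ are regarded as such maps via $v\mapsto X_{\pi(v)}$. An $A$-anisotropic tensor (of type $(1,s)$) is an $\mathcal F(A)$-multilinear map $T:\mathfrak T^1_0(M,A)^s\to\mathfrak T^1_0(M,A)$; it amounts to multilinear maps $T_v:(T_{\pi(v)}M)^s\to T_{\pi(v)}M$ depending smoothly on $v\in A$. For $\mathcal Y\in\mathfrak T^1_0(M,A)$, $(\partial^\nu\mathcal Y)_v(z)=\frac{d}{dt}\mathcal Y_{v+tz}|_{t=0}$. A vector field $V$ on an open $\Omega\subset M$ is $A$-admissible if $V_p\in A$ for all $p\in\Omega$; it extends $v$ if $V_{\pi(v)}=v$; $(\mathcal Y_V)_p=\mathcal Y_{V_p}$. An $A$-anisotropic connection is a map $\nabla:A\times\mathfrak X(M)\times\mathfrak X(M)\to TM$, $(v,X,Y)\mapsto\nabla^v_XY\in T_{\pi(v)}M$, additive in $Y$, with $\nabla^v_X(fY)=X_{\pi(v)}(f)Y_{\pi(v)}+f(\pi(v))\nabla^v_XY$, $\nabla^v_{fX+hY}Z=f(\pi(v))\nabla^v_XZ+h(\pi(v))\nabla^v_YZ$ for $f,h\in\mathcal F(M)$, and with $\nabla_XY\in\mathfrak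 T^1_0(M,A)$ (smoothness in $v$). For $\mathcal Y\in\mathfrak T^1_0(M,A)$, $\nabla^v_X\mathcal Y=\nabla^v_X(\mathcal Y_V)-(\partial^\nu\mathcal Y)_v(\nabla^v_XV)$ for any local $A$-admissible extension $V$ of $v$ (independent of $V$). For an anisotropic tensor $T$ of type $(1,s)$, $(\nabla_XT)(X_1,\ldots,X_s)=\nabla_X(T(X_1,\ldots,X_s))-\sum_jT(X_1,\ldots,\nabla_XX_j,\ldots,X_s)$; $(\nabla_XT)_v$ depends only on $X_{\pi(v)}$, so $(\nabla_uT)_v$ makes sense for $u\in T_{\pi(v)}M$. Torsion: $\mathcal T_v(X,Y)=\nabla^v_XY-\nabla^v_YX-[X,Y]_{\pi(v)}$; torsion-free means $\mathcal T=0$. Vertical derivative of $\nabla$: $P_v(X,Y,Z)=\frac{\partial}{\partial t}\big(\nabla^{v+tZ}_XY\big)|_{t=0}$. Curvature tensor: $R_v(X,Y)Z=\nabla^v_X(\nabla_YZ)-\nabla^v_Y(\nabla_XZ)-\nabla^v_{[X,Y]}Z$ for $X,Y,Z\in\mathfrak X(M)$. These are $A$-anisotropic tensors. The covariant derivative along a smooth curve $\gamma$ induced by $\nabla$ assigns to $v\in A$ with $\pi(v)=\gamma(t_0)$ and a vector field $X$ along $\gamma$ the vector $D^v_\gamma X=\big(\dot X^k(t_0)+\dot\gamma^i(t_0)X^j(t_0)\Gamma^k_{ij}(v)\big)\partial_k$, where $\nabla^v_{\partial_i}\partial_j=\Gamma^k_{ij}(v)\partial_k$ in a chart; it satisfies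 the Leibniz rule and $D^v_\gamma(X\circ\gamma)=\nabla^v_{\dot\gamma}X$ for $X\in\mathfrak X(M)$. For $V$ along $\gamma$ with values in $A$, $(D^V_\gamma X)(t)=D^{V(t)}_\gamma X$. A smooth curve $\gamma$ is an auto-parallel curve if $\dot\gamma(t)\in A$ for all $t$ and $D^{\dot\gamma}_\gamma\dot\gamma=0$. A Jacobi field along an auto-parallel curve $\gamma$ is the variational field $J(t)=\partial_s\Lambda(t,0)$ of a smooth variation $\Lambda:[a,b]\times(-\varepsilon,\varepsilon)\to M$, $\Lambda(\cdot,0)=\gamma$, such that every curve $\gamma_s=\Lambda(\cdot,s)$ is auto-parallel. *)

theory Defs
  imports "HOL-Analysis.Analysis"
begin

section \<open>Smooth maps between Euclidean spaces\<close>

text \<open>Meant for open domains only, so that all derivatives are unambiguous.\<close>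

fun Ck_on :: "nat \<Rightarrow> 'a::euclidean_space set \<Rightarrow> ('a \<Rightarrow> 'b::real_normed_vector) \<Rightarrow> bool" where
  "Ck_on 0 S f \<longleftrightarrow> continuous_on S f"
| "Ck_on (Suc n) S f \<longleftrightarrow> (\<forall>x\<in>S. f differentiable (at x)) \<and>
     (\<forall>h. Ck_on n S (\<lambda>x. frechet_derivative f (at x) h))"

definition smooth_on :: "'a::euclidean_space set \<Rightarrow> ('a \<Rightarrow> 'b::real_normed_vector) \<Rightarrow> bool" where
  "smooth_on S f \<longleftrightarrow> (\<forall>n. Ck_on n S f)"


section \<open>Smooth manifolds\<close>

type_synonym ('m, 'e) chart = "'m set \<times> ('m \<Rightarrow> 'e)"

abbreviation dom_of :: "('m, 'e) chart \<Rightarrow> 'm set" where "dom_of c \<equiv> fst c"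

abbreviation map_of_chart :: "('m, 'e) chart \<Rightarrow> 'm \<Rightarrow> 'e" where "map_of_chart c \<equiv> snd c"

definition chart_inv :: "('m, 'e) chart \<Rightarrow> 'e \<Rightarrow> 'm" where
  "chart_inv c = inv_into (dom_of c) (map_of_chart c)"

definition is_chart :: "('m::topological_space, 'e::euclidean_space) chart \<Rightarrow> bool" where
  "is_chart c \<longleftrightarrow> open (dom_of c) \<and> open (map_of_chart c ` dom_of c) \<and>
     homeomorphism (dom_of c) (map_of_chart c ` dom_of c) (map_of_chart c) (chart_inv c)"

text \<open>The manifold is the whole type \<open>'m\<close>; Hausdorffness and second countability are imposed
  through its type classes. The atlas need not be maximal.\<close>

definition smooth_atlas ::
  "('m::{t2_space, second_countable_topology}, 'e::euclidean_space) chart set \<Rightarrow> bool" where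
  "smooth_atlas \<A> \<longleftrightarrow> (\<forall>c\<in>\<A>. is_chart c) \<and> (\<Union>c\<in>\<A>. dom_of c) = UNIV \<and>
     (\<forall>c\<in>\<A>. \<forall>d\<in>\<A>. smooth_on (map_of_chart c ` (dom_of c \<inter> dom_of d)) (map_of_chart d \<circ> chart_inv c))"

definition smooth_fun :: "('m, 'e::euclidean_space) chart set \<Rightarrow> ('m \<Rightarrow> real) \<Rightarrow> bool" where
  "smooth_fun \<A> f \<longleftrightarrow> (\<forall>c\<in>\<A>. smooth_on (map_of_chart c ` dom_of c) (f \<circ> chart_inv c))"

text \<open>Smoothness of a map into the manifold on an arbitrary subset of a Euclidean space
  (used for \<open>[a,b]\<close> and \<open>[a,b] \<times> (-\<epsilon>,\<epsilon>)\<close>): near each point, and in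
  a chart around its image, the map is the restriction of a smooth map on an open set.\<close>

definition smooth_into :: "('m, 'e::euclidean_space) chart set \<Rightarrow> 'a::euclidean_space set \<Rightarrow> ('a \<Rightarrow> 'm) \<Rightarrow> bool" where
  "smooth_into \<A> S f \<longleftrightarrow> (\<forall>x\<in>S. \<exists>c\<in>\<A>. \<exists>W g. open W \<and> x \<in> W \<and> smooth_on W g \<and>
     (\<forall>y\<in>W \<inter> S. f y \<in> dom_of c \<and> map_of_chart c (f y) = g y))"


section \<open>The tangent bundle\<close>

text \<open>Every point \<open>p\<close> has a preferred chart \<open>chart_at \<A> p\<close> of the atlas around it. The tangent
  space \<open>T\<^sub>pM\<close> is represented by the model space \<open>'e\<close>: the vector \<open>u :: 'e\<close> at \<open>p\<close> stands for
  the tangent vector with components \<open>u\<close> in the preferred chart at \<open>p\<close>. Hence \<open>TM\<close> has the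
  underlying set \<open>'m \<times> 'e\<close>, with the usual vector space structure on the fibres, but the product
  topology of the type \<open>'m \<times> 'e\<close> is \<^emph>\<open>not\<close> the topology of \<open>TM\<close> (the preferred chart
  may jump); topology and smoothness are always read off in the charts \<open>tchart \<A> c\<close> below.\<close>

definition chart_at :: "('m, 'e) chart set \<Rightarrow> 'm \<Rightarrow> ('m, 'e) chart" where
  "chart_at \<A> p = (SOME c. c \<in> \<A> \<and> p \<in> dom_of c)"

text \<open>\<open>to_coord \<A> c p\<close> sends a tangent vector at \<open>p\<close> to its components in the chart \<open>c\<close>,
  and \<open>from_coord \<A> c p\<close> is the inverse isomorphism. Both are the identity for
  \<open>c = chart_at \<A> p\<close>.\<close>

definition transition_deriv :: "('m, 'e::euclidean_space) chart \<Rightarrow> ('m, 'e) chart \<Rightarrow> 'm \<Rightarrow> 'e \<Rightarrow> 'e" where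
  "transition_deriv c d p = frechet_derivative (map_of_chart d \<circ> chart_inv c) (at (map_of_chart c p))"

definition to_coord :: "('m, 'e::euclidean_space) chart set \<Rightarrow> ('m, 'e) chart \<Rightarrow> 'm \<Rightarrow> 'e \<Rightarrow> 'e" where
  "to_coord \<A> c p u = transition_deriv (chart_at \<A> p) c p u"

definition from_coord :: "('m, 'e::euclidean_space) chart set \<Rightarrow> ('m, 'e) chart \<Rightarrow> 'm \<Rightarrow> 'e \<Rightarrow> 'e" where
  "from_coord \<A> c p y = transition_deriv c (chart_at \<A> p) p y"

definition tchart :: "('m, 'e::euclidean_space) chart set \<Rightarrow> ('m, 'e) chart \<Rightarrow> 'm \<times> 'e \<Rightarrow> 'e \<times> 'e" where
  "tchart \<A> c v = (map_of_chart c (fst v), to_coord \<A> c (fst v) (snd v))"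

definition tchart_inv :: "('m, 'e::euclidean_space) chart set \<Rightarrow> ('m, 'e) chart \<Rightarrow> 'e \<times> 'e \<Rightarrow> 'm \<times> 'e" where
  "tchart_inv \<A> c xy = (chart_inv c (fst xy), from_coord \<A> c (chart_inv c (fst xy)) (snd xy))"

definition open_in_TM :: "('m, 'e::euclidean_space) chart set \<Rightarrow> ('m \<times> 'e) set \<Rightarrow> bool" where
  "open_in_TM \<A> A \<longleftrightarrow> (\<forall>c\<in>\<A>. open (tchart \<A> c ` {v \<in> A. fst v \<in> dom_of c}))"


section \<open>Vector fields\<close>

definition vf_rep :: "('m, 'e::euclidean_space) chart set \<Rightarrow> ('m, 'e) chart \<Rightarrow> ('m \<Rightarrow> 'e) \<Rightarrow> 'e \<Rightarrow> 'e" where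
  "vf_rep \<A> c X x = to_coord \<A> c (chart_inv c x) (X (chart_inv c x))"

definition smooth_vf_on :: "('m, 'e::euclidean_space) chart set \<Rightarrow> 'm set \<Rightarrow> ('m \<Rightarrow> 'e) \<Rightarrow> bool" where
  "smooth_vf_on \<A> \<Omega> X \<longleftrightarrow> (\<forall>c\<in>\<A>. smooth_on (map_of_chart c ` (dom_of c \<inter> \<Omega>)) (vf_rep \<A> c X))"

abbreviation smooth_vf :: "('m, 'e::euclidean_space) chart set \<Rightarrow> ('m \<Rightarrow> 'e) \<Rightarrow> bool" where
  "smooth_vf \<A> X \<equiv> smooth_vf_on \<A> UNIV X"

definition dir_deriv :: "('m, 'e::euclidean_space) chart set \<Rightarrow> 'm \<Rightarrow> 'e \<Rightarrow> ('m \<Rightarrow> real) \<Rightarrow> real" where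
  "dir_deriv \<A> p u f =
     frechet_derivative (f \<circ> chart_inv (chart_at \<A> p)) (at (map_of_chart (chart_at \<A> p) p)) u"

text \<open>\<open>[X,Y]\<^sup>k = X\<^sup>i \<partial>\<^sub>iY\<^sup>k - Y\<^sup>i \<partial>\<^sub>iX\<^sup>k\<close>, in the preferred chart at the point.\<close>

definition lie_bracket :: "('m, 'e::euclidean_space) chart set \<Rightarrow> ('m \<Rightarrow> 'e) \<Rightarrow> ('m \<Rightarrow> 'e) \<Rightarrow> 'm \<Rightarrow> 'e" where
  "lie_bracket \<A> X Y p = (let c = chart_at \<A> p; x = map_of_chart c p in
     frechet_derivative (vf_rep \<A> c Y) (at x) (X p) - frechet_derivative (vf_rep \<A> c X) (at x) (Y p))"

definition coord_vf :: "('m, 'e::euclidean_space) chart set \<Rightarrow> ('m, 'e) chart \<Rightarrow> 'e \<Rightarrow> 'm \<Rightarrow> 'e" where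
  "coord_vf \<A> c i q = from_coord \<A> c q i"

text \<open>Global vector fields extending a tangent vector, respectively the germ at \<open>p\<close> of a vector
  field that is only smooth near \<open>p\<close>. The latter is how a connection, which takes global fields
  as arguments, is applied to locally defined ones; by locality of connections the choice is
  immaterial.\<close>

definition vf_ext :: "('m, 'e::euclidean_space) chart set \<Rightarrow> 'm \<Rightarrow> 'e \<Rightarrow> 'm \<Rightarrow> 'e" where
  "vf_ext \<A> p u = (SOME X. smooth_vf \<A> X \<and> X p = u)"

definition germ_ext ::
  "('m::topological_space, 'e::euclidean_space) chart set \<Rightarrow> 'm \<Rightarrow> ('m \<Rightarrow> 'e) \<Rightarrow> 'm \<Rightarrow> 'e" where
  "germ_ext \<A> p Y = (SOME Z. smooth_vf \<A> Z \<and> (\<exists>W. open W \<and> p \<in> W \<and> (\<forall>q\<in>W. Z q = Y q)))"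


section \<open>Anisotropic vector fields and connections\<close>

text \<open>Objects on \<open>A\<close> are total functions on \<open>'m \<times> 'e\<close> of which only the values on \<open>A\<close> matter.\<close>

definition aniso_rep ::
  "('m, 'e::euclidean_space) chart set \<Rightarrow> ('m, 'e) chart \<Rightarrow> ('m \<times> 'e \<Rightarrow> 'e) \<Rightarrow> 'e \<times> 'e \<Rightarrow> 'e" where
  "aniso_rep \<A> c \<X> xy = to_coord \<A> c (chart_inv c (fst xy)) (\<X> (tchart_inv \<A> c xy))"

definition aniso_vf ::
  "('m, 'e::euclidean_space) chart set \<Rightarrow> ('m \<times> 'e) set \<Rightarrow> ('m \<times> 'e \<Rightarrow> 'e) \<Rightarrow> bool" where
  "aniso_vf \<A> A \<X> \<longleftrightarrow>
     (\<forall>c\<in>\<A>. smooth_on (tchart \<A> c ` {v \<in> A. fst v \<in> dom_of c}) (aniso_rep \<A> c \<X>))"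

type_synonym ('m, 'e) conn = "'m \<times> 'e \<Rightarrow> ('m \<Rightarrow> 'e) \<Rightarrow> ('m \<Rightarrow> 'e) \<Rightarrow> 'e"

definition aniso_connection ::
  "('m, 'e::euclidean_space) chart set \<Rightarrow> ('m \<times> 'e) set \<Rightarrow> ('m, 'e) conn \<Rightarrow> bool" where
  "aniso_connection \<A> A nab \<longleftrightarrow>
     (\<forall>v\<in>A. \<forall>X Y Z. smooth_vf \<A> X \<and> smooth_vf \<A> Y \<and> smooth_vf \<A> Z \<longrightarrow>
        nab v X (\<lambda>p. Y p + Z p) = nab v X Y + nab v X Z) \<and>
     (\<forall>v\<in>A. \<forall>X Y f. smooth_vf \<A> X \<and> smooth_vf \<A> Y \<and> smooth_fun \<A> f \<longrightarrow>
        nab v X (\<lambda>p. f p *\<^sub>R Y p) =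
          dir_deriv \<A> (fst v) (X (fst v)) f *\<^sub>R Y (fst v) + f (fst v) *\<^sub>R nab v X Y) \<and>
     (\<forall>v\<in>A. \<forall>X Y Z f h. smooth_vf \<A> X \<and> smooth_vf \<A> Y \<and> smooth_vf \<A> Z \<and>
          smooth_fun \<A> f \<and> smooth_fun \<A> h \<longrightarrow>
        nab v (\<lambda>p. f p *\<^sub>R X p + h p *\<^sub>R Y p) Z = f (fst v) *\<^sub>R nab v X Z + h (fst v) *\<^sub>R nab v Y Z) \<and>
     (\<forall>X Y. smooth_vf \<A> X \<and> smooth_vf \<A> Y \<longrightarrow> aniso_vf \<A> A (\<lambda>v. nab v X Y))"

definition vert_deriv :: "('m \<times> 'e::euclidean_space \<Rightarrow> 'e) \<Rightarrow> 'm \<times> 'e \<Rightarrow> 'e \<Rightarrow> 'e" where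
  "vert_deriv \<Y> v z = vector_derivative (\<lambda>t. \<Y> (fst v, snd v + t *\<^sub>R z)) (at 0)"

definition admissible_ext ::
  "('m::topological_space, 'e::euclidean_space) chart set \<Rightarrow> ('m \<times> 'e) set \<Rightarrow> 'm \<times> 'e \<Rightarrow> ('m \<Rightarrow> 'e) \<Rightarrow> bool" where
  "admissible_ext \<A> A v V \<longleftrightarrow> (\<exists>\<Omega>. open \<Omega> \<and> fst v \<in> \<Omega> \<and> smooth_vf_on \<A> \<Omega> V \<and>
     (\<forall>q\<in>\<Omega>. (q, V q) \<in> A) \<and> V (fst v) = snd v)"

text \<open>\<open>\<nabla>\<^sup>v\<^sub>X \<Y>\<close> for an anisotropic field \<open>\<Y>\<close>, via some locally admissible extension \<open>V\<close> of \<open>v\<close>.\<close>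

definition conn_aniso ::
  "('m::topological_space, 'e::euclidean_space) chart set \<Rightarrow> ('m \<times> 'e) set \<Rightarrow> ('m, 'e) conn \<Rightarrow>
     'm \<times> 'e \<Rightarrow> ('m \<Rightarrow> 'e) \<Rightarrow> ('m \<times> 'e \<Rightarrow> 'e) \<Rightarrow> 'e" where
  "conn_aniso \<A> A nab v X \<Y> = (let V = (SOME V. admissible_ext \<A> A v V) in
     nab v X (germ_ext \<A> (fst v) (\<lambda>q. \<Y> (q, V q))) -
     vert_deriv \<Y> v (nab v X (germ_ext \<A> (fst v) V)))"

text \<open>\<open>(\<nabla>\<^sub>X T)(X\<^sub>1,X\<^sub>2)\<close> at \<open>v\<close>, for an anisotropic tensor \<open>T\<close> of type \<open>(1,2)\<close>.\<close>

definition conn_tensor ::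
  "('m::topological_space, 'e::euclidean_space) chart set \<Rightarrow> ('m \<times> 'e) set \<Rightarrow> ('m, 'e) conn \<Rightarrow>
     ('m \<times> 'e \<Rightarrow> 'e \<Rightarrow> 'e \<Rightarrow> 'e) \<Rightarrow> 'm \<times> 'e \<Rightarrow> ('m \<Rightarrow> 'e) \<Rightarrow>
     ('m \<times> 'e \<Rightarrow> 'e) \<Rightarrow> ('m \<times> 'e \<Rightarrow> 'e) \<Rightarrow> 'e" where
  "conn_tensor \<A> A nab T v X X\<^sub>1 X\<^sub>2 =
     conn_aniso \<A> A nab v X (\<lambda>w. T w (X\<^sub>1 w) (X\<^sub>2 w)) -
     T v (conn_aniso \<A> A nab v X X\<^sub>1) (X\<^sub>2 v) - T v (X\<^sub>1 v) (conn_aniso \<A> A nab v X X\<^sub>2)"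


section \<open>Torsion, vertical derivative and curvature\<close>

definition torsion_vf ::
  "('m, 'e::euclidean_space) chart set \<Rightarrow> ('m, 'e) conn \<Rightarrow> 'm \<times> 'e \<Rightarrow> ('m \<Rightarrow> 'e) \<Rightarrow> ('m \<Rightarrow> 'e) \<Rightarrow> 'e" where
  "torsion_vf \<A> nab v X Y = nab v X Y - nab v Y X - lie_bracket \<A> X Y (fst v)"

definition vert_conn_vf ::
  "('m, 'e::euclidean_space) conn \<Rightarrow> 'm \<times> 'e \<Rightarrow> ('m \<Rightarrow> 'e) \<Rightarrow> ('m \<Rightarrow> 'e) \<Rightarrow> ('m \<Rightarrow> 'e) \<Rightarrow> 'e" where
  "vert_conn_vf nab v X Y Z =
     vector_derivative (\<lambda>t. nab (fst v, snd v + t *\<^sub>R Z (fst v)) X Y) (at 0)"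

definition curvature_vf ::
  "('m::topological_space, 'e::euclidean_space) chart set \<Rightarrow> ('m \<times> 'e) set \<Rightarrow> ('m, 'e) conn \<Rightarrow>
     'm \<times> 'e \<Rightarrow> ('m \<Rightarrow> 'e) \<Rightarrow> ('m \<Rightarrow> 'e) \<Rightarrow> ('m \<Rightarrow> 'e) \<Rightarrow> 'e" where
  "curvature_vf \<A> A nab v X Y Z =
     conn_aniso \<A> A nab v X (\<lambda>w. nab w Y Z) - conn_aniso \<A> A nab v Y (\<lambda>w. nab w X Z) -
     nab v (lie_bracket \<A> X Y) Z"

text \<open>The pointwise tensors: tangent vectors at the foot point of \<open>v\<close> are extended to vector
  fields, the choice being immaterial by tensoriality.\<close>

definition torsion ::
  "('m, 'e::euclidean_space) chart set \<Rightarrow> ('m, 'e) conn \<Rightarrow> 'm \<times> 'e \<Rightarrow> 'e \<Rightarrow> 'e \<Rightarrow> 'e" where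
  "torsion \<A> nab v u w = torsion_vf \<A> nab v (vf_ext \<A> (fst v) u) (vf_ext \<A> (fst v) w)"

definition vert_conn ::
  "('m, 'e::euclidean_space) chart set \<Rightarrow> ('m, 'e) conn \<Rightarrow> 'm \<times> 'e \<Rightarrow> 'e \<Rightarrow> 'e \<Rightarrow> 'e \<Rightarrow> 'e" where
  "vert_conn \<A> nab v u w z =
     vert_conn_vf nab v (vf_ext \<A> (fst v) u) (vf_ext \<A> (fst v) w) (vf_ext \<A> (fst v) z)"

definition curvature ::
  "('m::topological_space, 'e::euclidean_space) chart set \<Rightarrow> ('m \<times> 'e) set \<Rightarrow> ('m, 'e) conn \<Rightarrow>
     'm \<times> 'e \<Rightarrow> 'e \<Rightarrow> 'e \<Rightarrow> 'e \<Rightarrow> 'e" where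
  "curvature \<A> A nab v u w z =
     curvature_vf \<A> A nab v (vf_ext \<A> (fst v) u) (vf_ext \<A> (fst v) w) (vf_ext \<A> (fst v) z)"

definition conn_tensor_at ::
  "('m::topological_space, 'e::euclidean_space) chart set \<Rightarrow> ('m \<times> 'e) set \<Rightarrow> ('m, 'e) conn \<Rightarrow>
     ('m \<times> 'e \<Rightarrow> 'e \<Rightarrow> 'e \<Rightarrow> 'e) \<Rightarrow> 'm \<times> 'e \<Rightarrow> 'e \<Rightarrow> 'e \<Rightarrow> 'e \<Rightarrow> 'e" where
  "conn_tensor_at \<A> A nab T v u w z = conn_tensor \<A> A nab T v (vf_ext \<A> (fst v) u)
     (\<lambda>r. vf_ext \<A> (fst v) w (fst r)) (\<lambda>r. vf_ext \<A> (fst v) z (fst r))"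

definition torsion_free ::
  "('m, 'e::euclidean_space) chart set \<Rightarrow> ('m \<times> 'e) set \<Rightarrow> ('m, 'e) conn \<Rightarrow> bool" where
  "torsion_free \<A> A nab \<longleftrightarrow>
     (\<forall>v\<in>A. \<forall>X Y. smooth_vf \<A> X \<and> smooth_vf \<A> Y \<longrightarrow> torsion_vf \<A> nab v X Y = 0)"


section \<open>Covariant derivative along curves, auto-parallel curves, Jacobi fields\<close>

text \<open>At the endpoints of \<open>[a,b]\<close> all derivatives are one-sided. Near \<open>t\<close> everything is expressed
  in the preferred chart at \<open>\<gamma> t\<close>, in which \<open>to_coord\<close> is the identity at \<open>\<gamma> t\<close> itself.\<close>

definition velocity ::
  "('m, 'e::euclidean_space) chart set \<Rightarrow> real \<Rightarrow> real \<Rightarrow> (real \<Rightarrow> 'm) \<Rightarrow> real \<Rightarrow> 'e" where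
  "velocity \<A> a b \<gamma> t =
     vector_derivative (\<lambda>\<tau>. map_of_chart (chart_at \<A> (\<gamma> t)) (\<gamma> \<tau>)) (at t within {a..b})"

text \<open>The vector of components \<open>\<Gamma>\<^sup>k\<^sub>i\<^sub>j(v)\<close> in the chart \<open>c\<close>, with \<open>i\<close> and \<open>j\<close> ranging over \<open>Basis\<close>.\<close>

definition christoffel ::
  "('m::topological_space, 'e::euclidean_space) chart set \<Rightarrow> ('m, 'e) conn \<Rightarrow> ('m, 'e) chart \<Rightarrow>
     'm \<times> 'e \<Rightarrow> 'e \<Rightarrow> 'e \<Rightarrow> 'e" where
  "christoffel \<A> nab c v i j = to_coord \<A> c (fst v)
     (nab v (germ_ext \<A> (fst v) (coord_vf \<A> c i)) (germ_ext \<A> (fst v) (coord_vf \<A> c j)))"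

text \<open>\<open>D\<^sup>v\<^sub>\<gamma> X\<close> at \<open>t\<close>, for \<open>v\<close> over \<open>\<gamma> t\<close>.\<close>

definition cov_deriv ::
  "('m::topological_space, 'e::euclidean_space) chart set \<Rightarrow> ('m, 'e) conn \<Rightarrow> real \<Rightarrow> real \<Rightarrow>
     (real \<Rightarrow> 'm) \<Rightarrow> 'm \<times> 'e \<Rightarrow> (real \<Rightarrow> 'e) \<Rightarrow> real \<Rightarrow> 'e" where
  "cov_deriv \<A> nab a b \<gamma> v X t = (let c = chart_at \<A> (\<gamma> t) in
     vector_derivative (\<lambda>\<tau>. to_coord \<A> c (\<gamma> \<tau>) (X \<tau>)) (at t within {a..b}) +
     (\<Sum>i\<in>Basis. \<Sum>j\<in>Basis.
        ((velocity \<A> a b \<gamma> t \<bullet> i) * (X t \<bullet> j)) *\<^sub>R christoffel \<A> nab c v i j))"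

definition cov_deriv_along ::
  "('m::topological_space, 'e::euclidean_space) chart set \<Rightarrow> ('m, 'e) conn \<Rightarrow> real \<Rightarrow> real \<Rightarrow>
     (real \<Rightarrow> 'm) \<Rightarrow> (real \<Rightarrow> 'e) \<Rightarrow> (real \<Rightarrow> 'e) \<Rightarrow> real \<Rightarrow> 'e" where
  "cov_deriv_along \<A> nab a b \<gamma> V X t = cov_deriv \<A> nab a b \<gamma> (\<gamma> t, V t) X t"

definition auto_parallel ::
  "('m::topological_space, 'e::euclidean_space) chart set \<Rightarrow> ('m \<times> 'e) set \<Rightarrow> ('m, 'e) conn \<Rightarrow>
     real \<Rightarrow> real \<Rightarrow> (real \<Rightarrow> 'm) \<Rightarrow> bool" where
  "auto_parallel \<A> A nab a b \<gamma> \<longleftrightarrow> smooth_into \<A> {a..b} \<gamma> \<and>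
     (\<forall>t\<in>{a..b}. (\<gamma> t, velocity \<A> a b \<gamma> t) \<in> A \<and>
        cov_deriv_along \<A> nab a b \<gamma> (velocity \<A> a b \<gamma>) (velocity \<A> a b \<gamma>) t = 0)"

definition jacobi_field ::
  "('m::topological_space, 'e::euclidean_space) chart set \<Rightarrow> ('m \<times> 'e) set \<Rightarrow> ('m, 'e) conn \<Rightarrow>
     real \<Rightarrow> real \<Rightarrow> (real \<Rightarrow> 'm) \<Rightarrow> (real \<Rightarrow> 'e) \<Rightarrow> bool" where
  "jacobi_field \<A> A nab a b \<gamma> J \<longleftrightarrow> (\<exists>\<epsilon>>0. \<exists>\<Lambda> :: real \<times> real \<Rightarrow> 'm.
     smooth_into \<A> ({a..b} \<times> {-\<epsilon><..<\<epsilon>}) \<Lambda> \<and>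
     (\<forall>t\<in>{a..b}. \<Lambda> (t, 0) = \<gamma> t) \<and>
     (\<forall>s\<in>{-\<epsilon><..<\<epsilon>}. auto_parallel \<A> A nab a b (\<lambda>t. \<Lambda> (t, s))) \<and>
     (\<forall>t\<in>{a..b}. J t =
        vector_derivative (\<lambda>s. map_of_chart (chart_at \<A> (\<gamma> t)) (\<Lambda> (t, s))) (at 0)))"

end

theory Submission
  imports Defs
begin

text \<open>Bump functions extend coordinate frames to global fields and make a connection local, so in
  every chart it is \<open>\<nabla>\<^sub>X Y = DY(X) + \<Gamma>(X,Y)\<close> with coefficients \<open>\<Gamma>\<close> that are smooth on the chart image
  of \<open>A\<close>; torsion, curvature, \<open>P\<close> and \<open>\<nabla>\<T>\<close> become expressions in \<open>\<Gamma>\<close> and its first derivative, the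
  second derivatives of the extensions cancelling by symmetry. Near \<open>t\<close>, the variation is a smooth map
  \<open>g(t,s)\<close> in the preferred chart at \<open>\<gamma> t\<close>, and \<open>g\<^sub>t\<^sub>t + \<Gamma>(g,g\<^sub>t)(g\<^sub>t,g\<^sub>t) = 0\<close>. Differentiating this identity
  in \<open>s\<close> at \<open>s = 0\<close> expresses the second derivative of \<open>J\<close> through lower order terms, and the
  claim is then an identity between multilinear expressions.\<close>

section \<open>Calculus of smooth maps\<close>

text \<open>The preferred chart may jump from point to point, and velocity, covariant derivative and
  J are read in it separately at each time. But D (D J) differentiates D J, which must therefore be
  known in one fixed chart at all times near \<open>t\<close>. This is why covariant derivatives
  along curves are computed in an arbitrary chart, at the price of the inhomogeneous transformation
  law of the Christoffel coefficients, whereas curvature, P and \<nabla>\<T> are needed only at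
  \<gamma> t and are computed in the preferred chart there. The endpoints shape the rest:
  derivatives in t are one-sided there, and the variation agrees with the smooth map g only over
  [a,b]. The auto-parallel equation is therefore differentiated only in s, which runs through an
  open interval; the third derivative of g that results is brought into the order needed for D (D J)
  by symmetry of second derivatives on the open domain of g, where no endpoint is felt.\<close>

lemma Ck_on_subset: "Ck_on n S f \<Longrightarrow> T \<subseteq> S \<Longrightarrow> Ck_on n T f"
proof (induction n arbitrary: f)
  case 0 then show ?case using continuous_on_subset by auto
next
  case (Suc n) then show ?case by (auto simp: subset_iff)
qed

lemma Ck_on_Suc_lower: "Ck_on (Suc n) S f \<Longrightarrow> Ck_on n S f"
proof (induction n arbitrary: f)
  case 0
  then have "f differentiable (at x)" if "x \<in> S" for x using that by simp
  then have "continuous_on S f"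
    using differentiable_imp_continuous_within continuous_at_imp_continuous_on by blast
  then show ?case by simp
next
  case (Suc n)
  then show ?case by (metis Ck_on.simps(2))
qed

lemma Ck_on_continuous: "Ck_on n S f \<Longrightarrow> continuous_on S f"
  by (induction n) (use Ck_on_Suc_lower in auto)

text \<open>A derivative sees a whole neighbourhood, so equality carries over to all derivatives
  because \<open>S\<close> is open.\<close>

lemma Ck_on_cong:
  assumes "open S" "\<And>x. x \<in> S \<Longrightarrow> f x = g x" "Ck_on n S f"
  shows "Ck_on n S g"
  using assms(2,3)
proof (induction n arbitrary: f g)
  case 0
  then show ?case by (metis Ck_on.simps(1) continuous_on_cong)
next
  case (Suc n)
  have d: "f differentiable (at x)" if "x \<in> S" for x using Suc that by simp
  have d': "g differentiable (at x)" if "x \<in> S" for x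
    using d[OF that] \<open>open S\<close> that Suc.prems(1)
    by (metis differentiable_def has_derivative_transform_within_open)
  have e: "frechet_derivative f (at x) = frechet_derivative g (at x)" if "x \<in> S" for x
    using frechet_derivative_transform_within_open[OF d[OF that] \<open>open S\<close> that Suc.prems(1)] by simp
  have "Ck_on n S (\<lambda>x. frechet_derivative g (at x) h)" for h
    using Suc.IH[of "\<lambda>x. frechet_derivative f (at x) h" "\<lambda>x. frechet_derivative g (at x) h"] Suc.prems e by simp
  then show ?case using d' by simp
qed

text \<open>Every clause of the recursion is a condition at single points, including continuity at
  order 0 once neighbourhoods are open; hence it may be checked locally.\<close>

lemma Ck_on_local:
  assumes "\<And>x. x \<in> S \<Longrightarrow> \<exists>U. open U \<and> x \<in> U \<and> Ck_on n U f"
  shows "Ck_on n S f"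
  using assms
proof (induction n arbitrary: f)
  case 0
  show ?case
    by (metis "0" Ck_on.simps(1) continuous_at_imp_continuous_on continuous_on_eq_continuous_at)
next
  case (Suc n)
  have "f differentiable (at x)" if "x \<in> S" for x using Suc.prems[OF that] by auto
  moreover have "Ck_on n S (\<lambda>x. frechet_derivative f (at x) h)" for h
    by (rule Suc.IH) (use Suc.prems in force)
  ultimately show ?case by simp
qed

lemma frechet_derivative_eqI: "(f has_derivative f') (at x) \<Longrightarrow> frechet_derivative f (at x) h = f' h"
  by (metis frechet_derivative_at)

text \<open>The inductive proofs below exhibit a derivative \<open>f'\<close> explicitly; on an open
  set it can stand in for \<open>frechet_derivative\<close> at the next lower order.\<close>

lemma Ck_on_SucI:
  assumes "open S" "\<And>x. x \<in> S \<Longrightarrow> (f has_derivative f' x) (at x)"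
    and "\<And>h. Ck_on n S (\<lambda>x. f' x h)"
  shows "Ck_on (Suc n) S f"
proof -
  have "Ck_on n S (\<lambda>x. frechet_derivative f (at x) h)" for h
    by (rule Ck_on_cong[OF assms(1) _ assms(3)[of h]])
      (use assms(2) frechet_derivative_eqI in metis)
  then show ?thesis using assms(2) by (auto simp: differentiable_def)
qed

lemma Ck_on_SucD:
  assumes "Ck_on (Suc n) S f" "x \<in> S"
  shows "(f has_derivative frechet_derivative f (at x)) (at x)"
  using assms frechet_derivative_works by auto

lemma Ck_on_const: "open S \<Longrightarrow> Ck_on n S (\<lambda>x. c)"
proof (induction n arbitrary: c)
  case (Suc n)
  then show ?case by (intro Ck_on_SucI[where f' = "\<lambda>_ _. 0"]) auto
qed simp

lemma Ck_on_bounded_linear: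
  assumes "bounded_linear L" "open S"
  shows "Ck_on n S f \<Longrightarrow> Ck_on n S (\<lambda>x. L (f x))"
proof (induction n arbitrary: f)
  case 0
  then show ?case using assms by (simp add: bounded_linear.continuous_on)
next
  case (Suc n)
  show ?case
  proof (rule Ck_on_SucI[OF \<open>open S\<close>])
    show "((\<lambda>x. L (f x)) has_derivative (\<lambda>h. L (frechet_derivative f (at x) h))) (at x)" if "x \<in> S" for x
      by (intro bounded_linear.has_derivative[OF assms(1)] Ck_on_SucD[OF Suc.prems that])
    show "Ck_on n S (\<lambda>x. L (frechet_derivative f (at x) h))" for h
      using Suc by simp
  qed
qed

lemma Ck_on_add:
  assumes "open S"
  shows "Ck_on n S f \<Longrightarrow> Ck_on n S g \<Longrightarrow> Ck_on n S (\<lambda>x. f x + g x)"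
proof (induction n arbitrary: f g)
  case 0
  then show ?case by (simp add: continuous_on_add)
next
  case (Suc n)
  show ?case
  proof (rule Ck_on_SucI[OF \<open>open S\<close>])
    show "((\<lambda>x. f x + g x) has_derivative
        (\<lambda>h. frechet_derivative f (at x) h + frechet_derivative g (at x) h)) (at x)" if "x \<in> S" for x
      by (intro has_derivative_add Ck_on_SucD[OF Suc.prems(1) that] Ck_on_SucD[OF Suc.prems(2) that])
    show "Ck_on n S (\<lambda>x. frechet_derivative f (at x) h + frechet_derivative g (at x) h)" for h
      using Suc by simp
  qed
qed

lemma Ck_on_bounded_bilinear:
  assumes "bounded_bilinear B" "open S"
  shows "Ck_on n S f \<Longrightarrow> Ck_on n S g \<Longrightarrow> Ck_on n S (\<lambda>x. B (f x) (g x))"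
proof (induction n arbitrary: f g)
  case 0
  then show ?case using assms bounded_bilinear.continuous_on[OF assms(1)] by simp
next
  case (Suc n)
  show ?case
  proof (rule Ck_on_SucI[OF \<open>open S\<close>])
    show "((\<lambda>x. B (f x) (g x)) has_derivative
        (\<lambda>h. B (f x) (frechet_derivative g (at x) h) + B (frechet_derivative f (at x) h) (g x))) (at x)"
      if "x \<in> S" for x
      by (intro bounded_bilinear.FDERIV[OF assms(1)] Ck_on_SucD[OF Suc.prems(1) that] Ck_on_SucD[OF Suc.prems(2) that])
    have "Ck_on n S f" "Ck_on n S g" using Suc.prems Ck_on_Suc_lower by auto
    then show "Ck_on n S (\<lambda>x. B (f x) (frechet_derivative g (at x) h) + B (frechet_derivative f (at x) h) (g x))" for h
      using Suc by (intro Ck_on_add[OF \<open>open S\<close>]) auto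
  qed
qed

lemma Ck_on_sum:
  assumes "open S" "finite I" "\<And>i. i \<in> I \<Longrightarrow> Ck_on n S (f i)"
  shows "Ck_on n S (\<lambda>x. \<Sum>i\<in>I. f i x)"
  using assms(2,3)
  by (induction I rule: finite_induct) (auto intro!: Ck_on_const Ck_on_add \<open>open S\<close>)

lemma linear_euclidean_sum:
  fixes L :: "'a::euclidean_space \<Rightarrow> 'b::real_vector"
  assumes "linear L"
  shows "L x = (\<Sum>i\<in>Basis. (x \<bullet> i) *\<^sub>R L i)"
proof -
  have "L x = L (\<Sum>i\<in>Basis. (x \<bullet> i) *\<^sub>R i)" by (simp add: euclidean_representation)
  then show ?thesis by (simp add: linear_sum[OF assms] linear_scale[OF assms])
qed

text \<open>The chain rule applies the derivative of \<open>f\<close> in a direction that varies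
  with the point, while \<open>Ck_on\<close> speaks of fixed directions. Expanding in the basis
  gives products of scalar functions with fixed-direction derivatives of \<open>f\<close>; the
  latter come from the induction hypothesis, which therefore ranges over all
  \<open>f\<close>.\<close>

lemma Ck_on_compose:
  fixes f :: "'b::euclidean_space \<Rightarrow> 'c::real_normed_vector" and g :: "'a::euclidean_space \<Rightarrow> 'b"
  assumes "open S" "\<And>x. x \<in> S \<Longrightarrow> g x \<in> T"
  shows "Ck_on n T f \<Longrightarrow> Ck_on n S g \<Longrightarrow> Ck_on n S (\<lambda>x. f (g x))"
proof (induction n arbitrary: f)
  case 0
  then show ?case using assms by (auto intro: continuous_on_compose2)
next
  case (Suc n)
  note f = Ck_on_SucD[OF Suc.prems(1)] and g = Ck_on_SucD[OF Suc.prems(2)]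
  let ?f' = "\<lambda>y. frechet_derivative f (at y)" and ?g' = "\<lambda>x. frechet_derivative g (at x)"
  have L: "linear (?f' (g x))" if "x \<in> S" for x
    using f[OF assms(2)[OF that]] has_derivative_bounded_linear bounded_linear.linear by blast
  show ?case
  proof (rule Ck_on_SucI[OF \<open>open S\<close>])
    show "((\<lambda>x. f (g x)) has_derivative (\<lambda>h. \<Sum>i\<in>Basis. (?g' x h \<bullet> i) *\<^sub>R ?f' (g x) i)) (at x)" if "x \<in> S" for x
    proof -
      have "((\<lambda>x. f (g x)) has_derivative (\<lambda>h. ?f' (g x) (?g' x h))) (at x)"
        by (rule has_derivative_compose[OF g[OF that] f[OF assms(2)[OF that]]])
      then show ?thesis by (simp flip: linear_euclidean_sum[OF L[OF that]])
    qed
    show "Ck_on n S (\<lambda>x. \<Sum>i\<in>Basis. (?g' x h \<bullet> i) *\<^sub>R ?f' (g x) i)" for h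
    proof (rule Ck_on_sum[OF \<open>open S\<close> finite_Basis])
      fix i :: 'b assume "i \<in> Basis"
      have "Ck_on n S (\<lambda>x. ?g' x h \<bullet> i)"
        using Suc.prems(2) by (intro Ck_on_bounded_linear[OF bounded_linear_inner_left \<open>open S\<close>]) simp
      moreover have "Ck_on n S (\<lambda>x. ?f' (g x) i)"
        using Suc.prems by (intro Suc.IH Ck_on_Suc_lower[OF Suc.prems(2)]) simp
      ultimately show "Ck_on n S (\<lambda>x. (?g' x h \<bullet> i) *\<^sub>R ?f' (g x) i)"
        by (rule Ck_on_bounded_bilinear[OF bounded_bilinear_scaleR \<open>open S\<close>])
    qed
  qed
qed

section \<open>Smoothness as the conjunction of all finite orders\<close>

lemma smooth_on_subset: "smooth_on S f \<Longrightarrow> T \<subseteq> S \<Longrightarrow> smooth_on T f"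
  unfolding smooth_on_def using Ck_on_subset by blast

lemma smooth_on_cong: "open S \<Longrightarrow> (\<And>x. x \<in> S \<Longrightarrow> f x = g x) \<Longrightarrow> smooth_on S f \<Longrightarrow> smooth_on S g"
  unfolding smooth_on_def using Ck_on_cong by blast

lemma smooth_on_local:
  assumes "\<And>x. x \<in> S \<Longrightarrow> \<exists>U. open U \<and> x \<in> U \<and> smooth_on U f"
  shows "smooth_on S f"
  unfolding smooth_on_def
proof
  fix n show "Ck_on n S f" by (rule Ck_on_local) (use assms in \<open>auto simp: smooth_on_def\<close>)
qed

lemma smooth_on_continuous: "smooth_on S f \<Longrightarrow> continuous_on S f"
  unfolding smooth_on_def using Ck_on_continuous by blast

lemma smooth_on_has_derivative:
  "smooth_on S f \<Longrightarrow> x \<in> S \<Longrightarrow> (f has_derivative frechet_derivative f (at x)) (at x)"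
  unfolding smooth_on_def using Ck_on_SucD by blast

lemma smooth_on_linear: "smooth_on S f \<Longrightarrow> x \<in> S \<Longrightarrow> linear (frechet_derivative f (at x))"
  using smooth_on_has_derivative has_derivative_bounded_linear bounded_linear.linear by blast

lemma smooth_on_frechet_derivative:
  "smooth_on S f \<Longrightarrow> smooth_on S (\<lambda>x. frechet_derivative f (at x) h)"
  unfolding smooth_on_def using Ck_on.simps(2) by blast

lemma smooth_on_const: "open S \<Longrightarrow> smooth_on S (\<lambda>x. c)"
  by (simp add: smooth_on_def Ck_on_const)

lemma smooth_on_bounded_linear:
  "bounded_linear L \<Longrightarrow> open S \<Longrightarrow> smooth_on S f \<Longrightarrow> smooth_on S (\<lambda>x. L (f x))"
  by (simp add: smooth_on_def Ck_on_bounded_linear)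

lemma smooth_on_add: "open S \<Longrightarrow> smooth_on S f \<Longrightarrow> smooth_on S g \<Longrightarrow> smooth_on S (\<lambda>x. f x + g x)"
  by (simp add: smooth_on_def Ck_on_add)

lemma smooth_on_minus: "open S \<Longrightarrow> smooth_on S f \<Longrightarrow> smooth_on S (\<lambda>x. - f x)"
  using smooth_on_bounded_linear[OF bounded_linear_minus[OF bounded_linear_ident]] by blast

lemma smooth_on_diff: "open S \<Longrightarrow> smooth_on S f \<Longrightarrow> smooth_on S g \<Longrightarrow> smooth_on S (\<lambda>x. f x - g x)"
  using smooth_on_add[OF _ _ smooth_on_minus, of S f g] by simp

lemma smooth_on_sum:
  "open S \<Longrightarrow> finite I \<Longrightarrow> (\<And>i. i \<in> I \<Longrightarrow> smooth_on S (f i)) \<Longrightarrow> smooth_on S (\<lambda>x. \<Sum>i\<in>I. f i x)"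
  by (simp add: smooth_on_def Ck_on_sum)

lemma smooth_on_scaleR:
  "open S \<Longrightarrow> smooth_on S f \<Longrightarrow> smooth_on S g \<Longrightarrow> smooth_on S (\<lambda>x. f x *\<^sub>R g x)"
  by (simp add: smooth_on_def Ck_on_bounded_bilinear[OF bounded_bilinear_scaleR])

lemma smooth_on_mult:
  fixes f g :: "'a::euclidean_space \<Rightarrow> real"
  shows "open S \<Longrightarrow> smooth_on S f \<Longrightarrow> smooth_on S g \<Longrightarrow> smooth_on S (\<lambda>x. f x * g x)"
  by (simp add: smooth_on_def Ck_on_bounded_bilinear[OF bounded_bilinear_mult])

lemma smooth_on_inner:
  "open S \<Longrightarrow> smooth_on S f \<Longrightarrow> smooth_on S g \<Longrightarrow> smooth_on S (\<lambda>x. f x \<bullet> g x)"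
  by (simp add: smooth_on_def Ck_on_bounded_bilinear[OF bounded_bilinear_inner])

lemma smooth_on_compose:
  "open S \<Longrightarrow> (\<And>x. x \<in> S \<Longrightarrow> g x \<in> T) \<Longrightarrow> smooth_on T f \<Longrightarrow> smooth_on S g \<Longrightarrow> smooth_on S (\<lambda>x. f (g x))"
  unfolding smooth_on_def using Ck_on_compose[of S g T] by blast

text \<open>Smooth derivatives give order \<open>n + 1\<close> for every \<open>n\<close>, and order
  \<open>n + 1\<close> contains order \<open>n\<close>.\<close>

lemma smooth_on_I:
  assumes "\<And>x. x \<in> S \<Longrightarrow> f differentiable (at x)"
    and "\<And>h. smooth_on S (\<lambda>x. frechet_derivative f (at x) h)"
  shows "smooth_on S f"
  unfolding smooth_on_def
proof
  fix n
  have "Ck_on (Suc n) S f" using assms by (simp add: smooth_on_def)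
  then show "Ck_on n S f" by (rule Ck_on_Suc_lower)
qed

lemma smooth_on_ident: "open S \<Longrightarrow> smooth_on S (\<lambda>x. x)"
  by (rule smooth_on_I) (simp_all add: smooth_on_const)

lemma smooth_on_linear_map:
  fixes L :: "'a::euclidean_space \<Rightarrow> 'b::real_normed_vector"
  assumes "bounded_linear L" "open S" shows "smooth_on S L"
  using smooth_on_bounded_linear[OF assms smooth_on_ident[OF assms(2)]] .

lemma smooth_on_Pair:
  assumes "open S" "smooth_on S f" "smooth_on S g"
  shows "smooth_on S (\<lambda>x. (f x, g x))"
proof -
  have "smooth_on S (\<lambda>x. (f x, 0) + (0, g x))"
    by (intro smooth_on_add assms smooth_on_bounded_linear[of "\<lambda>y. (y, 0)"]
        smooth_on_bounded_linear[of "\<lambda>y. (0, y)"])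
      (auto intro!: bounded_linear_Pair bounded_linear_ident bounded_linear_zero)
  then show ?thesis by simp
qed

text \<open>Both the point and the direction vary. Linearity in the direction reduces this to
  finitely many fixed directions, as in \<open>Ck_on_compose\<close>.\<close>

lemma smooth_on_frechet_derivative_apply:
  fixes f :: "'b::euclidean_space \<Rightarrow> 'c::real_normed_vector" and g :: "'a::euclidean_space \<Rightarrow> 'b"
  assumes "open S" "\<And>x. x \<in> S \<Longrightarrow> g x \<in> T" "smooth_on T f" "smooth_on S g" "smooth_on S k"
  shows "smooth_on S (\<lambda>x. frechet_derivative f (at (g x)) (k x))"
proof (rule smooth_on_cong[OF \<open>open S\<close>])
  show "(\<Sum>i\<in>Basis. (k x \<bullet> i) *\<^sub>R frechet_derivative f (at (g x)) i) = frechet_derivative f (at (g x)) (k x)"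
    if "x \<in> S" for x
    by (rule linear_euclidean_sum[OF smooth_on_linear[OF assms(3) assms(2)[OF that]], symmetric])
  show "smooth_on S (\<lambda>x. \<Sum>i\<in>Basis. (k x \<bullet> i) *\<^sub>R frechet_derivative f (at (g x)) i)"
  proof (rule smooth_on_sum[OF assms(1) finite_Basis])
    fix i :: 'b
    have "smooth_on S (\<lambda>x. frechet_derivative f (at (g x)) i)"
      by (rule smooth_on_compose[OF assms(1,2) smooth_on_frechet_derivative[OF assms(3)] assms(4)])
    moreover have "smooth_on S (\<lambda>x. k x \<bullet> i)"
      by (intro smooth_on_inner smooth_on_const assms)
    ultimately show "smooth_on S (\<lambda>x. (k x \<bullet> i) *\<^sub>R frechet_derivative f (at (g x)) i)"
      by (intro smooth_on_scaleR assms)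
  qed
qed

section \<open>Second derivatives and their symmetry\<close>

definition hessian :: "('a::euclidean_space \<Rightarrow> 'b::real_normed_vector) \<Rightarrow> 'a \<Rightarrow> 'a \<Rightarrow> 'a \<Rightarrow> 'b" where
  "hessian f x u w = frechet_derivative (\<lambda>y. frechet_derivative f (at y) w) (at x) u"

text \<open>A product rule for a linear map that varies with the point: the Hessian accounts for the
  motion of the base point. The form \<open>at x within S\<close> lets it serve at the endpoints of
  a closed parameter interval too.\<close>

lemma has_derivative_frechet_derivative_apply:
  fixes f :: "'b::euclidean_space \<Rightarrow> 'c::real_normed_vector" and g :: "'a::euclidean_space \<Rightarrow> 'b"
  assumes T: "open T" "smooth_on T f"
    and g: "(g has_derivative g') (at x within S)" "g x \<in> T" and k: "(k has_derivative k') (at x within S)"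
    and x: "x \<in> S"
  shows "((\<lambda>y. frechet_derivative f (at (g y)) (k y)) has_derivative
     (\<lambda>h. hessian f (g x) (g' h) (k x) + frechet_derivative f (at (g x)) (k' h))) (at x within S)"
proof -
  let ?D = "\<lambda>y. frechet_derivative f (at y)"
  have L: "linear (?D y)" if "y \<in> T" for y using smooth_on_linear[OF T(2) that] .
  have D: "((\<lambda>y. ?D y i) has_derivative (\<lambda>u. hessian f y u i)) (at y)" if "y \<in> T" for y i
    unfolding hessian_def by (rule smooth_on_has_derivative[OF smooth_on_frechet_derivative[OF T(2)] that])
  \<comment> \<open>The Hessian is defined for one fixed \<open>w\<close> at a time; its linearity
    in \<open>w\<close> comes from differentiating the basis expansion of the inner
    derivative.\<close>
  have h: "hessian f (g x) u w = (\<Sum>i\<in>Basis. (w \<bullet> i) *\<^sub>R hessian f (g x) u i)" for u w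
  proof -
    have "((\<lambda>y. \<Sum>i\<in>Basis. (w \<bullet> i) *\<^sub>R ?D y i) has_derivative (\<lambda>u. \<Sum>i\<in>Basis. (w \<bullet> i) *\<^sub>R hessian f (g x) u i)) (at (g x))"
      by (intro has_derivative_sum has_derivative_scaleR_right D g)
    then have "((\<lambda>y. ?D y w) has_derivative (\<lambda>u. \<Sum>i\<in>Basis. (w \<bullet> i) *\<^sub>R hessian f (g x) u i)) (at (g x))"
      by (rule has_derivative_transform_within_open[OF _ T(1) g(2)])
        (rule linear_euclidean_sum[OF L, symmetric])
    then show ?thesis using frechet_derivative_eqI unfolding hessian_def by fast
  qed
  have "((\<lambda>y. \<Sum>i\<in>Basis. (k y \<bullet> i) *\<^sub>R ?D (g y) i) has_derivative
      (\<lambda>h. \<Sum>i\<in>Basis. (k x \<bullet> i) *\<^sub>R hessian f (g x) (g' h) i + (k' h \<bullet> i) *\<^sub>R ?D (g x) i)) (at x within S)"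
    by (intro has_derivative_sum has_derivative_scaleR has_derivative_inner_left k
        has_derivative_compose[OF g(1) D] g(2))
  then have main: "((\<lambda>y. \<Sum>i\<in>Basis. (k y \<bullet> i) *\<^sub>R ?D (g y) i) has_derivative
      (\<lambda>u. hessian f (g x) (g' u) (k x) + ?D (g x) (k' u))) (at x within S)"
    by (simp add: sum.distrib flip: h linear_euclidean_sum[OF L[OF g(2)]])
  have ev: "eventually (\<lambda>y. g y \<in> T) (at x within S)"
    using has_derivative_continuous[OF g(1)] T(1) g(2)
    by (simp add: continuous_within topological_tendstoD)
  show ?thesis
  proof (rule has_derivative_transform_eventually[OF main])
    show "\<forall>\<^sub>F y in at x within S. (\<Sum>i\<in>Basis. (k y \<bullet> i) *\<^sub>R ?D (g y) i) = ?D (g y) (k y)"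
      using ev by eventually_elim (rule linear_euclidean_sum[OF L, symmetric])
    show "(\<Sum>i\<in>Basis. (k x \<bullet> i) *\<^sub>R ?D (g x) i) = ?D (g x) (k x)"
      by (rule linear_euclidean_sum[OF L[OF g(2)], symmetric])
    show "x \<in> S" by (rule x)
  qed
qed

text \<open>Mean value theorem twice: along \<open>u\<close> for the difference of \<open>f\<close>
  across the edge \<open>h *\<^sub>R w\<close>, then along \<open>w\<close> for the derivative of
  \<open>f\<close> in direction \<open>u\<close>.\<close>

lemma second_difference:
  fixes f :: "'a::euclidean_space \<Rightarrow> real"
  assumes f: "smooth_on T f" and h: "h > 0"
    and T: "\<And>s t. 0 \<le> s \<Longrightarrow> s \<le> h \<Longrightarrow> 0 \<le> t \<Longrightarrow> t \<le> h \<Longrightarrow> x + s *\<^sub>R u + t *\<^sub>R w \<in> T"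
  obtains s t where "0 \<le> s" "s \<le> h" "0 \<le> t" "t \<le> h"
    "f (x + h *\<^sub>R u + h *\<^sub>R w) - f (x + h *\<^sub>R u) - f (x + h *\<^sub>R w) + f x
      = h * h * hessian f (x + s *\<^sub>R u + t *\<^sub>R w) w u"
proof -
  let ?D = "\<lambda>y. frechet_derivative f (at y)"
  have dp: "((\<lambda>s. f (x + s *\<^sub>R u + t *\<^sub>R w)) has_real_derivative ?D (x + s *\<^sub>R u + t *\<^sub>R w) u) (at s)"
    if "0 \<le> s" "s \<le> h" "0 \<le> t" "t \<le> h" for s t
  proof -
    have "((\<lambda>s. x + s *\<^sub>R u + t *\<^sub>R w) has_derivative (\<lambda>d. d *\<^sub>R u)) (at s)"
      by (auto intro!: derivative_eq_intros)
    from has_derivative_compose[OF this smooth_on_has_derivative[OF f T[OF that]]]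
    show ?thesis
      by (simp add: has_field_derivative_def linear_scale[OF smooth_on_linear[OF f T[OF that]]] mult_commute_abs)
  qed
  have "\<exists>s>0. s < h \<and> (f (x + h *\<^sub>R u + h *\<^sub>R w) - f (x + h *\<^sub>R u + 0 *\<^sub>R w)) - (f (x + 0 *\<^sub>R u + h *\<^sub>R w) - f (x + 0 *\<^sub>R u + 0 *\<^sub>R w))
      = (h - 0) * (?D (x + s *\<^sub>R u + h *\<^sub>R w) u - ?D (x + s *\<^sub>R u + 0 *\<^sub>R w) u)"
    by (rule MVT2[OF h]) (intro DERIV_diff dp; use h in simp)
  then obtain s where s: "0 < s" "s < h" and 1: "(f (x + h *\<^sub>R u + h *\<^sub>R w) - f (x + h *\<^sub>R u + 0 *\<^sub>R w)) - (f (x + 0 *\<^sub>R u + h *\<^sub>R w) - f (x + 0 *\<^sub>R u + 0 *\<^sub>R w))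
      = (h - 0) * (?D (x + s *\<^sub>R u + h *\<^sub>R w) u - ?D (x + s *\<^sub>R u + 0 *\<^sub>R w) u)" by blast
  have dq: "((\<lambda>t. ?D (x + s *\<^sub>R u + t *\<^sub>R w) u) has_real_derivative hessian f (x + s *\<^sub>R u + t *\<^sub>R w) w u) (at t)"
    if "0 \<le> t" "t \<le> h" for t
  proof -
    have z: "x + s *\<^sub>R u + t *\<^sub>R w \<in> T" using T s that by simp
    note f' = smooth_on_frechet_derivative[OF f, of u]
    have "((\<lambda>t. x + s *\<^sub>R u + t *\<^sub>R w) has_derivative (\<lambda>d. d *\<^sub>R w)) (at t)"
      by (auto intro!: derivative_eq_intros)
    from has_derivative_compose[OF this smooth_on_has_derivative[OF f' z]]
    show ?thesis unfolding hessian_def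
      by (simp add: has_field_derivative_def linear_scale[OF smooth_on_linear[OF f' z]] mult_commute_abs)
  qed
  have "\<exists>t>0. t < h \<and> ?D (x + s *\<^sub>R u + h *\<^sub>R w) u - ?D (x + s *\<^sub>R u + 0 *\<^sub>R w) u
      = (h - 0) * hessian f (x + s *\<^sub>R u + t *\<^sub>R w) w u"
    by (rule MVT2[OF h]) (rule dq)
  then obtain t where t: "0 < t" "t < h" and 2: "?D (x + s *\<^sub>R u + h *\<^sub>R w) u - ?D (x + s *\<^sub>R u + 0 *\<^sub>R w) u
      = (h - 0) * hessian f (x + s *\<^sub>R u + t *\<^sub>R w) w u" by blast
  have "f (x + h *\<^sub>R u + h *\<^sub>R w) - f (x + h *\<^sub>R u) - f (x + h *\<^sub>R w) + f x
      = h * h * hessian f (x + s *\<^sub>R u + t *\<^sub>R w) w u"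
    using 1 unfolding 2 by simp
  then show ?thesis by (rule that[rotated -1]) (use s t in auto)
qed

text \<open>The second difference is unchanged when \<open>u\<close> and \<open>w\<close> are
  exchanged, so the Hessian in one order at one point of a small parallelogram equals the Hessian in
  the other order at another point. Continuity moves both to \<open>x\<close>.\<close>

lemma hessian_symmetric_real:
  fixes f :: "'a::euclidean_space \<Rightarrow> real"
  assumes T: "open T" "x \<in> T" and f: "smooth_on T f"
  shows "hessian f x u w = hessian f x w u"
proof (rule ccontr)
  assume ne: "hessian f x u w \<noteq> hessian f x w u"
  \<comment> \<open>Half the supposed gap: two deviations below \<open>e\<close> contradict the
    triangle inequality.\<close>
  define e where "e = \<bar>hessian f x u w - hessian f x w u\<bar> / 2"
  have e: "e > 0" using ne by (simp add: e_def)
  have c: "isCont (\<lambda>z. hessian f z a b) x" for a b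
    using smooth_on_continuous[OF smooth_on_frechet_derivative[OF smooth_on_frechet_derivative[OF f]]] T
    unfolding hessian_def using continuous_on_eq_continuous_at by blast
  obtain d1 where d1: "d1 > 0" "\<And>z. dist z x < d1 \<Longrightarrow> dist (hessian f z u w) (hessian f x u w) < e"
    using c[of u w] e unfolding continuous_at_eps_delta by blast
  obtain d2 where d2: "d2 > 0" "\<And>z. dist z x < d2 \<Longrightarrow> dist (hessian f z w u) (hessian f x w u) < e"
    using c[of w u] e unfolding continuous_at_eps_delta by blast
  obtain d3 where d3: "d3 > 0" "ball x d3 \<subseteq> T" using T open_contains_ball by blast
  define d where "d = min d1 (min d2 d3)"
  \<comment> \<open>The summand 1 keeps the divisor positive when \<open>u = w = 0\<close>; the
    factor 2 in \<open>h\<close> leaves room for a strict bound by \<open>d\<close>.\<close>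
  define N where "N = norm u + norm w + 1"
  define h where "h = d / (2 * N)"
  have d: "d > 0" using d1 d2 d3 by (simp add: d_def)
  have nz: "N > 0" unfolding N_def by (smt (verit) norm_ge_zero)
  have h: "h > 0" using d nz by (simp add: h_def)
  have near: "dist (x + s *\<^sub>R u + t *\<^sub>R w) x < d" if "0 \<le> s" "s \<le> h" "0 \<le> t" "t \<le> h" for s t
  proof -
    have "dist (x + s *\<^sub>R u + t *\<^sub>R w) x = norm (s *\<^sub>R u + t *\<^sub>R w)" by (simp add: dist_norm add.assoc)
    also have "\<dots> \<le> s * norm u + t * norm w" using that norm_triangle_ineq[of "s *\<^sub>R u" "t *\<^sub>R w"] by simp
    also have "\<dots> \<le> h * norm u + h * norm w" using that by (intro add_mono mult_right_mono) auto
    also have "\<dots> \<le> h * N" using h by (simp add: N_def algebra_simps)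
    also have "\<dots> = d / 2" using nz by (simp add: h_def)
    also have "\<dots> < d" using d by simp
    finally show ?thesis .
  qed
  have inT: "x + s *\<^sub>R u + t *\<^sub>R w \<in> T" if "0 \<le> s" "s \<le> h" "0 \<le> t" "t \<le> h" for s t
    using near[OF that] d3 by (auto simp: d_def dist_commute)
  have inT': "x + s *\<^sub>R w + t *\<^sub>R u \<in> T" if "0 \<le> s" "s \<le> h" "0 \<le> t" "t \<le> h" for s t
    using inT[OF that(3,4,1,2)] by (simp add: algebra_simps)
  obtain s t where st: "0 \<le> s" "s \<le> h" "0 \<le> t" "t \<le> h"
    and 1: "f (x + h *\<^sub>R u + h *\<^sub>R w) - f (x + h *\<^sub>R u) - f (x + h *\<^sub>R w) + f x
      = h * h * hessian f (x + s *\<^sub>R u + t *\<^sub>R w) w u"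
    by (rule second_difference[OF f h, of x u w]; use inT in blast)
  obtain s' t' where st': "0 \<le> s'" "s' \<le> h" "0 \<le> t'" "t' \<le> h"
    and 2: "f (x + h *\<^sub>R w + h *\<^sub>R u) - f (x + h *\<^sub>R w) - f (x + h *\<^sub>R u) + f x
      = h * h * hessian f (x + s' *\<^sub>R w + t' *\<^sub>R u) u w"
    by (rule second_difference[OF f h, of x w u]; use inT' in blast)
  have comm: "x + h *\<^sub>R w + h *\<^sub>R u = x + h *\<^sub>R u + h *\<^sub>R w" "x + s' *\<^sub>R w + t' *\<^sub>R u = x + t' *\<^sub>R u + s' *\<^sub>R w"
    by (simp_all add: algebra_simps)
  have "h * h * hessian f (x + s *\<^sub>R u + t *\<^sub>R w) w u = h * h * hessian f (x + t' *\<^sub>R u + s' *\<^sub>R w) u w"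
    using 1 2 unfolding comm by linarith
  then have "hessian f (x + s *\<^sub>R u + t *\<^sub>R w) w u = hessian f (x + t' *\<^sub>R u + s' *\<^sub>R w) u w"
    using h by simp
  moreover have "dist (hessian f (x + s *\<^sub>R u + t *\<^sub>R w) w u) (hessian f x w u) < e"
    using d2(2) near[OF st] by (simp add: d_def)
  moreover have "dist (hessian f (x + t' *\<^sub>R u + s' *\<^sub>R w) u w) (hessian f x u w) < e"
    using d1(2) near[OF st'(3,4,1,2)] by (simp add: d_def)
  moreover have "2 * e = dist (hessian f x u w) (hessian f x w u)" by (simp add: e_def dist_real_def)
  ultimately show False
    using dist_triangle3[of "hessian f x u w" "hessian f x w u" "hessian f (x + s *\<^sub>R u + t *\<^sub>R w) w u"] by simp
qed

text \<open>Componentwise from the real case, as the inner product with \<open>b\<close> commutes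
  with both differentiations.\<close>

lemma hessian_symmetric:
  fixes f :: "'a::euclidean_space \<Rightarrow> 'b::euclidean_space"
  assumes T: "open T" "x \<in> T" and f: "smooth_on T f"
  shows "hessian f x u w = hessian f x w u"
proof (rule euclidean_eqI)
  fix b :: 'b
  have sm: "smooth_on T (\<lambda>y. f y \<bullet> b)"
    by (rule smooth_on_bounded_linear[OF bounded_linear_inner_left T(1) f])
  have eq: "frechet_derivative (\<lambda>y. f y \<bullet> b) (at y) v = frechet_derivative f (at y) v \<bullet> b" if "y \<in> T" for y v
    by (rule frechet_derivative_eqI) (intro has_derivative_inner_left smooth_on_has_derivative[OF f that])
  have h: "hessian (\<lambda>y. f y \<bullet> b) x v z = hessian f x v z \<bullet> b" for v z
  proof -
    have "((\<lambda>y. frechet_derivative f (at y) z \<bullet> b) has_derivative (\<lambda>v. hessian f x v z \<bullet> b)) (at x)"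
      unfolding hessian_def
      by (intro has_derivative_inner_left smooth_on_has_derivative[OF smooth_on_frechet_derivative[OF f] T(2)])
    then have "((\<lambda>y. frechet_derivative (\<lambda>y. f y \<bullet> b) (at y) z) has_derivative (\<lambda>v. hessian f x v z \<bullet> b)) (at x)"
      by (rule has_derivative_transform_within_open[OF _ T]) (simp add: eq)
    then show ?thesis unfolding hessian_def[of "\<lambda>y. f y \<bullet> b"] by (rule frechet_derivative_eqI)
  qed
  show "hessian f x u w \<bullet> b = hessian f x w u \<bullet> b"
    using hessian_symmetric_real[OF T sm, of u w] by (simp add: h)
qed

section \<open>Flat functions and bumps on Euclidean space\<close>

text \<open>The classical flat function \<open>exp (- (1 / t))\<close> with polynomial factors in
  \<open>1 / t\<close>: with these the family is closed under differentiation, so smoothness can be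
  proved for all \<open>p\<close> at once.\<close>

definition flat_exp :: "real poly \<Rightarrow> real \<Rightarrow> real" where
  "flat_exp p t = (if t > 0 then poly p (1 / t) * exp (- (1 / t)) else 0)"

text \<open>With \<open>s = 1 / t\<close> the chain rule contributes \<open>- (s * s)\<close>,
  whence the factor \<open>[:0, 0, 1:]\<close>, the square of the variable, in front of
  \<open>p - pderiv p\<close>. At \<open>t = 0\<close> the exponential beats every
  polynomial.\<close>

lemma flat_exp_has_derivative:
  "(flat_exp p has_real_derivative flat_exp ([:0, 0, 1:] * (p - pderiv p)) t) (at t)"
proof -
  define q where "q = [:0, 0, 1:] * (p - pderiv p)"
  have q: "poly q s = s * s * (poly p s - poly (pderiv p) s)" for s
    by (simp add: q_def algebra_simps)
  have "(flat_exp p has_real_derivative flat_exp q t) (at t)"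
  proof -
    consider "t > 0" | "t < 0" | "t = 0" by linarith
    then show ?thesis
    proof cases
      case 1
      have 2: "((\<lambda>t. 1 / t) has_real_derivative - (1 / t * (1 / t))) (at t)"
        using 1 by (auto intro!: derivative_eq_intros)
      have "((\<lambda>t. poly p (1 / t) * exp (- (1 / t))) has_real_derivative
          poly (pderiv p) (1 / t) * - (1 / t * (1 / t)) * exp (- (1 / t)) +
          exp (- (1 / t)) * - (- (1 / t * (1 / t))) * poly p (1 / t)) (at t)"
        by (rule DERIV_mult[OF DERIV_chain2[OF poly_DERIV 2] DERIV_chain2[OF DERIV_exp DERIV_minus[OF 2]]])
      moreover have "poly (pderiv p) (1 / t) * - (1 / t * (1 / t)) * exp (- (1 / t)) +
          exp (- (1 / t)) * - (- (1 / t * (1 / t))) * poly p (1 / t) = flat_exp q t"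
        using 1 by (simp add: flat_exp_def q field_simps)
      ultimately have d: "((\<lambda>t. poly p (1 / t) * exp (- (1 / t))) has_real_derivative flat_exp q t) (at t)"
        by simp
      show ?thesis
        by (rule has_field_derivative_transform_within_open[OF d open_greaterThan[of 0]])
          (use 1 in \<open>auto simp: flat_exp_def\<close>)
    next
      case 2
      have d: "((\<lambda>t. 0) has_real_derivative flat_exp q t) (at t)"
        using 2 by (simp add: flat_exp_def)
      show ?thesis
        by (rule has_field_derivative_transform_within_open[OF d open_lessThan[of 0]])
          (use 2 in \<open>auto simp: flat_exp_def\<close>)
    next
      case 3
      have poly_exp: "((\<lambda>s. poly q s * exp (- s)) \<longlongrightarrow> 0) at_top" for q :: "real poly"
      proof -
        have "((\<lambda>s. \<Sum>i\<le>degree q. coeff q i * (s ^ i / exp s)) \<longlongrightarrow> (\<Sum>i\<le>degree q. coeff q i * 0)) at_top"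
          by (intro tendsto_sum tendsto_mult tendsto_const tendsto_power_div_exp_0)
        then show ?thesis by (simp add: poly_altdef sum_distrib_right exp_minus divide_inverse mult.assoc)
      qed
      \<comment> \<open>The difference quotient at 0 has an extra factor \<open>1 / h\<close>;
        \<open>pCons 0 p\<close>, which is the variable times \<open>p\<close>, absorbs it.\<close>
      have "((\<lambda>h. poly (pCons 0 p) (inverse h) * exp (- inverse h)) \<longlongrightarrow> 0) (at_right 0)"
        by (rule filterlim_compose[OF poly_exp filterlim_inverse_at_top_right])
      then have "((\<lambda>h. (flat_exp p (0 + h) - flat_exp p 0) / h) \<longlongrightarrow> 0) (at_right 0)"
        by (rule Lim_transform_eventually)
          (auto simp: flat_exp_def eventually_at_right_less field_simps intro!: eventually_mono[OF eventually_at_right_less])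
      moreover have "((\<lambda>h. (flat_exp p (0 + h) - flat_exp p 0) / h) \<longlongrightarrow> 0) (at_left 0)"
        by (rule Lim_transform_eventually[OF tendsto_const])
          (auto simp: flat_exp_def eventually_at_filter)
      ultimately have "((\<lambda>h. (flat_exp p (0 + h) - flat_exp p 0) / h) \<longlongrightarrow> 0) (at 0)"
        by (simp add: filterlim_split_at)
      then show ?thesis using 3 by (simp add: DERIV_def flat_exp_def)
    qed
  qed
  then show ?thesis by (simp only: q_def)
qed

lemma smooth_on_flat_exp: "smooth_on UNIV (flat_exp p)"
  unfolding smooth_on_def
proof
  fix n show "Ck_on n UNIV (flat_exp p)"
  proof (induction n arbitrary: p)
    case 0
    have "isCont (flat_exp p) t" for t by (rule DERIV_isCont[OF flat_exp_has_derivative])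
    then show ?case by (simp add: continuous_at_imp_continuous_on)
  next
    case (Suc n)
    show ?case
    proof (rule Ck_on_SucI[OF open_UNIV])
      show "(flat_exp p has_derivative (\<lambda>h. flat_exp ([:0, 0, 1:] * (p - pderiv p)) t * h)) (at t)" for t
        using flat_exp_has_derivative unfolding has_field_derivative_def .
      show "Ck_on n UNIV (\<lambda>t. flat_exp ([:0, 0, 1:] * (p - pderiv p)) t * h)" for h
        by (rule Ck_on_bounded_linear[OF bounded_linear_mult_left open_UNIV Suc.IH])
    qed
  qed
qed

lemma bump_function:
  fixes x :: "'a::euclidean_space"
  assumes "r > 0"
  obtains \<beta> :: "'a \<Rightarrow> real" where "smooth_on UNIV \<beta>" "\<And>y. dist y x \<le> r \<Longrightarrow> \<beta> y = 1"
    "\<And>y. dist y x \<ge> 2 * r \<Longrightarrow> \<beta> y = 0"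
proof -
  define f where "f = flat_exp 1"
  have f0: "f t = 0" if "t \<le> 0" for t using that by (simp add: f_def flat_exp_def)
  have f1: "f t > 0" if "t > 0" for t using that by (simp add: f_def flat_exp_def)
  have mono: "f t \<ge> f 1" if "t \<ge> 1" for t using that by (simp add: f_def flat_exp_def)
  have sf: "smooth_on UNIV f" by (simp add: f_def smooth_on_flat_exp)
  \<comment> \<open>Cutting off the cut-off: \<open>f 1 - f t\<close> is constant for \<open>t \<le> 0\<close> and non-positive for \<open>t \<ge> 1\<close>.\<close>
  define \<psi> where "\<psi> t = f (f 1 - f t) / f (f 1)" for t
  have "smooth_on UNIV (\<lambda>t. f 1 - f t)"
    by (rule smooth_on_diff[OF open_UNIV smooth_on_const[OF open_UNIV] sf])
  from smooth_on_compose[OF open_UNIV UNIV_I sf this]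
  have s\<psi>: "smooth_on UNIV \<psi>"
    unfolding \<psi>_def by (rule smooth_on_bounded_linear[OF bounded_linear_divide open_UNIV])
  \<comment> \<open>The squared distance is smooth at the centre too. Rescaled like this,
    \<open>q\<close> is at most 0 on the ball of radius \<open>r\<close> and at least 3 from
    distance \<open>2 * r\<close> on, where \<psi> is 1 and 0 respectively.\<close>
  define q where "q y = ((y - x) \<bullet> (y - x)) / r\<^sup>2 - 1" for y
  have d: "smooth_on UNIV (\<lambda>y. y - x)"
    by (rule smooth_on_diff[OF open_UNIV smooth_on_ident smooth_on_const]) auto
  have sq: "smooth_on UNIV q"
    unfolding q_def
    by (rule smooth_on_diff[OF open_UNIV smooth_on_bounded_linear[OF bounded_linear_divide open_UNIV
            smooth_on_inner[OF open_UNIV d d]] smooth_on_const[OF open_UNIV]])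
  have q: "q y = (dist y x / r)\<^sup>2 - 1" for y
    by (simp add: q_def dist_norm power_divide power2_norm_eq_inner)
  show ?thesis
  proof
    show "smooth_on UNIV (\<lambda>y. \<psi> (q y))"
      by (rule smooth_on_compose[OF _ _ s\<psi> sq]) auto
    show "\<psi> (q y) = 1" if "dist y x \<le> r" for y
    proof -
      have "(dist y x / r)\<^sup>2 \<le> 1\<^sup>2" using that assms by (intro power_mono) auto
      then have "f (q y) = 0" using f0 by (simp add: q)
      then show ?thesis using f1[OF f1[of 1]] by (simp add: \<psi>_def)
    qed
    show "\<psi> (q y) = 0" if "dist y x \<ge> 2 * r" for y
    proof -
      have "2\<^sup>2 \<le> (dist y x / r)\<^sup>2" using that assms by (intro power_mono) (auto simp: field_simps)
      then have "f (q y) \<ge> f 1" using mono by (simp add: q)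
      then show ?thesis by (simp add: \<psi>_def f0)
    qed
  qed
qed

section \<open>Charts, vector fields and their extensions\<close>

locale smooth_manifold =
  fixes \<A> :: "('m::{t2_space, second_countable_topology}, 'e::euclidean_space) chart set"
  assumes atlas: "smooth_atlas \<A>"
begin

section \<open>Charts and the cocycle of transition derivatives\<close>

lemma chart_at_in: "chart_at \<A> p \<in> \<A>" and mem_chart_at: "p \<in> dom_of (chart_at \<A> p)"
proof -
  have "\<exists>c. c \<in> \<A> \<and> p \<in> dom_of c" using atlas unfolding smooth_atlas_def by blast
  from someI_ex[OF this] show "chart_at \<A> p \<in> \<A>" "p \<in> dom_of (chart_at \<A> p)"
    unfolding chart_at_def by auto
qed

context
  fixes c assumes c: "c \<in> \<A>"
begin

lemma open_dom: "open (dom_of c)"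
  using atlas c unfolding smooth_atlas_def is_chart_def by blast

lemma chart_homeomorphism: "homeomorphism (dom_of c) (map_of_chart c ` dom_of c) (map_of_chart c) (chart_inv c)"
  using atlas c unfolding smooth_atlas_def is_chart_def by blast

lemma chart_inv_left: "p \<in> dom_of c \<Longrightarrow> chart_inv c (map_of_chart c p) = p"
  using homeomorphism_apply1[OF chart_homeomorphism] .

lemma continuous_on_chart: "continuous_on (dom_of c) (map_of_chart c)"
  using homeomorphism_cont1[OF chart_homeomorphism] .

lemma continuous_on_chart_inv: "continuous_on (map_of_chart c ` dom_of c) (chart_inv c)"
  using homeomorphism_cont2[OF chart_homeomorphism] .

lemma open_chart_range: "open (map_of_chart c ` dom_of c)"
  using atlas c unfolding smooth_atlas_def is_chart_def by blast

lemma open_chart_image: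
  assumes "open U" "U \<subseteq> dom_of c"
  shows "open (map_of_chart c ` U)"
proof -
  have "map_of_chart c ` U = map_of_chart c ` dom_of c \<inter> chart_inv c -` U"
    using chart_inv_left assms(2) by force
  then show ?thesis
    using continuous_open_preimage[OF continuous_on_chart_inv open_chart_range assms(1)] by simp
qed

lemma open_chart_preimage:
  assumes "open V" shows "open (dom_of c \<inter> map_of_chart c -` V)"
  using continuous_open_preimage[OF continuous_on_chart open_dom assms] .

lemma open_dom_Int: "open U \<Longrightarrow> open (dom_of c \<inter> U)"
  using open_dom by (rule open_Int)

end

lemma open_overlap:
  "c \<in> \<A> \<Longrightarrow> d \<in> \<A> \<Longrightarrow> open (map_of_chart c ` (dom_of c \<inter> dom_of d))"
  by (intro open_chart_image open_Int open_dom) auto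

lemma transition_smooth:
  "c \<in> \<A> \<Longrightarrow> d \<in> \<A> \<Longrightarrow> smooth_on (map_of_chart c ` (dom_of c \<inter> dom_of d)) (map_of_chart d \<circ> chart_inv c)"
  using atlas unfolding smooth_atlas_def by blast

lemma transition_has_derivative:
  assumes "c \<in> \<A>" "d \<in> \<A>" "p \<in> dom_of c" "p \<in> dom_of d"
  shows "((map_of_chart d \<circ> chart_inv c) has_derivative transition_deriv c d p) (at (map_of_chart c p))"
  unfolding transition_deriv_def
  by (rule smooth_on_has_derivative[OF transition_smooth[OF assms(1,2)]]) (use assms in auto)

lemma linear_transition_deriv:
  assumes "c \<in> \<A>" "d \<in> \<A>" "p \<in> dom_of c" "p \<in> dom_of d"
  shows "linear (transition_deriv c d p)"
  using transition_has_derivative[OF assms] has_derivative_bounded_linear bounded_linear.linear by blast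

text \<open>Chain rule. The composite of the two transition maps agrees with the direct one only on
  the part of the chart image that lies over \<open>d\<close>; this part is open by
  \<open>open_overlap\<close>.\<close>

lemma transition_deriv_trans:
  assumes "c \<in> \<A>" "d \<in> \<A>" "e \<in> \<A>" "p \<in> dom_of c" "p \<in> dom_of d" "p \<in> dom_of e"
  shows "transition_deriv d e p (transition_deriv c d p u) = transition_deriv c e p u"
proof -
  have x: "(map_of_chart d \<circ> chart_inv c) (map_of_chart c p) = map_of_chart d p"
    using assms by (simp add: chart_inv_left)
  have "((\<lambda>x. (map_of_chart e \<circ> chart_inv d) ((map_of_chart d \<circ> chart_inv c) x)) has_derivative
      (\<lambda>u. transition_deriv d e p (transition_deriv c d p u))) (at (map_of_chart c p))"
    by (rule has_derivative_compose[OF transition_has_derivative[OF assms(1,2,4,5)]])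
      (unfold x, rule transition_has_derivative[OF assms(2,3,5,6)])
  then have "((map_of_chart e \<circ> chart_inv c) has_derivative
      (\<lambda>u. transition_deriv d e p (transition_deriv c d p u))) (at (map_of_chart c p))"
    by (rule has_derivative_transform_within_open[OF _ open_overlap[OF assms(1,2)]])
      (use assms in \<open>auto simp: chart_inv_left\<close>)
  then show ?thesis unfolding transition_deriv_def[of c e] by (simp add: frechet_derivative_eqI)
qed

lemma transition_deriv_self:
  assumes "c \<in> \<A>" "p \<in> dom_of c"
  shows "transition_deriv c c p u = u"
proof -
  have "((map_of_chart c \<circ> chart_inv c) has_derivative (\<lambda>u. u)) (at (map_of_chart c p))"
    by (rule has_derivative_transform_within_open[OF has_derivative_ident open_chart_range[OF assms(1)]])
      (use assms in \<open>auto simp: chart_inv_left\<close>)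
  then show ?thesis unfolding transition_deriv_def by (simp add: frechet_derivative_eqI)
qed

lemma linear_to_coord: "c \<in> \<A> \<Longrightarrow> p \<in> dom_of c \<Longrightarrow> linear (to_coord \<A> c p)"
  using linear_transition_deriv[OF chart_at_in _ mem_chart_at] by (metis (full_types) eta_contract_eq to_coord_def ext)

lemma linear_from_coord: "c \<in> \<A> \<Longrightarrow> p \<in> dom_of c \<Longrightarrow> linear (from_coord \<A> c p)"
  using linear_transition_deriv[OF _ chart_at_in _ mem_chart_at] by (metis (full_types) from_coord_def ext)

lemma to_coord_change:
  assumes "c \<in> \<A>" "d \<in> \<A>" "p \<in> dom_of c" "p \<in> dom_of d"
  shows "transition_deriv c d p (to_coord \<A> c p u) = to_coord \<A> d p u"
  unfolding to_coord_def using assms chart_at_in mem_chart_at by (intro transition_deriv_trans)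

lemma to_from_coord_change:
  assumes "c \<in> \<A>" "d \<in> \<A>" "p \<in> dom_of c" "p \<in> dom_of d"
  shows "to_coord \<A> d p (from_coord \<A> c p u) = transition_deriv c d p u"
  unfolding to_coord_def from_coord_def using assms chart_at_in mem_chart_at by (intro transition_deriv_trans)

lemma to_from_coord: "c \<in> \<A> \<Longrightarrow> p \<in> dom_of c \<Longrightarrow> to_coord \<A> c p (from_coord \<A> c p u) = u"
  by (simp add: to_from_coord_change transition_deriv_self)

lemma from_to_coord: "c \<in> \<A> \<Longrightarrow> p \<in> dom_of c \<Longrightarrow> from_coord \<A> c p (to_coord \<A> c p u) = u"
  unfolding to_coord_def from_coord_def
  by (simp add: transition_deriv_trans transition_deriv_self chart_at_in mem_chart_at)

lemma to_coord_chart_at: "to_coord \<A> (chart_at \<A> p) p u = u"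
  unfolding to_coord_def by (simp add: transition_deriv_self chart_at_in mem_chart_at)

lemma from_coord_chart_at: "from_coord \<A> (chart_at \<A> p) p u = u"
  unfolding from_coord_def by (simp add: transition_deriv_self chart_at_in mem_chart_at)

section \<open>Vector fields and functions in coordinates\<close>

lemma vf_rep_at: "c \<in> \<A> \<Longrightarrow> q \<in> dom_of c \<Longrightarrow> vf_rep \<A> c X (map_of_chart c q) = to_coord \<A> c q (X q)"
  by (simp add: vf_rep_def chart_inv_left)

lemma vf_rep_change:
  assumes "c \<in> \<A>" "d \<in> \<A>" "q \<in> dom_of c" "q \<in> dom_of d"
  shows "vf_rep \<A> d X (map_of_chart d q) =
    frechet_derivative (map_of_chart d \<circ> chart_inv c) (at (map_of_chart c q)) (vf_rep \<A> c X (map_of_chart c q))"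
  using to_coord_change[OF assms] by (simp add: vf_rep_at assms transition_deriv_def)

text \<open>One chart near each point decides smoothness: by \<open>vf_rep_change\<close> the
  components in another chart are a transition derivative applied to the given components, composed
  with a transition map.\<close>

lemma smooth_vf_onI:
  assumes "\<And>q. q \<in> \<Omega> \<Longrightarrow> \<exists>c\<in>\<A>. \<exists>U. open U \<and> q \<in> U \<and> U \<subseteq> dom_of c \<and> smooth_on (map_of_chart c ` U) (vf_rep \<A> c X)"
  shows "smooth_vf_on \<A> \<Omega> X"
  unfolding smooth_vf_on_def
proof (intro ballI smooth_on_local)
  fix d x assume d: "d \<in> \<A>" and "x \<in> map_of_chart d ` (dom_of d \<inter> \<Omega>)"
  then obtain q where q: "q \<in> dom_of d" "q \<in> \<Omega>" and x: "x = map_of_chart d q" by auto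
  obtain c U where c: "c \<in> \<A>" and U: "open U" "q \<in> U" "U \<subseteq> dom_of c"
    and sm: "smooth_on (map_of_chart c ` U) (vf_rep \<A> c X)" using assms[OF q(2)] by blast
  let ?V = "map_of_chart d ` (dom_of d \<inter> U)"
  have V: "open ?V" by (intro open_chart_image open_dom_Int d U) simp
  have sub: "?V \<subseteq> map_of_chart d ` (dom_of d \<inter> dom_of c)" using U by auto
  note tr = smooth_on_subset[OF transition_smooth[OF d c] sub]
  have "smooth_on ?V (\<lambda>x. frechet_derivative (map_of_chart d \<circ> chart_inv c) (at ((map_of_chart c \<circ> chart_inv d) x))
      (vf_rep \<A> c X ((map_of_chart c \<circ> chart_inv d) x)))"
  proof (rule smooth_on_frechet_derivative_apply[OF V _ transition_smooth[OF c d] tr])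
    show "(map_of_chart c \<circ> chart_inv d) x \<in> map_of_chart c ` (dom_of c \<inter> dom_of d)" if "x \<in> ?V" for x
      using that U d by (auto simp: chart_inv_left)
    show "smooth_on ?V (\<lambda>x. vf_rep \<A> c X ((map_of_chart c \<circ> chart_inv d) x))"
      by (rule smooth_on_compose[OF V _ sm tr]) (use U d in \<open>auto simp: chart_inv_left\<close>)
  qed
  then have "smooth_on ?V (vf_rep \<A> d X)"
    by (rule smooth_on_cong[OF V, rotated]) (use U c d in \<open>auto simp: chart_inv_left vf_rep_change[OF c d]\<close>)
  then show "\<exists>U. open U \<and> x \<in> U \<and> smooth_on U (vf_rep \<A> d X)" using V U q x by blast
qed

lemma smooth_vf_onD:
  "smooth_vf_on \<A> \<Omega> X \<Longrightarrow> c \<in> \<A> \<Longrightarrow> U \<subseteq> dom_of c \<Longrightarrow> U \<subseteq> \<Omega> \<Longrightarrow> smooth_on (map_of_chart c ` U) (vf_rep \<A> c X)"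
  unfolding smooth_vf_on_def by (meson Int_greatest image_mono smooth_on_subset)

lemma smooth_funI:
  assumes "\<And>q. \<exists>c\<in>\<A>. \<exists>U. open U \<and> q \<in> U \<and> U \<subseteq> dom_of c \<and> smooth_on (map_of_chart c ` U) (f \<circ> chart_inv c)"
  shows "smooth_fun \<A> f"
  unfolding smooth_fun_def
proof (intro ballI smooth_on_local)
  fix d x assume d: "d \<in> \<A>" and "x \<in> map_of_chart d ` dom_of d"
  then obtain q where q: "q \<in> dom_of d" and x: "x = map_of_chart d q" by auto
  obtain c U where c: "c \<in> \<A>" and U: "open U" "q \<in> U" "U \<subseteq> dom_of c"
    and sm: "smooth_on (map_of_chart c ` U) (f \<circ> chart_inv c)" using assms by blast
  let ?V = "map_of_chart d ` (dom_of d \<inter> U)"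
  have V: "open ?V" by (intro open_chart_image open_dom_Int d U) simp
  have sub: "?V \<subseteq> map_of_chart d ` (dom_of d \<inter> dom_of c)" using U by auto
  have "smooth_on ?V (\<lambda>x. (f \<circ> chart_inv c) ((map_of_chart c \<circ> chart_inv d) x))"
    by (rule smooth_on_compose[OF V _ sm smooth_on_subset[OF transition_smooth[OF d c] sub]])
      (use U d in \<open>auto simp: chart_inv_left\<close>)
  then have "smooth_on ?V (f \<circ> chart_inv d)"
    by (rule smooth_on_cong[OF V, rotated]) (use U c d in \<open>auto simp: chart_inv_left subset_iff\<close>)
  then show "\<exists>U. open U \<and> x \<in> U \<and> smooth_on U (f \<circ> chart_inv d)" using V U q x by blast
qed

lemma smooth_funD: "smooth_fun \<A> f \<Longrightarrow> c \<in> \<A> \<Longrightarrow> U \<subseteq> dom_of c \<Longrightarrow> smooth_on (map_of_chart c ` U) (f \<circ> chart_inv c)"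
  unfolding smooth_fun_def by (meson image_mono smooth_on_subset)

section \<open>Cut-offs and global extensions of local objects\<close>

text \<open>A Euclidean bump is carried over by a chart and extended by 0. Beyond the chart domain,
  smoothness of the extension rests on \<open>K\<close> being closed: it is compact, and the
  manifold is Hausdorff.\<close>

lemma manifold_bump:
  assumes "open \<Omega>" "p \<in> \<Omega>"
  obtains \<beta> W K where "smooth_fun \<A> \<beta>" "open W" "p \<in> W" "W \<subseteq> \<Omega>" "\<And>q. q \<in> W \<Longrightarrow> \<beta> q = 1"
    "closed K" "K \<subseteq> \<Omega>" "\<And>q. q \<notin> K \<Longrightarrow> \<beta> q = 0"
proof -
  define c where "c = chart_at \<A> p"
  have c: "c \<in> \<A>" "p \<in> dom_of c" by (simp_all add: c_def chart_at_in mem_chart_at)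
  define x where "x = map_of_chart c p"
  have "open (map_of_chart c ` (dom_of c \<inter> \<Omega>))"
    by (intro open_chart_image open_dom_Int c assms) simp
  moreover have "x \<in> map_of_chart c ` (dom_of c \<inter> \<Omega>)" using c assms by (auto simp: x_def)
  ultimately obtain r0 where r0: "r0 > 0" "cball x r0 \<subseteq> map_of_chart c ` (dom_of c \<inter> \<Omega>)"
    unfolding open_contains_cball by blast
  \<comment> \<open>\<open>b\<close> is known to vanish only from distance \<open>2 * r\<close> on,
    so this larger ball must fit into the chart image.\<close>
  define r where "r = r0 / 2"
  have r: "r > 0" "cball x (2 * r) \<subseteq> map_of_chart c ` (dom_of c \<inter> \<Omega>)" using r0 by (simp_all add: r_def)
  obtain b where b: "smooth_on UNIV b" "\<And>y. dist y x \<le> r \<Longrightarrow> b y = 1" "\<And>y. dist y x \<ge> 2 * r \<Longrightarrow> b y = (0::real)"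
    using bump_function[OF r(1)] by blast
  define \<beta> where "\<beta> q = (if q \<in> dom_of c then b (map_of_chart c q) else 0)" for q
  define K where "K = chart_inv c ` cball x (2 * r)"
  define W where "W = dom_of c \<inter> map_of_chart c -` ball x r"
  have "compact K" unfolding K_def
    by (intro compact_continuous_image compact_cball continuous_on_subset[OF continuous_on_chart_inv[OF c(1)]])
      (use r(2) in auto)
  then have K: "closed K" by (rule compact_imp_closed)
  have K\<Omega>: "K \<subseteq> \<Omega>" unfolding K_def using r(2) chart_inv_left[OF c(1)] by force
  have inK: "q \<in> K" if "q \<in> dom_of c" "dist (map_of_chart c q) x \<le> 2 * r" for q
    unfolding K_def using that chart_inv_left[OF c(1) that(1)]
    by (intro image_eqI[of _ _ "map_of_chart c q"]) (auto simp: dist_commute)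
  have 0: "\<beta> q = 0" if "q \<notin> K" for q
    by (metis \<beta>_def b(3) inK le_cases that)
  have W: "open W" unfolding W_def by (rule open_chart_preimage[OF c(1) open_ball])
  have "W \<subseteq> K" using inK r by (auto simp: W_def dist_commute)
  have 1: "\<beta> q = 1" if "q \<in> W" for q
    using that b(2) by (auto simp: \<beta>_def W_def dist_commute less_imp_le)
  have "smooth_fun \<A> \<beta>"
  proof (rule smooth_funI)
    fix q
    show "\<exists>d\<in>\<A>. \<exists>U. open U \<and> q \<in> U \<and> U \<subseteq> dom_of d \<and> smooth_on (map_of_chart d ` U) (\<beta> \<circ> chart_inv d)"
    proof (cases "q \<in> dom_of c")
      case True
      have "smooth_on (map_of_chart c ` dom_of c) (\<beta> \<circ> chart_inv c)"
        by (rule smooth_on_cong[OF open_chart_range[OF c(1)] _ smooth_on_subset[OF b(1)]])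
          (use c in \<open>auto simp: \<beta>_def chart_inv_left\<close>)
      then show ?thesis using True c open_dom by blast
    next
      case False
      define d where "d = chart_at \<A> q"
      have d: "d \<in> \<A>" "q \<in> dom_of d" by (simp_all add: d_def chart_at_in mem_chart_at)
      have "q \<notin> K" unfolding K_def using r(2) False chart_inv_left[OF c(1)] by force
      have o: "open (dom_of d \<inter> - K)" using K open_dom[OF d(1)] by auto
      have "smooth_on (map_of_chart d ` (dom_of d \<inter> - K)) (\<beta> \<circ> chart_inv d)"
        by (rule smooth_on_cong[OF open_chart_image[OF d(1) o] _ smooth_on_const[OF open_chart_image[OF d(1) o], of 0]])
          (use d 0 in \<open>auto simp: chart_inv_left\<close>)
      then show ?thesis using d o \<open>q \<notin> K\<close> by blast
    qed
  qed
  moreover have "p \<in> W" using c r by (simp add: W_def x_def)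
  ultimately show ?thesis using that W K K\<Omega> \<open>W \<subseteq> K\<close> 0 1 by (metis subset_trans)
qed

lemma vf_rep_add:
  "c \<in> \<A> \<Longrightarrow> x \<in> map_of_chart c ` dom_of c \<Longrightarrow> vf_rep \<A> c (\<lambda>p. X p + Y p) x = vf_rep \<A> c X x + vf_rep \<A> c Y x"
  by (auto simp: vf_rep_at linear_add linear_to_coord)

lemma vf_rep_diff:
  "c \<in> \<A> \<Longrightarrow> x \<in> map_of_chart c ` dom_of c \<Longrightarrow> vf_rep \<A> c (\<lambda>p. X p - Y p) x = vf_rep \<A> c X x - vf_rep \<A> c Y x"
  by (auto simp: vf_rep_at linear_diff linear_to_coord)

lemma vf_rep_scale:
  "c \<in> \<A> \<Longrightarrow> x \<in> map_of_chart c ` dom_of c \<Longrightarrow>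
    vf_rep \<A> c (\<lambda>p. f p *\<^sub>R X p) x = (f \<circ> chart_inv c) x *\<^sub>R vf_rep \<A> c X x"
  by (auto simp: vf_rep_at linear_scale linear_to_coord chart_inv_left)

lemma smooth_vf_add:
  assumes "smooth_vf \<A> X" "smooth_vf \<A> Y" shows "smooth_vf \<A> (\<lambda>p. X p + Y p)"
  unfolding smooth_vf_on_def Int_UNIV_right
proof
  fix c assume c: "c \<in> \<A>"
  note o = open_chart_range[OF c]
  show "smooth_on (map_of_chart c ` dom_of c) (vf_rep \<A> c (\<lambda>p. X p + Y p))"
    by (rule smooth_on_cong[OF o vf_rep_add[OF c, symmetric] smooth_on_add[OF o]])
      (use assms smooth_vf_onD[OF _ c] in auto)
qed

lemma smooth_vf_diff:
  assumes "smooth_vf \<A> X" "smooth_vf \<A> Y" shows "smooth_vf \<A> (\<lambda>p. X p - Y p)"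
  unfolding smooth_vf_on_def Int_UNIV_right
proof
  fix c assume c: "c \<in> \<A>"
  note o = open_chart_range[OF c]
  show "smooth_on (map_of_chart c ` dom_of c) (vf_rep \<A> c (\<lambda>p. X p - Y p))"
    by (rule smooth_on_cong[OF o vf_rep_diff[OF c, symmetric] smooth_on_diff[OF o]])
      (use assms smooth_vf_onD[OF _ c] in auto)
qed

lemma smooth_vf_scale:
  assumes "smooth_fun \<A> f" "smooth_vf \<A> X" shows "smooth_vf \<A> (\<lambda>p. f p *\<^sub>R X p)"
  unfolding smooth_vf_on_def Int_UNIV_right
proof
  fix c assume c: "c \<in> \<A>"
  note o = open_chart_range[OF c]
  show "smooth_on (map_of_chart c ` dom_of c) (vf_rep \<A> c (\<lambda>p. f p *\<^sub>R X p))"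
    by (rule smooth_on_cong[OF o vf_rep_scale[OF c, symmetric]
          smooth_on_scaleR[OF o smooth_funD[OF assms(1) c] smooth_vf_onD[OF assms(2) c]]]) simp_all
qed

lemma smooth_fun_const: "smooth_fun \<A> (\<lambda>p. k)"
  unfolding smooth_fun_def o_def using smooth_on_const open_chart_range by blast

lemma smooth_vf_zero: "smooth_vf \<A> (\<lambda>p. 0)"
proof -
  have "smooth_on (map_of_chart c ` dom_of c) (vf_rep \<A> c (\<lambda>p. 0))" if c: "c \<in> \<A>" for c
    by (rule smooth_on_cong[OF open_chart_range[OF c] _ smooth_on_const[OF open_chart_range[OF c], of 0]])
      (use c in \<open>auto simp: vf_rep_at linear_0 linear_to_coord\<close>)
  then show ?thesis by (simp add: smooth_vf_on_def)
qed

text \<open>Multiplying by a bump gives a field that vanishes off a closed set \<open>K\<close>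
  inside \<Omega>, hence is smooth near the points outside \<Omega> as well.\<close>

lemma vf_extension:
  assumes "open \<Omega>" "p \<in> \<Omega>" "smooth_vf_on \<A> \<Omega> Y"
  shows "\<exists>Z. smooth_vf \<A> Z \<and> (\<exists>W. open W \<and> p \<in> W \<and> (\<forall>q\<in>W. Z q = Y q))"
proof -
  obtain \<beta> W K where \<beta>: "smooth_fun \<A> \<beta>" and W: "open W" "p \<in> W" "\<And>q. q \<in> W \<Longrightarrow> \<beta> q = 1"
    and K: "closed K" "K \<subseteq> \<Omega>" "\<And>q. q \<notin> K \<Longrightarrow> \<beta> q = 0"
    using manifold_bump[OF assms(1,2)] by metis
  have "smooth_vf \<A> (\<lambda>q. \<beta> q *\<^sub>R Y q)"
  proof (rule smooth_vf_onI)
    fix q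
    define d where "d = chart_at \<A> q"
    have d: "d \<in> \<A>" "q \<in> dom_of d" by (simp_all add: d_def chart_at_in mem_chart_at)
    show "\<exists>c\<in>\<A>. \<exists>U. open U \<and> q \<in> U \<and> U \<subseteq> dom_of c \<and> smooth_on (map_of_chart c ` U) (vf_rep \<A> c (\<lambda>q. \<beta> q *\<^sub>R Y q))"
    proof (cases "q \<in> \<Omega>")
      case True
      let ?V = "map_of_chart d ` (dom_of d \<inter> \<Omega>)"
      have U: "open (dom_of d \<inter> \<Omega>)" using assms open_dom[OF d(1)] by auto
      have V: "open ?V" using open_chart_image[OF d(1) U] by simp
      have "smooth_on ?V (vf_rep \<A> d (\<lambda>q. \<beta> q *\<^sub>R Y q))"
        by (rule smooth_on_cong[OF V vf_rep_scale[OF d(1), symmetric]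
              smooth_on_scaleR[OF V smooth_funD[OF \<beta> d(1)] smooth_vf_onD[OF assms(3) d(1)]]]) auto
      then show ?thesis using U d True by blast
    next
      case False
      have o: "open (dom_of d \<inter> - K)" using K open_dom[OF d(1)] by auto
      have "smooth_on (map_of_chart d ` (dom_of d \<inter> - K)) (vf_rep \<A> d (\<lambda>q. \<beta> q *\<^sub>R Y q))"
        by (rule smooth_on_cong[OF open_chart_image[OF d(1) o] _ smooth_on_const[OF open_chart_image[OF d(1) o], of 0]])
          (use d K in \<open>auto simp: vf_rep_at linear_0 linear_to_coord\<close>)
      moreover have "q \<in> dom_of d \<inter> - K" using False K d by auto
      ultimately show ?thesis using d o by blast
    qed
  qed
  then show ?thesis using W by (intro exI[of _ "\<lambda>q. \<beta> q *\<^sub>R Y q"]) auto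
qed

lemma germ_ext_smooth:
  assumes "open \<Omega>" "p \<in> \<Omega>" "smooth_vf_on \<A> \<Omega> Y"
  shows "smooth_vf \<A> (germ_ext \<A> p Y)"
    and "\<exists>W. open W \<and> p \<in> W \<and> (\<forall>q\<in>W. germ_ext \<A> p Y q = Y q)"
  using someI_ex[OF vf_extension[OF assms]] unfolding germ_ext_def by blast+

lemma vf_rep_coord_vf: "c \<in> \<A> \<Longrightarrow> x \<in> map_of_chart c ` dom_of c \<Longrightarrow> vf_rep \<A> c (coord_vf \<A> c i) x = i"
  by (auto simp: vf_rep_at coord_vf_def to_from_coord)

lemma smooth_coord_vf:
  assumes c: "c \<in> \<A>" shows "smooth_vf_on \<A> (dom_of c) (coord_vf \<A> c i)"
proof -
  have "smooth_on (map_of_chart c ` dom_of c) (vf_rep \<A> c (coord_vf \<A> c i))"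
    by (rule smooth_on_cong[OF open_chart_range[OF c] vf_rep_coord_vf[OF c, symmetric] smooth_on_const[OF open_chart_range[OF c]]])
  then show ?thesis using c open_dom by (intro smooth_vf_onI) blast
qed

text \<open>The field with constant components in the preferred chart, globalised by
  \<open>vf_extension\<close>, is a witness for the choice in \<open>vf_ext\<close>.\<close>

lemma vf_ext_smooth: "smooth_vf \<A> (vf_ext \<A> p u)" and vf_ext_at: "vf_ext \<A> p u p = u"
proof -
  let ?c = "chart_at \<A> p"
  have "\<exists>Z. smooth_vf \<A> Z \<and> (\<exists>W. open W \<and> p \<in> W \<and> (\<forall>q\<in>W. Z q = coord_vf \<A> ?c u q))"
    by (rule vf_extension[OF open_dom mem_chart_at smooth_coord_vf]) (rule chart_at_in)+
  then obtain Z where "smooth_vf \<A> Z" "Z p = coord_vf \<A> ?c u p" by blast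
  then have "\<exists>Z. smooth_vf \<A> Z \<and> Z p = u" by (auto simp: coord_vf_def from_coord_chart_at)
  from someI_ex[OF this] show "smooth_vf \<A> (vf_ext \<A> p u)" "vf_ext \<A> p u p = u"
    unfolding vf_ext_def by auto
qed

end

section \<open>The connection in a chart\<close>

text \<open>\<open>C\<close> matters only on pairs of basis vectors and is not assumed bilinear. The
  Christoffel coefficients enter through this form, so they can be differentiated and shown smooth
  one pair at a time.\<close>

definition bilin :: "('e::euclidean_space \<Rightarrow> 'e \<Rightarrow> 'b::real_normed_vector) \<Rightarrow> 'e \<Rightarrow> 'e \<Rightarrow> 'b" where
  "bilin C u w = (\<Sum>i\<in>Basis. \<Sum>j\<in>Basis. ((u \<bullet> i) * (w \<bullet> j)) *\<^sub>R C i j)"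

lemma bilin_add_left: "bilin C (u + u') w = bilin C u w + bilin C u' w"
  by (simp add: bilin_def inner_add_left algebra_simps sum.distrib)

lemma bilin_add_right: "bilin C u (w + w') = bilin C u w + bilin C u w'"
  by (simp add: bilin_def inner_add_left algebra_simps sum.distrib)

lemma bilin_scale_left: "bilin C (r *\<^sub>R u) w = r *\<^sub>R bilin C u w"
  by (simp add: bilin_def scaleR_sum_right mult.assoc)

lemma bilin_scale_right: "bilin C u (r *\<^sub>R w) = r *\<^sub>R bilin C u w"
  by (simp add: bilin_def scaleR_sum_right mult.left_commute)

lemma bilin_minus_left: "bilin C (- u) w = - bilin C u w"
  using bilin_scale_left[of C "-1"] by simp

lemma bilin_minus_right: "bilin C u (- w) = - bilin C u w"
  using bilin_scale_right[of C u "-1"] by simp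

lemma bilin_diff_left: "bilin C (u - u') w = bilin C u w - bilin C u' w"
  using bilin_add_left[of C u "- u'"] by (simp add: bilin_minus_left)

lemma bilin_diff_right: "bilin C u (w - w') = bilin C u w - bilin C u w'"
  using bilin_add_right[of C u w "- w'"] by (simp add: bilin_minus_right)

lemma bilin_coeff_add: "bilin (\<lambda>i j. C i j + D i j) u w = bilin C u w + bilin D u w"
  by (simp add: bilin_def algebra_simps sum.distrib)

lemma bilin_coeff_linear: "linear L \<Longrightarrow> L (bilin C u w) = bilin (\<lambda>i j. L (C i j)) u w"
  by (simp add: bilin_def linear_sum linear_scale)

text \<open>Passes from an identity between coefficients to one for all vectors, as the
  transformation law of the Christoffel coefficients requires.\<close>

lemma bilin_bilinear:
  assumes "\<And>w. linear (\<lambda>u. B u w)" "\<And>u. linear (B u)"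
  shows "bilin B u w = B u w"
proof -
  have "B u w = (\<Sum>i\<in>Basis. (u \<bullet> i) *\<^sub>R B i w)" by (rule linear_euclidean_sum[OF assms(1)])
  also have "\<dots> = (\<Sum>i\<in>Basis. (u \<bullet> i) *\<^sub>R (\<Sum>j\<in>Basis. (w \<bullet> j) *\<^sub>R B i j))"
    by (rule sum.cong[OF refl]) (simp only: linear_euclidean_sum[OF assms(2), of _ w, symmetric])
  finally show ?thesis by (simp add: bilin_def scaleR_sum_right)
qed

lemma bilin_has_derivative:
  assumes C: "\<And>i j. ((\<lambda>y. C y i j) has_derivative C' i j) (at x within S)"
    and u: "(u has_derivative u') (at x within S)" and w: "(w has_derivative w') (at x within S)"
  shows "((\<lambda>y. bilin (C y) (u y) (w y)) has_derivative
    (\<lambda>h. bilin (\<lambda>i j. C' i j h) (u x) (w x) + bilin (C x) (u' h) (w x) + bilin (C x) (u x) (w' h))) (at x within S)"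
proof -
  have "((\<lambda>y. bilin (C y) (u y) (w y)) has_derivative
    (\<lambda>h. \<Sum>i\<in>Basis. \<Sum>j\<in>Basis. ((u x \<bullet> i) * (w x \<bullet> j)) *\<^sub>R C' i j h +
       ((u x \<bullet> i) * (w' h \<bullet> j) + (u' h \<bullet> i) * (w x \<bullet> j)) *\<^sub>R C x i j)) (at x within S)"
    unfolding bilin_def
    by (intro has_derivative_sum has_derivative_scaleR has_derivative_mult has_derivative_inner_left C u w)
  then show ?thesis
    by (simp add: bilin_def sum.distrib scaleR_add_left add_ac)
qed

lemma smooth_on_bilin:
  assumes "open S" "\<And>i j. smooth_on S (\<lambda>y. C y i j)" "smooth_on S u" "smooth_on S w"
  shows "smooth_on S (\<lambda>y. bilin (C y) (u y) (w y))"
  unfolding bilin_def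
  by (intro smooth_on_sum smooth_on_scaleR smooth_on_mult smooth_on_inner smooth_on_const assms finite_Basis)

context smooth_manifold
begin

section \<open>Local frames and components as global objects\<close>

text \<open>Components of a field live on a chart domain, but the Leibniz rule of a connection
  accepts only global functions. A cut-off supplies one with the right germ.\<close>

lemma fun_extension:
  assumes c: "c \<in> \<A>" "q \<in> dom_of c" and g: "smooth_on (map_of_chart c ` dom_of c) g"
  shows "\<exists>f. smooth_fun \<A> f \<and> (\<forall>\<^sub>F p in nhds q. f p = g (map_of_chart c p))"
proof -
  obtain \<beta> W K where \<beta>: "smooth_fun \<A> \<beta>" and W: "open W" "q \<in> W" "\<And>q. q \<in> W \<Longrightarrow> \<beta> q = 1"
    and K: "closed K" "K \<subseteq> dom_of c" "\<And>q. q \<notin> K \<Longrightarrow> \<beta> q = 0"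
    using manifold_bump[OF open_dom[OF c(1)] c(2)] by metis
  let ?f = "\<lambda>p. \<beta> p * g (map_of_chart c p)"
  have "smooth_fun \<A> ?f"
  proof (rule smooth_funI)
    fix p
    show "\<exists>d\<in>\<A>. \<exists>U. open U \<and> p \<in> U \<and> U \<subseteq> dom_of d \<and> smooth_on (map_of_chart d ` U) (?f \<circ> chart_inv d)"
    proof (cases "p \<in> dom_of c")
      case True
      have "smooth_on (map_of_chart c ` dom_of c) (?f \<circ> chart_inv c)"
        by (rule smooth_on_cong[OF open_chart_range[OF c(1)] _
              smooth_on_mult[OF open_chart_range[OF c(1)] smooth_funD[OF \<beta> c(1) subset_refl] g]])
          (use c in \<open>auto simp: chart_inv_left\<close>)
      then show ?thesis using True c open_dom by blast
    next
      case False
      define d where "d = chart_at \<A> p"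
      have d: "d \<in> \<A>" "p \<in> dom_of d" by (simp_all add: d_def chart_at_in mem_chart_at)
      have o: "open (dom_of d \<inter> - K)" using K open_dom[OF d(1)] by auto
      have "smooth_on (map_of_chart d ` (dom_of d \<inter> - K)) (?f \<circ> chart_inv d)"
        by (rule smooth_on_cong[OF open_chart_image[OF d(1) o] _ smooth_on_const[OF open_chart_image[OF d(1) o], of 0]])
          (use d K in \<open>auto simp: chart_inv_left\<close>)
      moreover have "p \<in> dom_of d \<inter> - K" using False K d by auto
      ultimately show ?thesis using d o by blast
    qed
  qed
  moreover have "\<forall>\<^sub>F p in nhds q. ?f p = g (map_of_chart c p)"
    using W by (auto simp: eventually_nhds)
  ultimately show ?thesis by blast
qed

text \<open>\<open>dir_deriv\<close> is tied to the preferred chart; the chain rule through the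
  transition map removes this dependence.\<close>

lemma dir_deriv_chart:
  assumes c: "c \<in> \<A>" "q \<in> dom_of c" and f: "smooth_fun \<A> f"
  shows "dir_deriv \<A> q u f = frechet_derivative (f \<circ> chart_inv c) (at (map_of_chart c q)) (to_coord \<A> c q u)"
proof -
  let ?d = "chart_at \<A> q"
  have d: "?d \<in> \<A>" "q \<in> dom_of ?d" by (simp_all add: chart_at_in mem_chart_at)
  have x: "(map_of_chart c \<circ> chart_inv ?d) (map_of_chart ?d q) = map_of_chart c q"
    using d by (simp add: chart_inv_left)
  have "((f \<circ> chart_inv c) has_derivative frechet_derivative (f \<circ> chart_inv c) (at (map_of_chart c q))) (at (map_of_chart c q))"
    by (rule smooth_on_has_derivative[OF smooth_funD[OF f c(1) subset_refl]]) (use c in auto)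
  then have "((\<lambda>x. (f \<circ> chart_inv c) ((map_of_chart c \<circ> chart_inv ?d) x)) has_derivative
      (\<lambda>u. frechet_derivative (f \<circ> chart_inv c) (at (map_of_chart c q)) (transition_deriv ?d c q u))) (at (map_of_chart ?d q))"
    by (intro has_derivative_compose[OF transition_has_derivative[OF d(1) c(1) d(2) c(2)]]) (unfold x)
  then have "((f \<circ> chart_inv ?d) has_derivative
      (\<lambda>u. frechet_derivative (f \<circ> chart_inv c) (at (map_of_chart c q)) (transition_deriv ?d c q u))) (at (map_of_chart ?d q))"
    by (rule has_derivative_transform_within_open[OF _ open_overlap[OF d(1) c(1)]])
      (use d c in \<open>auto simp: chart_inv_left\<close>)
  then show ?thesis unfolding dir_deriv_def to_coord_def by (rule frechet_derivative_eqI)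
qed

lemma germ_ext_eventually:
  "open \<Omega> \<Longrightarrow> p \<in> \<Omega> \<Longrightarrow> smooth_vf_on \<A> \<Omega> Y \<Longrightarrow> \<forall>\<^sub>F q in nhds p. germ_ext \<A> p Y q = Y q"
  using germ_ext_smooth(2) by (auto simp: eventually_nhds)

lemma frame_smooth: "c \<in> \<A> \<Longrightarrow> q \<in> dom_of c \<Longrightarrow> smooth_vf \<A> (germ_ext \<A> q (coord_vf \<A> c i))"
  using germ_ext_smooth(1)[OF open_dom _ smooth_coord_vf] .

lemma frame_eventually:
  "c \<in> \<A> \<Longrightarrow> q \<in> dom_of c \<Longrightarrow> \<forall>\<^sub>F p in nhds q. germ_ext \<A> q (coord_vf \<A> c i) p = coord_vf \<A> c i p"
  using germ_ext_eventually[OF open_dom _ smooth_coord_vf] .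

text \<open>Frame and coefficients are global objects that are correct only near \<open>q\<close>.
  By locality of the connection this is enough to compute with them at \<open>q\<close>.\<close>

lemma frame_expansion:
  assumes c: "c \<in> \<A>" "q \<in> dom_of c" and X: "smooth_vf \<A> X"
  obtains g where "\<And>i. smooth_fun \<A> (g i)"
    "\<And>i. \<forall>\<^sub>F p in nhds q. g i p = vf_rep \<A> c X (map_of_chart c p) \<bullet> i"
    "\<forall>\<^sub>F p in nhds q. X p = (\<Sum>i\<in>Basis. g i p *\<^sub>R germ_ext \<A> q (coord_vf \<A> c i) p)"
proof -
  note o = open_chart_range[OF c(1)]
  have "\<exists>f. smooth_fun \<A> f \<and> (\<forall>\<^sub>F p in nhds q. f p = vf_rep \<A> c X (map_of_chart c p) \<bullet> i)" for i
    by (rule fun_extension[OF c smooth_on_inner[OF o smooth_vf_onD[OF X c(1)] smooth_on_const[OF o]]]) auto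
  then obtain g where g: "\<And>i. smooth_fun \<A> (g i)" "\<And>i. \<forall>\<^sub>F p in nhds q. g i p = vf_rep \<A> c X (map_of_chart c p) \<bullet> i"
    by metis
  have "\<forall>\<^sub>F p in nhds q. \<forall>i\<in>Basis. g i p = vf_rep \<A> c X (map_of_chart c p) \<bullet> i"
    using g(2) by (simp add: eventually_ball_finite)
  moreover have "\<forall>\<^sub>F p in nhds q. \<forall>i\<in>Basis. germ_ext \<A> q (coord_vf \<A> c i) p = coord_vf \<A> c i p"
    using frame_eventually[OF c] by (simp add: eventually_ball_finite)
  moreover have "\<forall>\<^sub>F p in nhds q. p \<in> dom_of c"
    using c open_dom by (metis eventually_nhds)
  ultimately have "\<forall>\<^sub>F p in nhds q. X p = (\<Sum>i\<in>Basis. g i p *\<^sub>R germ_ext \<A> q (coord_vf \<A> c i) p)"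
  proof eventually_elim
    case (elim p)
    have "(\<Sum>i\<in>Basis. g i p *\<^sub>R germ_ext \<A> q (coord_vf \<A> c i) p)
        = (\<Sum>i\<in>Basis. (to_coord \<A> c p (X p) \<bullet> i) *\<^sub>R from_coord \<A> c p i)"
      using elim c by (simp add: vf_rep_at coord_vf_def)
    also have "\<dots> = from_coord \<A> c p (to_coord \<A> c p (X p))"
      by (rule linear_euclidean_sum[OF linear_from_coord[OF c(1) elim(3)], symmetric])
    finally show ?case using elim c by (simp add: from_to_coord)
  qed
  then show ?thesis using that g by blast
qed

lemma smooth_vf_sum:
  "finite I \<Longrightarrow> (\<And>i. smooth_vf \<A> (Y i)) \<Longrightarrow> smooth_vf \<A> (\<lambda>p. \<Sum>i\<in>I. Y i p)"
  by (induction I rule: finite_induct) (auto intro!: smooth_vf_zero smooth_vf_add)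

text \<open>With \<beta> equal to 1 at \<open>q\<close> and supported where \<open>Z\<close>
  vanishes, \<open>1 - \<beta>\<close> vanishes at \<open>q\<close> but leaves \<open>Z\<close>
  unchanged. Multiplying by it turns the algebraic axioms of a connection into locality.\<close>

lemma cutoff_complement:
  assumes "\<forall>\<^sub>F p in nhds q. Z p = 0" "smooth_vf \<A> Z"
  obtains f where "smooth_fun \<A> f" "f q = 0" "\<And>p. Z p = f p *\<^sub>R (Z p :: 'e)"
proof -
  obtain U where U: "open U" "q \<in> U" "\<And>p. p \<in> U \<Longrightarrow> Z p = 0" using assms by (auto simp: eventually_nhds)
  obtain \<beta> W K where \<beta>: "smooth_fun \<A> \<beta>" and W: "q \<in> W" "\<And>q. q \<in> W \<Longrightarrow> \<beta> q = (1::real)"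
    and K: "K \<subseteq> U" "\<And>q. q \<notin> K \<Longrightarrow> \<beta> q = 0"
    using manifold_bump[OF U(1,2)] by metis
  have "smooth_fun \<A> (\<lambda>p. 1 - \<beta> p)"
  proof -
    have "smooth_on (map_of_chart c ` dom_of c) ((\<lambda>p. 1 - \<beta> p) \<circ> chart_inv c)" if "c \<in> \<A>" for c
      using smooth_on_diff[OF open_chart_range[OF that] smooth_on_const[OF open_chart_range[OF that], of 1]
          smooth_funD[OF \<beta> that subset_refl]] by (simp add: o_def)
    then show ?thesis by (simp add: smooth_fun_def)
  qed
  moreover have "1 - \<beta> q = 0" using W by simp
  moreover have "Z p = (1 - \<beta> p) *\<^sub>R Z p" for p using U(3)[of p] K(2)[of p] subsetD[OF K(1), of p] by (cases "p \<in> K") auto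
  ultimately show ?thesis using that by blast
qed

end

locale aniso_manifold = smooth_manifold \<A>
  for \<A> :: "('m::{t2_space, second_countable_topology}, 'e::euclidean_space) chart set" +
  fixes A :: "('m \<times> 'e) set" and nab :: "('m, 'e) conn"
  assumes open_A: "open_in_TM \<A> A"
    and conn: "aniso_connection \<A> A nab"
begin

section \<open>Locality of the connection and its Christoffel coefficients\<close>

definition TA :: "('m, 'e) chart \<Rightarrow> ('e \<times> 'e) set" where
  "TA c = tchart \<A> c ` {v \<in> A. fst v \<in> dom_of c}"

lemma open_TA: "c \<in> \<A> \<Longrightarrow> open (TA c)"
  using open_A unfolding open_in_TM_def TA_def by blast

lemma tchart_in_TA: "v \<in> A \<Longrightarrow> fst v \<in> dom_of c \<Longrightarrow> tchart \<A> c v \<in> TA c"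
  unfolding TA_def by blast

lemma tchart_inv_tchart: "c \<in> \<A> \<Longrightarrow> fst v \<in> dom_of c \<Longrightarrow> tchart_inv \<A> c (tchart \<A> c v) = v"
  by (simp add: tchart_inv_def tchart_def chart_inv_left from_to_coord)

lemma TA_cases:
  assumes "c \<in> \<A>" "z \<in> TA c"
  obtains v where "v \<in> A" "fst v \<in> dom_of c" "z = tchart \<A> c v" "tchart_inv \<A> c z = v" "fst z = map_of_chart c (fst v)"
  using assms unfolding TA_def by (auto simp: tchart_inv_tchart) (metis fst_conv tchart_def tchart_inv_tchart)

lemma nab_add: "v \<in> A \<Longrightarrow> smooth_vf \<A> X \<Longrightarrow> smooth_vf \<A> Y \<Longrightarrow> smooth_vf \<A> Z \<Longrightarrow>
    nab v X (\<lambda>p. Y p + Z p) = nab v X Y + nab v X Z"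
  using conn unfolding aniso_connection_def by blast

lemma nab_leibniz: "v \<in> A \<Longrightarrow> smooth_vf \<A> X \<Longrightarrow> smooth_vf \<A> Y \<Longrightarrow> smooth_fun \<A> f \<Longrightarrow>
    nab v X (\<lambda>p. f p *\<^sub>R Y p) = dir_deriv \<A> (fst v) (X (fst v)) f *\<^sub>R Y (fst v) + f (fst v) *\<^sub>R nab v X Y"
  using conn unfolding aniso_connection_def by blast

lemma nab_tensor: "v \<in> A \<Longrightarrow> smooth_vf \<A> X \<Longrightarrow> smooth_vf \<A> Y \<Longrightarrow> smooth_vf \<A> Z \<Longrightarrow>
    smooth_fun \<A> f \<Longrightarrow> smooth_fun \<A> h \<Longrightarrow>
    nab v (\<lambda>p. f p *\<^sub>R X p + h p *\<^sub>R Y p) Z = f (fst v) *\<^sub>R nab v X Z + h (fst v) *\<^sub>R nab v Y Z"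
  using conn unfolding aniso_connection_def by blast

lemma nab_smooth: "smooth_vf \<A> X \<Longrightarrow> smooth_vf \<A> Y \<Longrightarrow> aniso_vf \<A> A (\<lambda>v. nab v X Y)"
  using conn unfolding aniso_connection_def by blast

lemma nab_zero_right: "v \<in> A \<Longrightarrow> smooth_vf \<A> X \<Longrightarrow> nab v X (\<lambda>p. 0) = 0"
  using nab_add[of v X "\<lambda>p. 0" "\<lambda>p. 0"] smooth_vf_zero by simp

lemma nab_sum_right:
  assumes "v \<in> A" "smooth_vf \<A> X" "\<And>i. smooth_vf \<A> (Y i)" "finite I"
  shows "nab v X (\<lambda>p. \<Sum>i\<in>I. Y i p) = (\<Sum>i\<in>I. nab v X (Y i))"
  using assms(4)
  by (induction I rule: finite_induct) (use assms in \<open>simp_all add: nab_zero_right nab_add smooth_vf_sum\<close>)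

lemma nab_sum_left:
  assumes "v \<in> A" "\<And>i. smooth_vf \<A> (X i)" "\<And>i. smooth_fun \<A> (f i)" "smooth_vf \<A> Z" "finite I"
  shows "nab v (\<lambda>p. \<Sum>i\<in>I. f i p *\<^sub>R X i p) Z = (\<Sum>i\<in>I. f i (fst v) *\<^sub>R nab v (X i) Z)"
  using assms(5)
proof (induction I rule: finite_induct)
  case empty
  show ?case
    using nab_tensor[OF assms(1) smooth_vf_zero smooth_vf_zero assms(4) smooth_fun_const[of 0] smooth_fun_const[of 0]] by simp
next
  case (insert i I)
  show ?case
    using nab_tensor[OF assms(1) assms(2)[of i] smooth_vf_sum[OF insert(1) smooth_vf_scale[OF assms(3) assms(2)]] assms(4) assms(3)[of i] smooth_fun_const[of 1]]
      insert by simp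
qed

text \<open>The difference of the two fields is \<open>f *\<^sub>R Z\<close> with \<open>f\<close>
  and \<open>Z\<close> both zero at the foot point, so each term of the Leibniz rule
  vanishes.\<close>

lemma nab_cong_right:
  assumes v: "v \<in> A" and X: "smooth_vf \<A> X" "smooth_vf \<A> Y" "smooth_vf \<A> Y'"
    and eq: "\<forall>\<^sub>F p in nhds (fst v). Y p = Y' p"
  shows "nab v X Y = nab v X Y'"
proof -
  define Z where "Z p = Y p - Y' p" for p
  have Z: "smooth_vf \<A> Z" unfolding Z_def by (rule smooth_vf_diff[OF X(2,3)])
  have Z0: "\<forall>\<^sub>F p in nhds (fst v). Z p = 0" using eq by eventually_elim (simp add: Z_def)
  obtain f where f: "smooth_fun \<A> f" "f (fst v) = 0" "\<And>p. Z p = f p *\<^sub>R Z p"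
    using cutoff_complement[OF Z0 Z] by blast
  have "nab v X Z = nab v X (\<lambda>p. f p *\<^sub>R Z p)" using f(3) by metis
  also have "\<dots> = 0" using nab_leibniz[OF v X(1) Z f(1)] f(2) eventually_nhds_x_imp_x[OF Z0] by simp
  finally have "nab v X (\<lambda>p. Y' p + Z p) = nab v X Y'" using nab_add[OF v X(1,3) Z] by simp
  then show ?thesis by (simp add: Z_def)
qed

text \<open>The same device, with linearity over functions in place of the Leibniz rule.\<close>

lemma nab_cong_left:
  assumes v: "v \<in> A" and X: "smooth_vf \<A> X" "smooth_vf \<A> X'" "smooth_vf \<A> Y"
    and eq: "\<forall>\<^sub>F p in nhds (fst v). X p = X' p"
  shows "nab v X Y = nab v X' Y"
proof -
  define Z where "Z p = X p - X' p" for p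
  have Z: "smooth_vf \<A> Z" unfolding Z_def by (rule smooth_vf_diff[OF X(1,2)])
  have Z0: "\<forall>\<^sub>F p in nhds (fst v). Z p = 0" using eq by eventually_elim (simp add: Z_def)
  obtain f where f: "smooth_fun \<A> f" "f (fst v) = 0" "\<And>p. Z p = f p *\<^sub>R Z p"
    using cutoff_complement[OF Z0 Z] by blast
  have "nab v X Y = nab v (\<lambda>p. 1 *\<^sub>R X' p + f p *\<^sub>R Z p) Y"
    using f(3) by (simp flip: f(3) add: Z_def)
  also have "\<dots> = nab v X' Y"
    using nab_tensor[OF v X(2) Z X(3) smooth_fun_const[of 1] f(1)] f(2) by simp
  finally show ?thesis .
qed

text \<open>The Christoffel coefficients are read as functions of the coordinates \<open>z\<close>
  in \<open>TA c\<close>, so that ordinary calculus applies to them.\<close>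

definition Gam :: "('m, 'e) chart \<Rightarrow> 'e \<times> 'e \<Rightarrow> 'e \<Rightarrow> 'e \<Rightarrow> 'e" where
  "Gam c z = bilin (christoffel \<A> nab c (tchart_inv \<A> c z))"

text \<open>Both fields are expanded in the coordinate frame. The Leibniz terms are the derivatives
  of the components of \<open>Y\<close>, and the frame itself contributes the Christoffel
  coefficients.\<close>

lemma nab_chart:
  assumes c: "c \<in> \<A>" "fst v \<in> dom_of c" and v: "v \<in> A" and X: "smooth_vf \<A> X" and Y: "smooth_vf \<A> Y"
  shows "to_coord \<A> c (fst v) (nab v X Y) =
    frechet_derivative (vf_rep \<A> c Y) (at (map_of_chart c (fst v))) (to_coord \<A> c (fst v) (X (fst v))) +
    Gam c (tchart \<A> c v) (to_coord \<A> c (fst v) (X (fst v))) (to_coord \<A> c (fst v) (Y (fst v)))"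
proof -
  define q where "q = fst v"
  define x where "x = map_of_chart c q"
  define E where "E i = germ_ext \<A> q (coord_vf \<A> c i)" for i
  have q: "q \<in> dom_of c" using c q_def by simp
  have E: "smooth_vf \<A> (E i)" for i unfolding E_def by (rule frame_smooth[OF c(1) q])
  have Eq: "E i q = from_coord \<A> c q i" for i
    using eventually_nhds_x_imp_x[OF frame_eventually[OF c(1) q]] by (simp add: E_def coord_vf_def)
  let ?T = "to_coord \<A> c q"
  have T: "linear ?T" by (rule linear_to_coord[OF c(1) q])
  define u where "u = ?T (X q)"
  define w where "w = ?T (Y q)"
  have C: "?T (nab v (E i) (E j)) = christoffel \<A> nab c (tchart_inv \<A> c (tchart \<A> c v)) i j" for i j
    using c by (simp add: tchart_inv_tchart christoffel_def E_def q_def)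
  obtain g where g: "\<And>i. smooth_fun \<A> (g i)" "\<And>i. \<forall>\<^sub>F p in nhds q. g i p = vf_rep \<A> c X (map_of_chart c p) \<bullet> i"
    "\<forall>\<^sub>F p in nhds q. X p = (\<Sum>i\<in>Basis. g i p *\<^sub>R E i p)"
    using frame_expansion[OF c(1) q X] unfolding E_def by blast
  obtain f where f: "\<And>i. smooth_fun \<A> (f i)" "\<And>i. \<forall>\<^sub>F p in nhds q. f i p = vf_rep \<A> c Y (map_of_chart c p) \<bullet> i"
    "\<forall>\<^sub>F p in nhds q. Y p = (\<Sum>i\<in>Basis. f i p *\<^sub>R E i p)"
    using frame_expansion[OF c(1) q Y] unfolding E_def by blast
  have gq: "g i q = u \<bullet> i" and fq: "f i q = w \<bullet> i" for i
    using eventually_nhds_x_imp_x[OF g(2)] eventually_nhds_x_imp_x[OF f(2)] c q by (simp_all add: u_def w_def vf_rep_at)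
  have XE: "nab v X (E j) = (\<Sum>i\<in>Basis. (u \<bullet> i) *\<^sub>R nab v (E i) (E j))" for j
  proof -
    have "nab v X (E j) = nab v (\<lambda>p. \<Sum>i\<in>Basis. g i p *\<^sub>R E i p) (E j)"
      using g(3) by (intro nab_cong_left v X E smooth_vf_sum smooth_vf_scale g(1)) (simp_all add: q_def)
    also have "\<dots> = (\<Sum>i\<in>Basis. (u \<bullet> i) *\<^sub>R nab v (E i) (E j))"
      by (subst nab_sum_left[OF v E g(1) E]) (simp_all add: gq flip: q_def)
    finally show ?thesis .
  qed
  \<comment> \<open>Near \<open>q\<close> the global function \<open>f j\<close> is a component of
    \<open>Y\<close>, so its abstract derivative is a component of the ordinary one.\<close>
  have dd: "dir_deriv \<A> q (X q) (f j) = frechet_derivative (vf_rep \<A> c Y) (at x) u \<bullet> j" for j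
  proof -
    have xr: "x \<in> map_of_chart c ` dom_of c" using q by (simp add: x_def)
    obtain W where W: "open W" "q \<in> W" "\<And>p. p \<in> W \<Longrightarrow> f j p = vf_rep \<A> c Y (map_of_chart c p) \<bullet> j"
      using f(2)[of j] by (auto simp: eventually_nhds)
    have "((\<lambda>y. vf_rep \<A> c Y y \<bullet> j) has_derivative (\<lambda>h. frechet_derivative (vf_rep \<A> c Y) (at x) h \<bullet> j)) (at x)"
      by (intro has_derivative_inner_left smooth_on_has_derivative[OF smooth_vf_onD[OF Y c(1) subset_refl] xr]) simp
    then have "((f j \<circ> chart_inv c) has_derivative (\<lambda>h. frechet_derivative (vf_rep \<A> c Y) (at x) h \<bullet> j)) (at x)"
      by (rule has_derivative_transform_within_open[OF _ open_chart_image[OF c(1) open_dom_Int[OF c(1) W(1)]]])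
        (use W q c in \<open>auto simp: x_def chart_inv_left\<close>)
    then show ?thesis
      using frechet_derivative_eqI dir_deriv_chart[OF c(1) q f(1)] by (metis u_def x_def)
  qed
  have "nab v X Y = nab v X (\<lambda>p. \<Sum>j\<in>Basis. f j p *\<^sub>R E j p)"
    using f(3) by (intro nab_cong_right v X Y E smooth_vf_sum smooth_vf_scale f(1)) (simp_all add: q_def)
  also have "\<dots> = (\<Sum>j\<in>Basis. nab v X (\<lambda>p. f j p *\<^sub>R E j p))"
    by (intro nab_sum_right v X smooth_vf_scale f(1) E) simp
  also have "\<dots> = (\<Sum>j\<in>Basis. (frechet_derivative (vf_rep \<A> c Y) (at x) u \<bullet> j) *\<^sub>R E j q + (w \<bullet> j) *\<^sub>R nab v X (E j))"
    by (intro sum.cong refl) (simp add: nab_leibniz[OF v X E f(1)] dd fq flip: q_def)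
  finally have "?T (nab v X Y) = (\<Sum>j\<in>Basis. (frechet_derivative (vf_rep \<A> c Y) (at x) u \<bullet> j) *\<^sub>R j) +
      (\<Sum>j\<in>Basis. (w \<bullet> j) *\<^sub>R (\<Sum>i\<in>Basis. (u \<bullet> i) *\<^sub>R ?T (nab v (E i) (E j))))"
    by (simp add: linear_sum[OF T] linear_add[OF T] linear_scale[OF T] sum.distrib Eq XE to_from_coord[OF c(1) q])
  also have "(\<Sum>j\<in>Basis. (w \<bullet> j) *\<^sub>R (\<Sum>i\<in>Basis. (u \<bullet> i) *\<^sub>R ?T (nab v (E i) (E j)))) = Gam c (tchart \<A> c v) u w"
    unfolding Gam_def bilin_def C scaleR_sum_right scaleR_scaleR
    by (subst sum.swap) (simp add: mult.commute)
  finally show ?thesis by (simp add: euclidean_representation u_def w_def x_def q_def)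
qed

text \<open>Smoothness of the connection is given for fixed global fields, but
  \<open>christoffel\<close> uses its own extensions of the coordinate fields at each foot point.
  Near a given point one fixed pair of extensions, \<open>E i\<close> and \<open>E j\<close>, agrees
  with the coordinate fields on a whole neighbourhood \<open>W\<close>, and by locality gives the
  same values over \<open>W\<close>.\<close>

lemma smooth_christoffel:
  assumes c: "c \<in> \<A>"
  shows "smooth_on (TA c) (\<lambda>z. christoffel \<A> nab c (tchart_inv \<A> c z) i j)"
proof (rule smooth_on_local)
  fix z assume "z \<in> TA c"
  then obtain v where v: "v \<in> A" "fst v \<in> dom_of c" "z = tchart \<A> c v" by (rule TA_cases[OF c])
  define q where "q = fst v"
  define E where "E i = germ_ext \<A> q (coord_vf \<A> c i)" for i
  have q: "q \<in> dom_of c" using v q_def by simp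
  have E: "smooth_vf \<A> (E i)" for i unfolding E_def by (rule frame_smooth[OF c q])
  have "\<forall>\<^sub>F p in nhds q. E i p = coord_vf \<A> c i p \<and> E j p = coord_vf \<A> c j p"
    unfolding E_def by (intro eventually_conj frame_eventually[OF c q])
  then obtain W where W: "open W" "q \<in> W" "\<And>p. p \<in> W \<Longrightarrow> E i p = coord_vf \<A> c i p" "\<And>p. p \<in> W \<Longrightarrow> E j p = coord_vf \<A> c j p"
    unfolding eventually_nhds by blast
  let ?U = "TA c \<inter> (map_of_chart c ` (dom_of c \<inter> W)) \<times> UNIV"
  have U: "open ?U"
    by (intro open_Int open_TA c open_Times open_chart_image open_dom_Int W open_UNIV) simp
  have "smooth_on (TA c) (aniso_rep \<A> c (\<lambda>v. nab v (E i) (E j)))"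
    using nab_smooth[OF E E] c unfolding aniso_vf_def TA_def by blast
  then have "smooth_on ?U (aniso_rep \<A> c (\<lambda>v. nab v (E i) (E j)))" by (rule smooth_on_subset) simp
  then have "smooth_on ?U (\<lambda>z. christoffel \<A> nab c (tchart_inv \<A> c z) i j)"
  proof (rule smooth_on_cong[OF U, rotated])
    fix z assume z: "z \<in> ?U"
    then obtain v where v: "v \<in> A" "fst v \<in> dom_of c" "tchart_inv \<A> c z = v" "fst z = map_of_chart c (fst v)"
      using TA_cases[OF c] by (metis IntD1)
    have "fst z \<in> map_of_chart c ` (dom_of c \<inter> W)" using z by auto
    then obtain p where zp: "fst z = map_of_chart c p" and pW: "p \<in> dom_of c \<inter> W" by (rule imageE)
    have "fst v = p"
      by (rule box_equals[OF arg_cong[OF trans[OF v(4)[symmetric] zp], of "chart_inv c"]])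
        (rule chart_inv_left[OF c v(2)], rule chart_inv_left[OF c IntD1[OF pW]])
    then have vW: "fst v \<in> W" using IntD2[OF pW] by (rule ssubst)
    have ev: "\<forall>\<^sub>F p in nhds (fst v). E k p = germ_ext \<A> (fst v) (coord_vf \<A> c k) p"
      if "\<And>p. p \<in> W \<Longrightarrow> E k p = coord_vf \<A> c k p" for k
    proof -
      have "\<forall>\<^sub>F p in nhds (fst v). p \<in> W" using W(1) vW by (metis eventually_nhds)
      then show ?thesis using frame_eventually[OF c v(2), of k] by eventually_elim (simp add: that)
    qed
    have "nab v (E i) (E j) = nab v (germ_ext \<A> (fst v) (coord_vf \<A> c i)) (E j)"
      by (rule nab_cong_left[OF v(1) E frame_smooth[OF c v(2)] E ev[OF W(3)]])
    also have "\<dots> = nab v (germ_ext \<A> (fst v) (coord_vf \<A> c i)) (germ_ext \<A> (fst v) (coord_vf \<A> c j))"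
      by (rule nab_cong_right[OF v(1) frame_smooth[OF c v(2)] E frame_smooth[OF c v(2)] ev[OF W(4)]])
    finally show "aniso_rep \<A> c (\<lambda>v. nab v (E i) (E j)) z = christoffel \<A> nab c (tchart_inv \<A> c z) i j"
      using v by (simp add: aniso_rep_def christoffel_def chart_inv_left[OF c])
  qed
  moreover have "z \<in> ?U"
    using v W c by (auto simp: tchart_in_TA) (simp add: tchart_def q_def)
  ultimately show "\<exists>U. open U \<and> z \<in> U \<and> smooth_on U (\<lambda>z. christoffel \<A> nab c (tchart_inv \<A> c z) i j)"
    using U by blast
qed

text \<open>Derivative of \<open>Gam\<close> in the point alone, with both vector slots held fixed.
  The direction has a base part and a fibre part; the fibre part carries the anisotropy.\<close>

definition DGam :: "('m, 'e) chart \<Rightarrow> 'e \<times> 'e \<Rightarrow> 'e \<times> 'e \<Rightarrow> 'e \<Rightarrow> 'e \<Rightarrow> 'e" where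
  "DGam c z dz = bilin (\<lambda>i j. frechet_derivative (\<lambda>z. christoffel \<A> nab c (tchart_inv \<A> c z) i j) (at z) dz)"

lemma DGam_add: "c \<in> \<A> \<Longrightarrow> z \<in> TA c \<Longrightarrow> DGam c z (dz + dz') u w = DGam c z dz u w + DGam c z dz' u w"
  unfolding DGam_def bilin_coeff_add[symmetric]
  by (simp add: linear_add[OF smooth_on_linear[OF smooth_christoffel]])

lemma Gam_has_derivative:
  assumes c: "c \<in> \<A>" and z: "(z has_derivative z') (at x within S)" "z x \<in> TA c"
    and u: "(u has_derivative u') (at x within S)" and w: "(w has_derivative w') (at x within S)"
  shows "((\<lambda>y. Gam c (z y) (u y) (w y)) has_derivative
    (\<lambda>h. DGam c (z x) (z' h) (u x) (w x) + Gam c (z x) (u' h) (w x) + Gam c (z x) (u x) (w' h))) (at x within S)"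
  unfolding Gam_def DGam_def
  by (intro bilin_has_derivative u w
      has_derivative_compose[OF z(1) smooth_on_has_derivative[OF smooth_christoffel[OF c] z(2)]])

lemma smooth_Gam:
  assumes "c \<in> \<A>" "open S" "smooth_on S z" "\<And>x. x \<in> S \<Longrightarrow> z x \<in> TA c" "smooth_on S u" "smooth_on S w"
  shows "smooth_on S (\<lambda>y. Gam c (z y) (u y) (w y))"
  unfolding Gam_def
  by (intro smooth_on_bilin assms(2,5,6))
    (rule smooth_on_compose[OF assms(2,4) smooth_christoffel[OF assms(1)] assms(3)])

end

section \<open>Change of charts\<close>

lemma linear_hessian_left: "smooth_on T f \<Longrightarrow> x \<in> T \<Longrightarrow> linear (\<lambda>u. hessian f x u w)"
  unfolding hessian_def using smooth_on_linear[OF smooth_on_frechet_derivative] .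

text \<open>Linearity in the inner direction is inherited from the outer one by symmetry.\<close>

lemma linear_hessian_right:
  fixes f :: "'a::euclidean_space \<Rightarrow> 'b::euclidean_space"
  assumes "open T" "smooth_on T f" "x \<in> T"
  shows "linear (\<lambda>w. hessian f x u w)"
  using linear_hessian_left[OF assms(2,3), of u] hessian_symmetric[OF assms(1,3,2)] by presburger

context smooth_manifold
begin

lemma vf_rep_has_derivative:
  assumes "smooth_vf_on \<A> \<Omega> Y" "open \<Omega>" "q \<in> \<Omega>" "c \<in> \<A>" "q \<in> dom_of c"
  shows "(vf_rep \<A> c Y has_derivative frechet_derivative (vf_rep \<A> c Y) (at (map_of_chart c q))) (at (map_of_chart c q))"
  by (rule smooth_on_has_derivative[OF smooth_vf_onD[OF assms(1,4), of "dom_of c \<inter> \<Omega>"]]) (use assms in auto)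

lemma vf_rep_derivative_cong:
  assumes "c \<in> \<A>" "q \<in> dom_of c" "smooth_vf \<A> Y'" "\<forall>\<^sub>F p in nhds q. Y' p = Y p"
  shows "frechet_derivative (vf_rep \<A> c Y') (at (map_of_chart c q)) = frechet_derivative (vf_rep \<A> c Y) (at (map_of_chart c q))"
proof -
  obtain W where W: "open W" "q \<in> W" "\<And>p. p \<in> W \<Longrightarrow> Y' p = Y p" using assms(4) by (auto simp: eventually_nhds)
  have "vf_rep \<A> c Y' differentiable at (map_of_chart c q)"
    using vf_rep_has_derivative[OF assms(3) open_UNIV UNIV_I assms(1,2)] by (auto simp: differentiable_def)
  then show ?thesis
    by (rule frechet_derivative_transform_within_open[OF _ open_chart_image[OF assms(1) open_dom_Int[OF assms(1) W(1)]]])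
      (use W assms in \<open>auto simp: vf_rep_at\<close>)
qed

text \<open>Obtained by differentiating \<open>vf_rep_change\<close>: the transition derivative
  itself varies with the point, hence the Hessian beside the tensorial term. Feeding in
  \<open>transition_deriv c d q u\<close> undoes the derivative of the inverse transition.\<close>

lemma vf_rep_derivative_change:
  assumes c: "c \<in> \<A>" "q \<in> dom_of c" and d: "d \<in> \<A>" "q \<in> dom_of d"
    and Y: "smooth_vf_on \<A> \<Omega> Y" "open \<Omega>" "q \<in> \<Omega>"
  shows "frechet_derivative (vf_rep \<A> d Y) (at (map_of_chart d q)) (transition_deriv c d q u) =
    hessian (map_of_chart d \<circ> chart_inv c) (map_of_chart c q) u (vf_rep \<A> c Y (map_of_chart c q)) +
    transition_deriv c d q (frechet_derivative (vf_rep \<A> c Y) (at (map_of_chart c q)) u)"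
proof -
  define \<psi> where "\<psi> = map_of_chart d \<circ> chart_inv c"
  define \<phi> where "\<phi> = map_of_chart c \<circ> chart_inv d"
  define x where "x = map_of_chart c q"
  define y where "y = map_of_chart d q"
  have \<phi>y: "\<phi> y = x" using d by (simp add: \<phi>_def x_def y_def chart_inv_left)
  have D\<phi>: "(\<phi> has_derivative transition_deriv d c q) (at y)"
    unfolding \<phi>_def y_def by (rule transition_has_derivative[OF d(1) c(1) d(2) c(2)])
  have DY: "(vf_rep \<A> c Y has_derivative frechet_derivative (vf_rep \<A> c Y) (at x)) (at (\<phi> y))"
    unfolding \<phi>y x_def by (rule vf_rep_has_derivative[OF Y c])
  have sm: "smooth_on (map_of_chart c ` (dom_of c \<inter> dom_of d)) \<psi>" unfolding \<psi>_def by (rule transition_smooth[OF c(1) d(1)])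
  have "((\<lambda>y. frechet_derivative \<psi> (at (\<phi> y)) (vf_rep \<A> c Y (\<phi> y))) has_derivative
     (\<lambda>h. hessian \<psi> (\<phi> y) (transition_deriv d c q h) (vf_rep \<A> c Y (\<phi> y)) +
        frechet_derivative \<psi> (at (\<phi> y)) (frechet_derivative (vf_rep \<A> c Y) (at x) (transition_deriv d c q h)))) (at y)"
    by (rule has_derivative_frechet_derivative_apply[OF open_overlap[OF c(1) d(1)] sm D\<phi> _ has_derivative_compose[OF D\<phi> DY]])
      (use c d in \<open>auto simp: \<phi>y x_def\<close>)
  then have "(vf_rep \<A> d Y has_derivative
     (\<lambda>h. hessian \<psi> x (transition_deriv d c q h) (vf_rep \<A> c Y x) +
        transition_deriv c d q (frechet_derivative (vf_rep \<A> c Y) (at x) (transition_deriv d c q h)))) (at y)"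
    unfolding \<phi>y transition_deriv_def[of c d] x_def[symmetric] \<psi>_def[symmetric]
    by (rule has_derivative_transform_within_open[OF _ open_overlap[OF d(1) c(1)]])
      (use c d in \<open>auto simp: y_def \<phi>_def \<psi>_def chart_inv_left vf_rep_change[OF c(1) d(1)]\<close>)
  from frechet_derivative_eqI[OF this, of "transition_deriv c d q u"] show ?thesis
    using transition_deriv_trans[OF c(1) d(1) c(1) c(2) d(2) c(2)] transition_deriv_self[OF c]
    by (simp add: x_def y_def \<psi>_def)
qed

text \<open>The Hessian terms of \<open>vf_rep_derivative_change\<close> for \<open>X\<close> and
  \<open>Y\<close> are equal by symmetry and drop out of the difference.\<close>

lemma lie_bracket_chart:
  assumes X: "smooth_vf \<A> X" and Y: "smooth_vf \<A> Y" and c: "c \<in> \<A>" "q \<in> dom_of c"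
  shows "to_coord \<A> c q (lie_bracket \<A> X Y q) =
    frechet_derivative (vf_rep \<A> c Y) (at (map_of_chart c q)) (to_coord \<A> c q (X q)) -
    frechet_derivative (vf_rep \<A> c X) (at (map_of_chart c q)) (to_coord \<A> c q (Y q))"
proof -
  let ?d = "chart_at \<A> q"
  have d: "?d \<in> \<A>" "q \<in> dom_of ?d" by (simp_all add: chart_at_in mem_chart_at)
  have r: "vf_rep \<A> ?d Z (map_of_chart ?d q) = Z q" for Z
    using d by (simp add: vf_rep_at to_coord_chart_at)
  have "hessian (map_of_chart c \<circ> chart_inv ?d) (map_of_chart ?d q) (X q) (Y q) =
    hessian (map_of_chart c \<circ> chart_inv ?d) (map_of_chart ?d q) (Y q) (X q)"
    by (rule hessian_symmetric[OF open_overlap[OF d(1) c(1)] _ transition_smooth[OF d(1) c(1)]]) (use c d in auto)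
  then show ?thesis
    unfolding lie_bracket_def Let_def to_coord_def linear_diff[OF linear_transition_deriv[OF d(1) c(1) d(2) c(2)]]
    using vf_rep_derivative_change[OF d c X open_UNIV UNIV_I] vf_rep_derivative_change[OF d c Y open_UNIV UNIV_I]
    by (simp add: r)
qed

text \<open>The curvature feeds the bracket to the connection, whose axioms concern smooth fields.
  The definition of the bracket changes chart from point to point; \<open>lie_bracket_chart\<close>
  provides a formula in one chart.\<close>

lemma smooth_lie_bracket:
  assumes X: "smooth_vf \<A> X" and Y: "smooth_vf \<A> Y"
  shows "smooth_vf \<A> (lie_bracket \<A> X Y)"
  unfolding smooth_vf_on_def Int_UNIV_right
proof
  fix c assume c: "c \<in> \<A>"
  note o = open_chart_range[OF c] and X' = smooth_vf_onD[OF X c subset_refl subset_UNIV]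
    and Y' = smooth_vf_onD[OF Y c subset_refl subset_UNIV]
  have D: "smooth_on (map_of_chart c ` dom_of c) (\<lambda>x. frechet_derivative f (at x) (g x))"
    if "smooth_on (map_of_chart c ` dom_of c) f" "smooth_on (map_of_chart c ` dom_of c) g" for f g :: "'e \<Rightarrow> 'e"
    by (rule smooth_on_frechet_derivative_apply[OF o _ that(1) smooth_on_ident[OF o] that(2)])
  show "smooth_on (map_of_chart c ` dom_of c) (vf_rep \<A> c (lie_bracket \<A> X Y))"
    by (rule smooth_on_cong[OF o _ smooth_on_diff[OF o D[OF Y' X'] D[OF X' Y']]])
      (use c in \<open>auto simp: vf_rep_at lie_bracket_chart[OF X Y c]\<close>)
qed

end

context aniso_manifold
begin

text \<open>Reading the transformation law towards the preferred chart, in which \<open>cov_deriv\<close> is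
  defined, involves the Hessian of only one of the two transition maps.\<close>

lemma christoffel_change:
  assumes c: "c \<in> \<A>" "fst v \<in> dom_of c" and v: "v \<in> A"
  shows "from_coord \<A> c (fst v) (Gam c (tchart \<A> c v) u w) =
    hessian (map_of_chart (chart_at \<A> (fst v)) \<circ> chart_inv c) (map_of_chart c (fst v)) u w +
    Gam (chart_at \<A> (fst v)) (tchart \<A> (chart_at \<A> (fst v)) v) (from_coord \<A> c (fst v) u) (from_coord \<A> c (fst v) w)"
proof -
  define q where "q = fst v"
  let ?d = "chart_at \<A> q"
  let ?\<psi> = "map_of_chart ?d \<circ> chart_inv c" and ?\<psi>' = "from_coord \<A> c q"
  have d: "?d \<in> \<A>" "q \<in> dom_of ?d" by (simp_all add: chart_at_in mem_chart_at)
  have q: "q \<in> dom_of c" using c q_def by simp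
  define E where "E i = germ_ext \<A> q (coord_vf \<A> c i)" for i
  have E: "smooth_vf \<A> (E i)" for i unfolding E_def by (rule frame_smooth[OF c(1) q])
  have Eq: "E i q = ?\<psi>' i" for i
    using eventually_nhds_x_imp_x[OF frame_eventually[OF c(1) q]] by (simp add: E_def coord_vf_def)
  have lin: "linear ?\<psi>'" by (rule linear_from_coord[OF c(1) q])
  \<comment> \<open>In its own chart a coordinate field has constant components, so the change to
    the preferred chart leaves only the Hessian.\<close>
  have flat: "frechet_derivative (vf_rep \<A> c (E j)) (at (map_of_chart c q)) i = 0" for i j
  proof -
    have "frechet_derivative (vf_rep \<A> c (E j)) (at (map_of_chart c q)) =
        frechet_derivative (vf_rep \<A> c (coord_vf \<A> c j)) (at (map_of_chart c q))"
      unfolding E_def by (rule vf_rep_derivative_cong[OF c(1) q frame_smooth[OF c(1) q] frame_eventually[OF c(1) q]])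
    moreover have "(vf_rep \<A> c (coord_vf \<A> c j) has_derivative (\<lambda>h. 0)) (at (map_of_chart c q))"
      by (rule has_derivative_transform_within_open[OF has_derivative_const open_chart_range[OF c(1)]])
        (use q in \<open>auto simp: vf_rep_coord_vf[OF c(1)]\<close>)
    ultimately show ?thesis by (simp add: frechet_derivative_eqI)
  qed
  have ch: "?\<psi>' (christoffel \<A> nab c v i j) = hessian ?\<psi> (map_of_chart c q) i j + Gam ?d (tchart \<A> ?d v) (?\<psi>' i) (?\<psi>' j)" for i j
  proof -
    have "?\<psi>' (christoffel \<A> nab c v i j) = nab v (E i) (E j)"
      unfolding christoffel_def E_def q_def[symmetric] by (rule from_to_coord[OF c(1) q])
    also have "\<dots> = frechet_derivative (vf_rep \<A> ?d (E j)) (at (map_of_chart ?d q)) (?\<psi>' i) +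
        Gam ?d (tchart \<A> ?d v) (?\<psi>' i) (?\<psi>' j)"
      using nab_chart[OF d(1) _ v E E, of i j] d(2) by (simp add: to_coord_chart_at Eq flip: q_def)
    also have "frechet_derivative (vf_rep \<A> ?d (E j)) (at (map_of_chart ?d q)) (?\<psi>' i) = hessian ?\<psi> (map_of_chart c q) i j"
      using vf_rep_derivative_change[OF c(1) q d E open_UNIV UNIV_I, of j i] flat
      by (simp add: from_coord_def vf_rep_at[OF c(1) q] Eq linear_0[OF linear_transition_deriv[OF c(1) d(1) q d(2)]]
          to_from_coord[OF c(1) q, unfolded from_coord_def])
    finally show ?thesis .
  qed
  have xr: "map_of_chart c q \<in> map_of_chart c ` (dom_of c \<inter> dom_of ?d)" using q d by auto
  \<comment> \<open>The right-hand side is bilinear in \<open>u\<close> and \<open>w\<close>, hence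
    recovered from basis pairs, where \<open>ch\<close> supplies the coefficients of the left-hand
    side.\<close>
  have H1: "linear (\<lambda>u. hessian ?\<psi> (map_of_chart c q) u w)" for w
    by (rule linear_hessian_left[OF transition_smooth[OF c(1) d(1)] xr])
  have H2: "linear (\<lambda>w. hessian ?\<psi> (map_of_chart c q) u w)" for u
    by (rule linear_hessian_right[OF open_overlap[OF c(1) d(1)] transition_smooth[OF c(1) d(1)] xr])
  have G1: "linear (\<lambda>u. Gam ?d (tchart \<A> ?d v) (?\<psi>' u) (?\<psi>' w))" for w
    by (rule linearI) (simp_all add: Gam_def linear_add[OF lin] linear_scale[OF lin] bilin_add_left bilin_scale_left)
  have G2: "linear (\<lambda>w. Gam ?d (tchart \<A> ?d v) (?\<psi>' u) (?\<psi>' w))" for u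
    by (rule linearI) (simp_all add: Gam_def linear_add[OF lin] linear_scale[OF lin] bilin_add_right bilin_scale_right)
  have "?\<psi>' (Gam c (tchart \<A> c v) u w) = bilin (\<lambda>i j. ?\<psi>' (christoffel \<A> nab c v i j)) u w"
    unfolding Gam_def tchart_inv_tchart[OF c] by (rule bilin_coeff_linear[OF lin])
  also have "\<dots> = bilin (\<lambda>i j. hessian ?\<psi> (map_of_chart c q) i j) u w + bilin (\<lambda>i j. Gam ?d (tchart \<A> ?d v) (?\<psi>' i) (?\<psi>' j)) u w"
    unfolding ch by (rule bilin_coeff_add)
  also have "\<dots> = hessian ?\<psi> (map_of_chart c q) u w + Gam ?d (tchart \<A> ?d v) (?\<psi>' u) (?\<psi>' w)"
    using bilin_bilinear[OF H1 H2] bilin_bilinear[OF G1 G2] by presburger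
  finally show ?thesis by (simp add: q_def)
qed

section \<open>Covariant derivatives along curves in an arbitrary chart\<close>

text \<open>Rewriting the components along the curve from \<open>c\<close> to the preferred chart
  produces a Hessian term; by \<open>christoffel_change\<close> this and \<Gamma> of the preferred
  chart are together the image of \<Gamma> of \<open>c\<close>. A covariant derivative can thus be
  followed in one chart while the preferred charts jump.\<close>

lemma cov_deriv_chart:
  assumes ab: "a < b" "t \<in> {a..b}" and c: "c \<in> \<A>" "\<gamma> t \<in> dom_of c"
    and ev: "\<forall>\<^sub>F \<sigma> in at t within {a..b}. \<gamma> \<sigma> \<in> dom_of c"
    and x: "((\<lambda>\<sigma>. map_of_chart c (\<gamma> \<sigma>)) has_vector_derivative \<xi>) (at t within {a..b})"
  shows velocity_chart: "velocity \<A> a b \<gamma> t = from_coord \<A> c (\<gamma> t) \<xi>"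
    and "\<lbrakk>(\<gamma> t, V) \<in> A; ((\<lambda>\<sigma>. to_coord \<A> c (\<gamma> \<sigma>) (X \<sigma>)) has_vector_derivative \<eta>) (at t within {a..b})\<rbrakk> \<Longrightarrow>
      cov_deriv \<A> nab a b \<gamma> (\<gamma> t, V) X t =
        from_coord \<A> c (\<gamma> t) (\<eta> + Gam c (tchart \<A> c (\<gamma> t, V)) \<xi> (to_coord \<A> c (\<gamma> t) (X t)))"
proof -
  let ?d = "chart_at \<A> (\<gamma> t)"
  let ?\<psi> = "map_of_chart ?d \<circ> chart_inv c" and ?\<psi>' = "from_coord \<A> c (\<gamma> t)" and ?x = "map_of_chart c (\<gamma> t)"
  let ?O = "map_of_chart c ` (dom_of c \<inter> dom_of ?d)"
  have d: "?d \<in> \<A>" "\<gamma> t \<in> dom_of ?d" by (simp_all add: chart_at_in mem_chart_at)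
  note sm = transition_smooth[OF c(1) d(1)] and o = open_overlap[OF c(1) d(1)]
  have xr: "?x \<in> ?O" using c d by auto
  have x': "((\<lambda>\<sigma>. map_of_chart c (\<gamma> \<sigma>)) has_derivative (\<lambda>h. h *\<^sub>R \<xi>)) (at t within {a..b})"
    using x by (simp add: has_vector_derivative_def)
  have "\<forall>\<^sub>F \<sigma> in at t within {a..b}. map_of_chart c (\<gamma> \<sigma>) \<in> ?O"
    using has_derivative_continuous[OF x'] o xr by (simp add: continuous_within topological_tendstoD)
  \<comment> \<open>Coordinates in the overlap put \<open>\<gamma> \<sigma>\<close> into both
    domains only because \<open>\<gamma> \<sigma>\<close> already lies in \<open>dom_of c\<close>:
    \<open>map_of_chart c\<close> is a total function and may fail to be injective outside.\<close>
  with ev have evd: "\<forall>\<^sub>F \<sigma> in at t within {a..b}. \<gamma> \<sigma> \<in> dom_of c \<and> \<gamma> \<sigma> \<in> dom_of ?d"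
  proof eventually_elim
    case (elim \<sigma>)
    then obtain p where "p \<in> dom_of c" "p \<in> dom_of ?d" "map_of_chart c (\<gamma> \<sigma>) = map_of_chart c p" by blast
    then show ?case using elim chart_inv_left[OF c(1)] by metis
  qed
  have \<psi>': "frechet_derivative ?\<psi> (at ?x) = ?\<psi>'" by (simp add: from_coord_def transition_deriv_def fun_eq_iff)
  have lin: "linear ?\<psi>'" by (rule linear_from_coord[OF c])
  have "((\<lambda>\<sigma>. ?\<psi> (map_of_chart c (\<gamma> \<sigma>))) has_derivative (\<lambda>h. ?\<psi>' (h *\<^sub>R \<xi>))) (at t within {a..b})"
    unfolding \<psi>'[symmetric] by (rule has_derivative_compose[OF x' smooth_on_has_derivative[OF sm xr]])
  then have "((\<lambda>\<sigma>. map_of_chart ?d (\<gamma> \<sigma>)) has_derivative (\<lambda>h. ?\<psi>' (h *\<^sub>R \<xi>))) (at t within {a..b})"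
  proof (rule has_derivative_transform_eventually)
    show "\<forall>\<^sub>F \<sigma> in at t within {a..b}. ?\<psi> (map_of_chart c (\<gamma> \<sigma>)) = map_of_chart ?d (\<gamma> \<sigma>)"
      using evd by eventually_elim (simp add: chart_inv_left[OF c(1)])
  qed (use c ab in \<open>simp_all add: chart_inv_left\<close>)
  then have "((\<lambda>\<sigma>. map_of_chart ?d (\<gamma> \<sigma>)) has_vector_derivative ?\<psi>' \<xi>) (at t within {a..b})"
    by (simp add: has_vector_derivative_def linear_scale[OF lin])
  then show vel: "velocity \<A> a b \<gamma> t = ?\<psi>' \<xi>"
    unfolding velocity_def using vector_derivative_within_closed_interval[OF ab] by blast
  assume V: "(\<gamma> t, V) \<in> A" and X: "((\<lambda>\<sigma>. to_coord \<A> c (\<gamma> \<sigma>) (X \<sigma>)) has_vector_derivative \<eta>) (at t within {a..b})"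
  let ?X = "to_coord \<A> c (\<gamma> t) (X t)"
  have X': "((\<lambda>\<sigma>. to_coord \<A> c (\<gamma> \<sigma>) (X \<sigma>)) has_derivative (\<lambda>h. h *\<^sub>R \<eta>)) (at t within {a..b})"
    using X by (simp add: has_vector_derivative_def)
  have "((\<lambda>\<sigma>. frechet_derivative ?\<psi> (at (map_of_chart c (\<gamma> \<sigma>))) (to_coord \<A> c (\<gamma> \<sigma>) (X \<sigma>))) has_derivative
      (\<lambda>h. hessian ?\<psi> ?x (h *\<^sub>R \<xi>) ?X + frechet_derivative ?\<psi> (at ?x) (h *\<^sub>R \<eta>))) (at t within {a..b})"
    by (rule has_derivative_frechet_derivative_apply[OF o sm x' xr X' ab(2)])
  then have "((\<lambda>\<sigma>. to_coord \<A> ?d (\<gamma> \<sigma>) (X \<sigma>)) has_derivative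
      (\<lambda>h. hessian ?\<psi> ?x (h *\<^sub>R \<xi>) ?X + frechet_derivative ?\<psi> (at ?x) (h *\<^sub>R \<eta>))) (at t within {a..b})"
  proof (rule has_derivative_transform_eventually)
    show "\<forall>\<^sub>F \<sigma> in at t within {a..b}. frechet_derivative ?\<psi> (at (map_of_chart c (\<gamma> \<sigma>))) (to_coord \<A> c (\<gamma> \<sigma>) (X \<sigma>)) = to_coord \<A> ?d (\<gamma> \<sigma>) (X \<sigma>)"
      using evd by eventually_elim (simp add: to_coord_change[OF c(1) d(1), symmetric] transition_deriv_def)
  qed (use c d ab in \<open>simp_all add: to_coord_change[OF c(1) d(1), symmetric] transition_deriv_def\<close>)
  then have "((\<lambda>\<sigma>. to_coord \<A> ?d (\<gamma> \<sigma>) (X \<sigma>)) has_vector_derivative hessian ?\<psi> ?x \<xi> ?X + ?\<psi>' \<eta>) (at t within {a..b})"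
    by (simp add: has_vector_derivative_def linear_scale[OF linear_hessian_left[OF sm xr]] \<psi>' linear_scale[OF lin] scaleR_add_right)
  then have der: "vector_derivative (\<lambda>\<sigma>. to_coord \<A> ?d (\<gamma> \<sigma>) (X \<sigma>)) (at t within {a..b}) = hessian ?\<psi> ?x \<xi> ?X + ?\<psi>' \<eta>"
    by (rule vector_derivative_within_closed_interval[OF ab])
  have "cov_deriv \<A> nab a b \<gamma> (\<gamma> t, V) X t = hessian ?\<psi> ?x \<xi> ?X + ?\<psi>' \<eta> + Gam ?d (tchart \<A> ?d (\<gamma> t, V)) (?\<psi>' \<xi>) (X t)"
    using d by (simp add: cov_deriv_def Let_def der vel Gam_def tchart_inv_tchart bilin_def)
  also have "X t = ?\<psi>' ?X" by (simp add: from_to_coord[OF c])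
  finally show "cov_deriv \<A> nab a b \<gamma> (\<gamma> t, V) X t = ?\<psi>' (\<eta> + Gam c (tchart \<A> c (\<gamma> t, V)) \<xi> ?X)"
    using christoffel_change[OF c(1) _ V, of \<xi> ?X] c by (simp add: linear_add[OF lin] from_to_coord[OF c] comp_def)
qed

section \<open>Tensors in the preferred chart\<close>

text \<open>In the preferred chart at the foot point the fibre coordinate of \<open>v\<close> is
  \<open>snd v\<close> itself, so a motion along the fibre is a motion in the second coordinate of
  the chart image.\<close>

lemma vert_deriv_chart:
  assumes "v \<in> A" and sm: "smooth_on (TA (chart_at \<A> (fst v))) (aniso_rep \<A> (chart_at \<A> (fst v)) \<Y>)"
  shows "vert_deriv \<Y> v \<zeta> = frechet_derivative (aniso_rep \<A> (chart_at \<A> (fst v)) \<Y>) (at (tchart \<A> (chart_at \<A> (fst v)) v)) (0, \<zeta>)"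
proof -
  define p where "p = fst v"
  let ?c = "chart_at \<A> p"
  have c: "?c \<in> \<A>" "p \<in> dom_of ?c" by (simp_all add: chart_at_in mem_chart_at)
  let ?z = "tchart \<A> ?c v"
  have z: "?z = (map_of_chart ?c p, snd v)" by (simp add: tchart_def p_def to_coord_chart_at)
  have zT: "?z \<in> TA ?c" using tchart_in_TA[OF assms(1)] c by (simp add: p_def)
  have eq: "\<Y> (p, y) = aniso_rep \<A> ?c \<Y> (map_of_chart ?c p, y)" for y
    using c by (simp add: aniso_rep_def tchart_inv_def chart_inv_left to_coord_chart_at from_coord_chart_at)
  have "((\<lambda>t::real. (map_of_chart ?c p, snd v + t *\<^sub>R \<zeta>)) has_derivative (\<lambda>h. (0, h *\<^sub>R \<zeta>))) (at 0)"
    by (auto intro!: derivative_eq_intros)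
  moreover have "(aniso_rep \<A> ?c \<Y> has_derivative frechet_derivative (aniso_rep \<A> ?c \<Y>) (at ?z)) (at (map_of_chart ?c p, snd v + 0 *\<^sub>R \<zeta>))"
    using smooth_on_has_derivative[OF sm[folded p_def] zT] by (simp add: z)
  ultimately have "((\<lambda>t. \<Y> (p, snd v + t *\<^sub>R \<zeta>)) has_derivative (\<lambda>h. frechet_derivative (aniso_rep \<A> ?c \<Y>) (at ?z) (0, h *\<^sub>R \<zeta>))) (at 0)"
    unfolding eq by (rule has_derivative_compose)
  moreover have "frechet_derivative (aniso_rep \<A> ?c \<Y>) (at ?z) (0, h *\<^sub>R \<zeta>) = h *\<^sub>R frechet_derivative (aniso_rep \<A> ?c \<Y>) (at ?z) (0, \<zeta>)" for h
    using linear_scale[OF smooth_on_linear[OF sm[folded p_def] zT], of h "(0, \<zeta>)"] by simp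
  ultimately show ?thesis
    unfolding vert_deriv_def p_def[symmetric] by (intro vector_derivative_at) (simp add: has_vector_derivative_def)
qed

lemma in_A_iff:
  assumes "c \<in> \<A>" "fst v \<in> dom_of c" shows "tchart \<A> c v \<in> TA c \<longleftrightarrow> v \<in> A"
  using tchart_in_TA assms tchart_inv_tchart[OF assms] TA_cases[OF assms(1)] by metis

text \<open>The coordinate field with the components of \<open>v\<close> passes through
  \<open>v\<close>; as \<open>TA c\<close> is open, it stays in \<open>A\<close> over nearby
  points.\<close>

lemma admissible_ext_exists:
  assumes "v \<in> A" shows "\<exists>V. admissible_ext \<A> A v V"
proof -
  define c where "c = chart_at \<A> (fst v)"
  have c: "c \<in> \<A>" "fst v \<in> dom_of c" by (simp_all add: c_def chart_at_in mem_chart_at)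
  define y where "y = snd v"
  let ?V = "coord_vf \<A> c y"
  define O' where "O' = {x. (x, y) \<in> TA c}"
  have O': "open O'"
    unfolding O'_def using open_vimage[OF open_TA[OF c(1)], of "\<lambda>x. (x, y)"]
    by (simp add: vimage_def continuous_on_Pair)
  define \<Omega> where "\<Omega> = dom_of c \<inter> map_of_chart c -` O'"
  have tc: "tchart \<A> c (q, ?V q) = (map_of_chart c q, y)" if "q \<in> dom_of c" for q
    using that c by (simp add: tchart_def coord_vf_def to_from_coord)
  have "open \<Omega>" unfolding \<Omega>_def by (rule open_chart_preimage[OF c(1) O'])
  moreover have Vv: "?V (fst v) = snd v" by (simp add: coord_vf_def c_def from_coord_chart_at y_def)
  moreover have "fst v \<in> \<Omega>"
    using tchart_in_TA[OF assms c(2)] tc[OF c(2)] c Vv by (simp add: \<Omega>_def O'_def)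
  moreover have "smooth_vf_on \<A> \<Omega> ?V"
    using smooth_coord_vf[OF c(1)] unfolding smooth_vf_on_def \<Omega>_def
    by (meson Int_mono Int_lower1 image_mono smooth_on_subset subset_refl)
  moreover have "(q, ?V q) \<in> A" if "q \<in> \<Omega>" for q
    using that in_A_iff[of c "(q, ?V q)"] tc c by (simp add: \<Omega>_def O'_def)
  ultimately show ?thesis unfolding admissible_ext_def by blast
qed

text \<open>Along \<open>V\<close> the chain rule yields the derivative of \<Y> in direction
  \<open>(u, V' u)\<close>, and the vertical correction subtracts the one in direction
  \<open>(0, V' u + \<Gamma>(u, v))\<close>. The unknown \<open>V' u\<close> cancels, and with it
  every trace of the choice of \<open>V\<close>.\<close>

lemma conn_aniso_chart:
  assumes v: "v \<in> A" and X: "smooth_vf \<A> X"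
    and sm: "smooth_on (TA (chart_at \<A> (fst v))) (aniso_rep \<A> (chart_at \<A> (fst v)) \<Y>)"
  defines "c \<equiv> chart_at \<A> (fst v)"
  shows "conn_aniso \<A> A nab v X \<Y> =
    frechet_derivative (aniso_rep \<A> c \<Y>) (at (tchart \<A> c v)) (X (fst v), 0) +
    Gam c (tchart \<A> c v) (X (fst v)) (\<Y> v) -
    frechet_derivative (aniso_rep \<A> c \<Y>) (at (tchart \<A> c v)) (0, Gam c (tchart \<A> c v) (X (fst v)) (snd v))"
proof -
  define p where "p = fst v"
  define u where "u = X p"
  have c: "c \<in> \<A>" "p \<in> dom_of c" by (simp_all add: c_def p_def chart_at_in mem_chart_at)
  have T: "to_coord \<A> c p y = y" for y by (simp add: c_def p_def to_coord_chart_at)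
  let ?z = "tchart \<A> c v" and ?Y = "aniso_rep \<A> c \<Y>" and ?x = "map_of_chart c p"
  have z: "?z = (?x, snd v)" using T by (simp add: tchart_def p_def)
  have zT: "?z \<in> TA c" using tchart_in_TA[OF v] c by (simp add: p_def)
  note DY = smooth_on_has_derivative[OF sm[folded c_def] zT] and linY = smooth_on_linear[OF sm[folded c_def] zT]
  define V where "V = (SOME V. admissible_ext \<A> A v V)"
  have "admissible_ext \<A> A v V" unfolding V_def by (rule someI_ex[OF admissible_ext_exists[OF v]])
  then obtain \<Omega> where \<Omega>: "open \<Omega>" "p \<in> \<Omega>" "smooth_vf_on \<A> \<Omega> V" "\<And>q. q \<in> \<Omega> \<Longrightarrow> (q, V q) \<in> A" "V p = snd v"
    unfolding admissible_ext_def p_def by blast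
  let ?W = "map_of_chart c ` (dom_of c \<inter> \<Omega>)"
  have W: "open ?W" by (intro open_chart_image open_dom_Int c \<Omega>) simp
  have xW: "?x \<in> ?W" using c \<Omega> by auto
  have sV: "smooth_on ?W (vf_rep \<A> c V)" by (rule smooth_vf_onD[OF \<Omega>(3) c(1)]) auto
  let ?V' = "frechet_derivative (vf_rep \<A> c V) (at ?x)"
  define Z where "Z q = \<Y> (q, V q)" for q
  have Zrep: "vf_rep \<A> c Z x = ?Y (x, vf_rep \<A> c V x)" if "x \<in> ?W" for x
    using that c by (auto simp: vf_rep_at aniso_rep_def tchart_inv_def chart_inv_left from_to_coord Z_def)
  have inT: "(x, vf_rep \<A> c V x) \<in> TA c" if "x \<in> ?W" for x
  proof -
    from that obtain q where q: "q \<in> dom_of c" "q \<in> \<Omega>" "x = map_of_chart c q" by blast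
    then show ?thesis using tchart_in_TA[OF \<Omega>(4)[OF q(2)], of c] c by (simp add: vf_rep_at tchart_def)
  qed
  have "smooth_on ?W (\<lambda>x. ?Y (x, vf_rep \<A> c V x))"
    by (rule smooth_on_compose[OF W inT sm[folded c_def] smooth_on_Pair[OF W smooth_on_ident[OF W] sV]])
  then have "smooth_on ?W (vf_rep \<A> c Z)" by (rule smooth_on_cong[OF W, rotated]) (simp add: Zrep)
  then have sZ: "smooth_vf_on \<A> (dom_of c \<inter> \<Omega>) Z"
    using c open_dom_Int[OF c(1) \<Omega>(1)] by (intro smooth_vf_onI) blast
  have oc: "open (dom_of c \<inter> \<Omega>)" "p \<in> dom_of c \<inter> \<Omega>" using c \<Omega> open_dom_Int by auto
  have Vp: "vf_rep \<A> c V ?x = snd v" using c \<Omega> T by (simp add: vf_rep_at)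
  have "((\<lambda>x. (x, vf_rep \<A> c V x)) has_derivative (\<lambda>h. (h, ?V' h))) (at ?x)"
    by (intro has_derivative_Pair has_derivative_ident smooth_on_has_derivative[OF sV xW])
  then have "((\<lambda>x. ?Y (x, vf_rep \<A> c V x)) has_derivative (\<lambda>h. frechet_derivative ?Y (at ?z) (h, ?V' h))) (at ?x)"
    by (rule has_derivative_compose) (use DY Vp z in simp)
  then have "(vf_rep \<A> c Z has_derivative (\<lambda>h. frechet_derivative ?Y (at ?z) (h, ?V' h))) (at ?x)"
    by (rule has_derivative_transform_within_open[OF _ W xW]) (simp add: Zrep)
  then have DZ: "frechet_derivative (vf_rep \<A> c Z) (at ?x) h = frechet_derivative ?Y (at ?z) (h, ?V' h)" for h
    by (rule frechet_derivative_eqI)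
  note nab_p = nab_chart[OF c(1) _ v X, folded p_def, OF c(2), unfolded T]
  have gZ: "nab v X (germ_ext \<A> p Z) = frechet_derivative ?Y (at ?z) (u, ?V' u) + Gam c ?z u (\<Y> v)"
  proof -
    have "germ_ext \<A> p Z p = \<Y> v"
      using eventually_nhds_x_imp_x[OF germ_ext_eventually[OF oc sZ]] \<Omega>(5) by (simp add: Z_def p_def)
    then show ?thesis
      using nab_p[OF germ_ext_smooth(1)[OF oc sZ]] DZ
        vf_rep_derivative_cong[OF c germ_ext_smooth(1)[OF oc sZ] germ_ext_eventually[OF oc sZ]] by (simp add: u_def)
  qed
  have gV: "nab v X (germ_ext \<A> p V) = ?V' u + Gam c ?z u (snd v)"
  proof -
    have "germ_ext \<A> p V p = snd v"
      using eventually_nhds_x_imp_x[OF germ_ext_eventually[OF \<Omega>(1-3)]] \<Omega>(5) by simp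
    then show ?thesis
      using nab_p[OF germ_ext_smooth(1)[OF \<Omega>(1-3)]]
        vf_rep_derivative_cong[OF c germ_ext_smooth(1)[OF \<Omega>(1-3)] germ_ext_eventually[OF \<Omega>(1-3)]] by (simp add: u_def)
  qed
  have split: "frechet_derivative ?Y (at ?z) (u, ?V' u) = frechet_derivative ?Y (at ?z) (u, 0) + frechet_derivative ?Y (at ?z) (0, ?V' u)"
    using linear_add[OF linY, of "(u, 0)" "(0, ?V' u)"] by simp
  have split2: "frechet_derivative ?Y (at ?z) (0, ?V' u + w) = frechet_derivative ?Y (at ?z) (0, ?V' u) + frechet_derivative ?Y (at ?z) (0, w)" for w
    using linear_add[OF linY, of "(0, ?V' u)" "(0, w)"] by simp
  show ?thesis
    unfolding conn_aniso_def Let_def V_def[symmetric] p_def[symmetric] vert_deriv_chart[OF v sm] gV u_def[symmetric] c_def[symmetric]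
    using gZ[unfolded Z_def] split split2 by (simp add: p_def c_def)
qed

end

context aniso_manifold
begin

section \<open>Torsion, curvature and P through the Christoffel coefficients\<close>

text \<open>The derivative terms of \<open>nab_chart\<close> are those of
  \<open>lie_bracket_chart\<close>, which leaves \<Gamma> minus its transpose. The chart is
  arbitrary because the torsion is later differentiated over a neighbourhood in one chart.\<close>

lemma torsion_chart:
  assumes v: "v \<in> A" and c: "c \<in> \<A>" "fst v \<in> dom_of c"
  shows "to_coord \<A> c (fst v) (torsion \<A> nab v u w) =
    Gam c (tchart \<A> c v) (to_coord \<A> c (fst v) u) (to_coord \<A> c (fst v) w) -
    Gam c (tchart \<A> c v) (to_coord \<A> c (fst v) w) (to_coord \<A> c (fst v) u)"
  unfolding torsion_def torsion_vf_def
  by (simp add: linear_diff[OF linear_to_coord[OF c]] nab_chart[OF c v] lie_bracket_chart[OF _ _ c] vf_ext_smooth vf_ext_at)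

lemma nab_rep:
  assumes "c \<in> \<A>" "z \<in> TA c" "smooth_vf \<A> Y" "smooth_vf \<A> Z"
  shows "aniso_rep \<A> c (\<lambda>r. nab r Y Z) z =
    frechet_derivative (vf_rep \<A> c Z) (at (fst z)) (vf_rep \<A> c Y (fst z)) +
    Gam c z (vf_rep \<A> c Y (fst z)) (vf_rep \<A> c Z (fst z))"
proof -
  obtain v where v: "v \<in> A" "fst v \<in> dom_of c" "z = tchart \<A> c v" "tchart_inv \<A> c z = v" "fst z = map_of_chart c (fst v)"
    by (rule TA_cases[OF assms(1,2)])
  show ?thesis
    using nab_chart[OF assms(1) v(2,1) assms(3,4)] v(3-5)
    by (simp add: aniso_rep_def chart_inv_left[OF assms(1) v(2)] vf_rep_at[OF assms(1) v(2)])
qed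

text \<open>Product rule for \<open>nab_rep\<close>. The Hessian of \<open>Z\<close> appears because
  the derivative of \<open>Z\<close> is taken at a moving point; \<open>Y\<close> and
  \<open>Z\<close> see only the base part \<open>fst dz\<close>.\<close>

lemma nab_rep_derivative:
  assumes c: "c \<in> \<A>" and z: "z \<in> TA c" and Y: "smooth_vf \<A> Y" and Z: "smooth_vf \<A> Z"
  defines "DY \<equiv> frechet_derivative (vf_rep \<A> c Y) (at (fst z))"
    and "DZ \<equiv> frechet_derivative (vf_rep \<A> c Z) (at (fst z))"
  shows "frechet_derivative (aniso_rep \<A> c (\<lambda>r. nab r Y Z)) (at z) dz =
    hessian (vf_rep \<A> c Z) (fst z) (fst dz) (vf_rep \<A> c Y (fst z)) + DZ (DY (fst dz)) +
    (DGam c z dz (vf_rep \<A> c Y (fst z)) (vf_rep \<A> c Z (fst z)) +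
     Gam c z (DY (fst dz)) (vf_rep \<A> c Z (fst z)) + Gam c z (vf_rep \<A> c Y (fst z)) (DZ (fst dz)))"
proof -
  note o = open_chart_range[OF c] and Y' = smooth_vf_onD[OF Y c subset_refl subset_UNIV]
    and Z' = smooth_vf_onD[OF Z c subset_refl subset_UNIV]
  have x: "fst z \<in> map_of_chart c ` dom_of c" by (rule TA_cases[OF c z]) auto
  have f: "(fst has_derivative fst) (at z)" by (rule has_derivative_fst[OF has_derivative_ident])
  note FY = has_derivative_compose[OF f smooth_on_has_derivative[OF Y' x], folded DY_def]
  note FZ = has_derivative_compose[OF f smooth_on_has_derivative[OF Z' x], folded DZ_def]
  have "((\<lambda>z. frechet_derivative (vf_rep \<A> c Z) (at (fst z)) (vf_rep \<A> c Y (fst z)) +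
      Gam c z (vf_rep \<A> c Y (fst z)) (vf_rep \<A> c Z (fst z))) has_derivative
    (\<lambda>dz. (hessian (vf_rep \<A> c Z) (fst z) (fst dz) (vf_rep \<A> c Y (fst z)) + DZ (DY (fst dz))) +
    (DGam c z dz (vf_rep \<A> c Y (fst z)) (vf_rep \<A> c Z (fst z)) +
     Gam c z (DY (fst dz)) (vf_rep \<A> c Z (fst z)) + Gam c z (vf_rep \<A> c Y (fst z)) (DZ (fst dz))))) (at z)"
    unfolding DZ_def
    by (intro has_derivative_add Gam_has_derivative[OF c has_derivative_ident z FY FZ[unfolded DZ_def]]
        has_derivative_frechet_derivative_apply[OF o Z' f x FY UNIV_I])
  then have "(aniso_rep \<A> c (\<lambda>r. nab r Y Z) has_derivative
    (\<lambda>dz. (hessian (vf_rep \<A> c Z) (fst z) (fst dz) (vf_rep \<A> c Y (fst z)) + DZ (DY (fst dz))) +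
    (DGam c z dz (vf_rep \<A> c Y (fst z)) (vf_rep \<A> c Z (fst z)) +
     Gam c z (DY (fst dz)) (vf_rep \<A> c Z (fst z)) + Gam c z (vf_rep \<A> c Y (fst z)) (DZ (fst dz))))) (at z)"
    by (rule has_derivative_transform_within_open[OF _ open_TA[OF c] z]) (simp add: nab_rep[OF c _ Y Z])
  then show ?thesis by (rule frechet_derivative_eqI)
qed

lemma Gam_zero [simp]: "Gam c z 0 w = 0" "Gam c z u 0 = 0"
  by (simp_all add: Gam_def bilin_def)

lemma DGam_zero [simp]: "DGam c z dz 0 w = 0" "DGam c z dz u 0 = 0"
  by (simp_all add: DGam_def bilin_def)

lemma
  assumes "v \<in> A"
  shows preferred_chart: "chart_at \<A> (fst v) \<in> \<A>" "fst v \<in> dom_of (chart_at \<A> (fst v))"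
    and tchart_preferred: "tchart \<A> (chart_at \<A> (fst v)) v \<in> TA (chart_at \<A> (fst v))"
      "tchart \<A> (chart_at \<A> (fst v)) v = (map_of_chart (chart_at \<A> (fst v)) (fst v), snd v)"
  using assms by (simp_all add: chart_at_in mem_chart_at tchart_in_TA) (simp add: tchart_def to_coord_chart_at)

text \<open>In the vertical correction the direction has base part 0, so only the fibre derivative
  of \<Gamma> survives there.\<close>

lemma conn_aniso_nab:
  assumes v: "v \<in> A" and X: "smooth_vf \<A> X" and Y: "smooth_vf \<A> Y" and Z: "smooth_vf \<A> Z"
  defines "c \<equiv> chart_at \<A> (fst v)"
  defines "z \<equiv> tchart \<A> c v" and "x \<equiv> map_of_chart c (fst v)"
    and "u \<equiv> X (fst v)" and "w \<equiv> Y (fst v)" and "\<zeta> \<equiv> Z (fst v)"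
  defines "DY \<equiv> frechet_derivative (vf_rep \<A> c Y) (at x)" and "DZ \<equiv> frechet_derivative (vf_rep \<A> c Z) (at x)"
  shows "conn_aniso \<A> A nab v X (\<lambda>r. nab r Y Z) =
    hessian (vf_rep \<A> c Z) x u w + DZ (DY u) + DGam c z (u, 0) w \<zeta> + Gam c z (DY u) \<zeta> + Gam c z w (DZ u) +
    Gam c z u (DZ w + Gam c z w \<zeta>) - DGam c z (0, Gam c z u (snd v)) w \<zeta>"
proof -
  have c: "c \<in> \<A>" "fst v \<in> dom_of c" and zT: "z \<in> TA c" and z: "fst z = x"
    using preferred_chart[OF v] tchart_preferred[OF v] by (simp_all add: c_def z_def x_def)
  have r: "vf_rep \<A> c F x = F (fst v)" for F
    using c vf_rep_at[of c "fst v" F] to_coord_chart_at[of "fst v"] by (simp add: x_def flip: c_def)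
  have x: "x \<in> map_of_chart c ` dom_of c" using c by (simp add: x_def)
  note Y' = smooth_vf_onD[OF Y c(1) subset_refl subset_UNIV] and Z' = smooth_vf_onD[OF Z c(1) subset_refl subset_UNIV]
  have l: "DY 0 = 0" "DZ 0 = 0" "hessian (vf_rep \<A> c Z) x 0 w = 0"
    unfolding DY_def DZ_def
    using linear_0[OF smooth_on_linear[OF Y' x]] linear_0[OF smooth_on_linear[OF Z' x]] linear_0[OF linear_hessian_left[OF Z' x]] by auto
  have n: "nab v Y Z = DZ w + Gam c z w \<zeta>"
    using nab_chart[OF c v Y Z] to_coord_chart_at[of "fst v"]
    by (simp add: DZ_def x_def z_def w_def \<zeta>_def flip: c_def)
  have sm: "smooth_on (TA (chart_at \<A> (fst v))) (aniso_rep \<A> (chart_at \<A> (fst v)) (\<lambda>r. nab r Y Z))"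
    using nab_smooth[OF Y Z] c unfolding aniso_vf_def TA_def c_def by blast
  show ?thesis
    using conn_aniso_chart[OF v X sm]
    by (simp add: nab_rep_derivative[OF c(1) zT Y Z] z r n l u_def[symmetric] w_def[symmetric] \<zeta>_def[symmetric]
        DY_def[symmetric] DZ_def[symmetric] c_def[symmetric] z_def[symmetric])
qed

text \<open>Derivatives of the extensions cancel: second derivatives of \<open>Z\<close> by
  symmetry, derivatives of \<open>X\<close> and \<open>Y\<close> against the bracket term, first
  derivatives of \<open>Z\<close> inside \<Gamma> between the two orders. What remains is the
  classical formula plus two fibre derivatives of \<Gamma>.\<close>

lemma curvature_chart:
  assumes v: "v \<in> A"
  defines "c \<equiv> chart_at \<A> (fst v)"
  defines "z \<equiv> tchart \<A> c v"
  shows "curvature \<A> A nab v u w \<zeta> =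
    DGam c z (u, 0) w \<zeta> - DGam c z (w, 0) u \<zeta> -
    DGam c z (0, Gam c z u (snd v)) w \<zeta> + DGam c z (0, Gam c z w (snd v)) u \<zeta> +
    Gam c z u (Gam c z w \<zeta>) - Gam c z w (Gam c z u \<zeta>)"
proof -
  define X where "X = vf_ext \<A> (fst v) u"
  define Y where "Y = vf_ext \<A> (fst v) w"
  define Z where "Z = vf_ext \<A> (fst v) \<zeta>"
  have s: "smooth_vf \<A> X" "smooth_vf \<A> Y" "smooth_vf \<A> Z"
    and val: "X (fst v) = u" "Y (fst v) = w" "Z (fst v) = \<zeta>"
    by (simp_all add: X_def Y_def Z_def vf_ext_smooth vf_ext_at)
  have c: "c \<in> \<A>" "fst v \<in> dom_of c"
    using preferred_chart[OF v] by (simp_all add: c_def)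
  have T: "to_coord \<A> c (fst v) y = y" for y by (simp add: c_def to_coord_chart_at)
  let ?x = "map_of_chart c (fst v)"
  have x: "?x \<in> map_of_chart c ` dom_of c" using c by simp
  let ?D = "\<lambda>F. frechet_derivative (vf_rep \<A> c F) (at ?x)"
  note Z' = smooth_vf_onD[OF s(3) c(1) subset_refl subset_UNIV]
  have lie: "lie_bracket \<A> X Y (fst v) = ?D Y u - ?D X w"
    using lie_bracket_chart[OF s(1,2) c] by (simp add: T val)
  have "nab v (lie_bracket \<A> X Y) Z = ?D Z (?D Y u - ?D X w) + Gam c z (?D Y u - ?D X w) \<zeta>"
    using nab_chart[OF c v smooth_lie_bracket[OF s(1,2)] s(3)] by (simp add: T val lie z_def)
  then have n: "nab v (lie_bracket \<A> X Y) Z = ?D Z (?D Y u) - ?D Z (?D X w) + (Gam c z (?D Y u) \<zeta> - Gam c z (?D X w) \<zeta>)"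
    by (simp add: linear_diff[OF smooth_on_linear[OF Z' x]] Gam_def bilin_diff_left)
  have h: "hessian (vf_rep \<A> c Z) ?x u w = hessian (vf_rep \<A> c Z) ?x w u"
    by (rule hessian_symmetric[OF open_chart_range[OF c(1)] x Z'])
  note e1 = conn_aniso_nab[OF v s(1,2,3), folded c_def, folded z_def, unfolded val]
  note e2 = conn_aniso_nab[OF v s(2,1,3), folded c_def, folded z_def, unfolded val]
  show ?thesis
    unfolding curvature_def curvature_vf_def X_def[symmetric] Y_def[symmetric] Z_def[symmetric] e1 e2 n h
    by (simp add: Gam_def bilin_add_right)
qed

text \<open>P moves only the fibre coordinate while both extended fields stay fixed, so nothing but
  \<Gamma> is differentiated.\<close>

lemma vert_conn_chart:
  assumes v: "v \<in> A"
  defines "c \<equiv> chart_at \<A> (fst v)"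
  shows "vert_conn \<A> nab v u w \<zeta> = DGam c (tchart \<A> c v) (0, \<zeta>) u w"
proof -
  define X where "X = vf_ext \<A> (fst v) u"
  define Y where "Y = vf_ext \<A> (fst v) w"
  have s: "smooth_vf \<A> X" "smooth_vf \<A> Y" and val: "X (fst v) = u" "Y (fst v) = w"
    by (simp_all add: X_def Y_def vf_ext_smooth vf_ext_at)
  have c: "c \<in> \<A>" "fst v \<in> dom_of c" and zT: "tchart \<A> c v \<in> TA c" and z: "fst (tchart \<A> c v) = map_of_chart c (fst v)"
    using preferred_chart[OF v] tchart_preferred[OF v] by (simp_all add: c_def)
  let ?x = "map_of_chart c (fst v)"
  have x: "?x \<in> map_of_chart c ` dom_of c" using c by simp
  have r: "vf_rep \<A> c F ?x = F (fst v)" for F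
    using c vf_rep_at[of c "fst v" F] to_coord_chart_at[of "fst v"] by (simp flip: c_def)
  note X' = smooth_vf_onD[OF s(1) c(1) subset_refl subset_UNIV] and Y' = smooth_vf_onD[OF s(2) c(1) subset_refl subset_UNIV]
  have l: "frechet_derivative (vf_rep \<A> c X) (at ?x) 0 = 0" "frechet_derivative (vf_rep \<A> c Y) (at ?x) 0 = 0"
      "hessian (vf_rep \<A> c Y) ?x 0 u = 0"
    using linear_0[OF smooth_on_linear[OF X' x]] linear_0[OF smooth_on_linear[OF Y' x]] linear_0[OF linear_hessian_left[OF Y' x]] by auto
  have sm: "smooth_on (TA (chart_at \<A> (fst v))) (aniso_rep \<A> (chart_at \<A> (fst v)) (\<lambda>r. nab r X Y))"
    using nab_smooth[OF s] c unfolding aniso_vf_def TA_def c_def by blast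
  have "vert_conn \<A> nab v u w \<zeta> = vert_deriv (\<lambda>r. nab r X Y) v \<zeta>"
    unfolding vert_conn_def vert_conn_vf_def vert_deriv_def by (simp add: X_def Y_def vf_ext_at)
  also have "\<dots> = DGam c (tchart \<A> c v) (0, \<zeta>) u w"
    unfolding vert_deriv_chart[OF v sm] c_def[symmetric] nab_rep_derivative[OF c(1) zT s]
    by (simp add: z r val l)
  finally show ?thesis .
qed

text \<open>A vector field on the manifold is constant along fibres, so the vertical correction is
  zero and the formula of \<open>nab_chart\<close> is left.\<close>

lemma conn_aniso_vf:
  assumes v: "v \<in> A" and X: "smooth_vf \<A> X" and Y: "smooth_vf \<A> Y"
  defines "c \<equiv> chart_at \<A> (fst v)"
  shows "conn_aniso \<A> A nab v X (\<lambda>r. Y (fst r)) =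
    frechet_derivative (vf_rep \<A> c Y) (at (map_of_chart c (fst v))) (X (fst v)) + Gam c (tchart \<A> c v) (X (fst v)) (Y (fst v))"
proof -
  have c: "c \<in> \<A>" "fst v \<in> dom_of c" and zT: "tchart \<A> c v \<in> TA c" and z: "fst (tchart \<A> c v) = map_of_chart c (fst v)"
    using preferred_chart[OF v] tchart_preferred[OF v] by (simp_all add: c_def)
  note Y' = smooth_vf_onD[OF Y c(1) subset_refl subset_UNIV]
  have T: "fst z \<in> map_of_chart c ` dom_of c" if "z \<in> TA c" for z by (rule TA_cases[OF c(1) that]) auto
  have eq: "aniso_rep \<A> c (\<lambda>r. Y (fst r)) = (\<lambda>z. vf_rep \<A> c Y (fst z))"
    by (simp add: aniso_rep_def tchart_inv_def vf_rep_def fun_eq_iff)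
  have sm: "smooth_on (TA (chart_at \<A> (fst v))) (aniso_rep \<A> (chart_at \<A> (fst v)) (\<lambda>r. Y (fst r)))"
    unfolding c_def[symmetric] eq
    by (rule smooth_on_compose[OF open_TA[OF c(1)] T Y' smooth_on_linear_map[OF bounded_linear_fst open_TA[OF c(1)]]])
  have x: "map_of_chart c (fst v) \<in> map_of_chart c ` dom_of c" using c by simp
  have "((\<lambda>z. vf_rep \<A> c Y (fst z)) has_derivative
      (\<lambda>dz. frechet_derivative (vf_rep \<A> c Y) (at (map_of_chart c (fst v))) (fst dz))) (at (tchart \<A> c v))"
    by (rule has_derivative_compose[OF has_derivative_fst[OF has_derivative_ident]])
      (use smooth_on_has_derivative[OF Y' x] z in simp)
  then have D: "frechet_derivative (\<lambda>z. vf_rep \<A> c Y (fst z)) (at (tchart \<A> c v)) dz =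
      frechet_derivative (vf_rep \<A> c Y) (at (map_of_chart c (fst v))) (fst dz)" for dz
    by (rule frechet_derivative_eqI)
  show ?thesis
    using conn_aniso_chart[OF v X sm]
    by (simp add: eq D c_def[symmetric] linear_0[OF smooth_on_linear[OF Y' x]])
qed

text \<open>Derivatives of the extensions of \<open>w\<close> and \<zeta> enter through
  \<nabla>(\<T>(X,Y)) and are cancelled by those in \<T>(\<nabla>X,Y) and \<T>(X,\<nabla>Y), leaving
  derivatives of \<Gamma> minus its transpose and products of two \<Gamma>.\<close>

lemma conn_tensor_torsion_chart:
  assumes v: "v \<in> A"
  defines "c \<equiv> chart_at \<A> (fst v)"
  defines "z \<equiv> tchart \<A> c v"
  shows "conn_tensor_at \<A> A nab (torsion \<A> nab) v u w \<zeta> =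
    DGam c z (u, 0) w \<zeta> - DGam c z (u, 0) \<zeta> w -
    (DGam c z (0, Gam c z u (snd v)) w \<zeta> - DGam c z (0, Gam c z u (snd v)) \<zeta> w) +
    Gam c z u (Gam c z w \<zeta> - Gam c z \<zeta> w) -
    (Gam c z (Gam c z u w) \<zeta> - Gam c z \<zeta> (Gam c z u w)) -
    (Gam c z w (Gam c z u \<zeta>) - Gam c z (Gam c z u \<zeta>) w)"
proof -
  define U where "U = vf_ext \<A> (fst v) u"
  define X where "X = vf_ext \<A> (fst v) w"
  define Y where "Y = vf_ext \<A> (fst v) \<zeta>"
  have s: "smooth_vf \<A> U" "smooth_vf \<A> X" "smooth_vf \<A> Y"
    and val: "U (fst v) = u" "X (fst v) = w" "Y (fst v) = \<zeta>"
    by (simp_all add: U_def X_def Y_def vf_ext_smooth vf_ext_at)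
  have c: "c \<in> \<A>" "fst v \<in> dom_of c" and zT: "z \<in> TA c" and z: "fst z = map_of_chart c (fst v)"
    using preferred_chart[OF v] tchart_preferred[OF v] by (simp_all add: c_def z_def)
  have T: "to_coord \<A> c (fst v) y = y" for y by (simp add: c_def to_coord_chart_at)
  let ?x = "map_of_chart c (fst v)"
  have x: "?x \<in> map_of_chart c ` dom_of c" using c by simp
  let ?D = "\<lambda>F. frechet_derivative (vf_rep \<A> c F) (at ?x)"
  have r: "vf_rep \<A> c F ?x = F (fst v)" for F using c by (simp add: vf_rep_at T)
  note X' = smooth_vf_onD[OF s(2) c(1) subset_refl subset_UNIV] and Y' = smooth_vf_onD[OF s(3) c(1) subset_refl subset_UNIV]
  have Tf: "fst z \<in> map_of_chart c ` dom_of c" if "z \<in> TA c" for z by (rule TA_cases[OF c(1) that]) auto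
  define \<Y> where "\<Y> r = torsion \<A> nab r (X (fst r)) (Y (fst r))" for r
  let ?F = "\<lambda>z. Gam c z (vf_rep \<A> c X (fst z)) (vf_rep \<A> c Y (fst z)) - Gam c z (vf_rep \<A> c Y (fst z)) (vf_rep \<A> c X (fst z))"
  \<comment> \<open>At foot points other than that of \<open>v\<close> the chart \<open>c\<close> is
    in general not the preferred one; \<open>torsion_chart\<close> is therefore applied at
    \<open>v'\<close> in \<open>c\<close>.\<close>
  have rep: "aniso_rep \<A> c \<Y> z' = ?F z'" if z': "z' \<in> TA c" for z'
  proof -
    obtain v' where v': "v' \<in> A" "fst v' \<in> dom_of c" "z' = tchart \<A> c v'" "tchart_inv \<A> c z' = v'" "fst z' = map_of_chart c (fst v')"
      by (rule TA_cases[OF c(1) z'])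
    show ?thesis
      using torsion_chart[OF v'(1) c(1) v'(2)] v'(3-5)
      by (simp add: aniso_rep_def \<Y>_def chart_inv_left[OF c(1) v'(2)] vf_rep_at[OF c(1) v'(2)])
  qed
  note sf = smooth_on_linear_map[OF bounded_linear_fst open_TA[OF c(1)]] and sid = smooth_on_ident[OF open_TA[OF c(1)]]
  note sX = smooth_on_compose[OF open_TA[OF c(1)] Tf X' sf] and sY = smooth_on_compose[OF open_TA[OF c(1)] Tf Y' sf]
  have "smooth_on (TA c) ?F"
    by (rule smooth_on_diff[OF open_TA[OF c(1)] smooth_Gam[OF c(1) open_TA[OF c(1)] sid _ sX sY]
          smooth_Gam[OF c(1) open_TA[OF c(1)] sid _ sY sX]])
  then have sm: "smooth_on (TA (chart_at \<A> (fst v))) (aniso_rep \<A> (chart_at \<A> (fst v)) \<Y>)"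
    unfolding c_def[symmetric] by (rule smooth_on_cong[OF open_TA[OF c(1)], rotated]) (simp add: rep)
  have f: "(fst has_derivative fst) (at z)" by (rule has_derivative_fst[OF has_derivative_ident])
  have FX: "((\<lambda>z. vf_rep \<A> c X (fst z)) has_derivative (\<lambda>dz. ?D X (fst dz))) (at z)"
    by (rule has_derivative_compose[OF f]) (use smooth_on_has_derivative[OF X' x] z in simp)
  have FY: "((\<lambda>z. vf_rep \<A> c Y (fst z)) has_derivative (\<lambda>dz. ?D Y (fst dz))) (at z)"
    by (rule has_derivative_compose[OF f]) (use smooth_on_has_derivative[OF Y' x] z in simp)
  let ?F' = "\<lambda>dz. DGam c z dz w \<zeta> + Gam c z (?D X (fst dz)) \<zeta> + Gam c z w (?D Y (fst dz)) -
      (DGam c z dz \<zeta> w + Gam c z (?D Y (fst dz)) w + Gam c z \<zeta> (?D X (fst dz)))"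
  have "(?F has_derivative ?F') (at z)"
    using has_derivative_diff[OF Gam_has_derivative[OF c(1) has_derivative_ident zT FX FY]
        Gam_has_derivative[OF c(1) has_derivative_ident zT FY FX]]
    by (simp add: z r val)
  then have "(aniso_rep \<A> c \<Y> has_derivative ?F') (at z)"
    by (rule has_derivative_transform_within_open[OF _ open_TA[OF c(1)] zT]) (simp add: rep)
  then have D: "frechet_derivative (aniso_rep \<A> c \<Y>) (at z) dz = ?F' dz" for dz by (rule frechet_derivative_eqI)
  have tor: "torsion \<A> nab v u' w' = Gam c z u' w' - Gam c z w' u'" for u' w'
    using torsion_chart[OF v c] by (simp add: T z_def)
  have l: "?D X 0 = 0" "?D Y 0 = 0" using linear_0[OF smooth_on_linear[OF X' x]] linear_0[OF smooth_on_linear[OF Y' x]] by auto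
  have 1: "conn_aniso \<A> A nab v U \<Y> = ?F' (u, 0) + Gam c z u (Gam c z w \<zeta> - Gam c z \<zeta> w) - ?F' (0, Gam c z u (snd v))"
    using conn_aniso_chart[OF v s(1) sm] unfolding c_def[symmetric] z_def[symmetric] D val \<Y>_def[of v] tor .
  note 2 = conn_aniso_vf[OF v s(1,2), folded c_def, folded z_def, unfolded val]
  note 3 = conn_aniso_vf[OF v s(1,3), folded c_def, folded z_def, unfolded val]
  show ?thesis
    unfolding conn_tensor_at_def conn_tensor_def U_def[symmetric] X_def[symmetric] Y_def[symmetric] \<Y>_def[symmetric] val tor 1 2 3
    by (simp add: l) (simp add: Gam_def bilin_add_left bilin_add_right algebra_simps)
qed

section \<open>The torsion-free case\<close>

text \<open>\<open>conn_aniso\<close> goes through \<open>germ_ext\<close> and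
  \<open>vert_deriv\<close>, but by the chart formula only the representative on the open set
  \<open>TA c\<close> counts, and there it is zero.\<close>

lemma conn_aniso_zero:
  assumes v: "v \<in> A" and X: "smooth_vf \<A> X" and 0: "\<And>r. r \<in> A \<Longrightarrow> \<Y> r = 0"
  shows "conn_aniso \<A> A nab v X \<Y> = 0"
proof -
  define c where "c = chart_at \<A> (fst v)"
  have c: "c \<in> \<A>" and zT: "tchart \<A> c v \<in> TA c"
    using preferred_chart[OF v] tchart_preferred[OF v] by (simp_all add: c_def)
  have rep: "aniso_rep \<A> c \<Y> z = 0" if z: "z \<in> TA c" for z
  proof -
    obtain v where "v \<in> A" "fst v \<in> dom_of c" "z = tchart \<A> c v" "tchart_inv \<A> c z = v" "fst z = map_of_chart c (fst v)"
      by (rule TA_cases[OF c z])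
    then show ?thesis using 0 by (simp add: aniso_rep_def chart_inv_left[OF c] linear_0[OF linear_to_coord[OF c]])
  qed
  have sm: "smooth_on (TA (chart_at \<A> (fst v))) (aniso_rep \<A> (chart_at \<A> (fst v)) \<Y>)"
    unfolding c_def[symmetric]
    by (rule smooth_on_cong[OF open_TA[OF c] _ smooth_on_const[OF open_TA[OF c], of 0]]) (simp add: rep)
  have "(aniso_rep \<A> c \<Y> has_derivative (\<lambda>h. 0)) (at (tchart \<A> c v))"
    by (rule has_derivative_transform_within_open[OF has_derivative_const open_TA[OF c] zT]) (simp add: rep)
  then have "frechet_derivative (aniso_rep \<A> c \<Y>) (at (tchart \<A> c v)) dz = 0" for dz by (rule frechet_derivative_eqI)
  then show ?thesis using conn_aniso_chart[OF v X sm] 0[OF v] by (simp add: c_def)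
qed

lemma torsion_free_vanish:
  assumes tf: "torsion_free \<A> A nab" and v: "v \<in> A"
  shows "torsion \<A> nab v u w = 0" "conn_tensor_at \<A> A nab (torsion \<A> nab) v x u w = 0"
proof -
  have t: "torsion \<A> nab r u w = 0" if "r \<in> A" for r u w
    using tf that vf_ext_smooth unfolding torsion_free_def torsion_def by blast
  show "torsion \<A> nab v u w = 0" by (rule t[OF v])
  show "conn_tensor_at \<A> A nab (torsion \<A> nab) v x u w = 0"
    using conn_aniso_zero[OF v vf_ext_smooth t] v by (simp add: conn_tensor_at_def conn_tensor_def t)
qed

end

section \<open>Jacobi fields\<close>

context smooth_manifold
begin

text \<open>\<open>smooth_into\<close> offers some chart around the image point, whereas the
  computation takes place in a prescribed one. On the preimage of the overlap the transition map can
  be composed with the given representative.\<close>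

lemma smooth_into_chart:
  assumes f: "smooth_into \<A> S f" and x: "x \<in> S" and c: "c \<in> \<A>" "f x \<in> dom_of c"
  obtains W g where "open W" "x \<in> W" "smooth_on W g"
    "\<And>y. y \<in> W \<inter> S \<Longrightarrow> f y \<in> dom_of c \<and> map_of_chart c (f y) = g y"
proof -
  obtain d W g where d: "d \<in> \<A>" and W: "open W" "x \<in> W" and g: "smooth_on W g"
    and fg: "\<And>y. y \<in> W \<inter> S \<Longrightarrow> f y \<in> dom_of d \<and> map_of_chart d (f y) = g y"
    using f x unfolding smooth_into_def by blast
  let ?O = "map_of_chart d ` (dom_of d \<inter> dom_of c)"
  have W': "open (W \<inter> g -` ?O)"
    by (rule continuous_open_preimage[OF smooth_on_continuous[OF g] W(1) open_overlap[OF d c(1)]])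
  have "f x \<in> dom_of d" "g x = map_of_chart d (f x)" using fg W x by auto
  then have xW: "x \<in> W \<inter> g -` ?O" using W c by auto
  have sm: "smooth_on (W \<inter> g -` ?O) (\<lambda>y. (map_of_chart c \<circ> chart_inv d) (g y))"
    by (rule smooth_on_compose[OF W' _ transition_smooth[OF d c(1)] smooth_on_subset[OF g]]) auto
  have "f y \<in> dom_of c \<and> map_of_chart c (f y) = (map_of_chart c \<circ> chart_inv d) (g y)" if y: "y \<in> (W \<inter> g -` ?O) \<inter> S" for y
  proof -
    have fy: "f y \<in> dom_of d" "map_of_chart d (f y) = g y" using fg y by auto
    obtain p where p: "p \<in> dom_of d" "p \<in> dom_of c" "g y = map_of_chart d p" using y by blast
    have "f y = p" using fy p chart_inv_left[OF d] by metis
    then show ?thesis using p by (simp add: chart_inv_left[OF d])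
  qed
  then show ?thesis using that[OF W' xW sm] by blast
qed

end

section \<open>Partial derivatives of maps of two real variables\<close>

text \<open>\<open>k\<close> is controlled only on \<open>S\<close>, later [a,b], so its derivative
  is taken within \<open>S\<close>; it is computed from \<open>f\<close>, which is smooth on an open
  set and has a full derivative even over an endpoint.\<close>

lemma smooth_on_horizontal_derivative:
  fixes f :: "real \<times> real \<Rightarrow> 'b::real_normed_vector"
  assumes W: "open W" "(\<tau>, s) \<in> W" and f: "smooth_on W f" and \<tau>: "\<tau> \<in> S"
    and k: "\<And>\<sigma>. \<sigma> \<in> S \<Longrightarrow> (\<sigma>, s) \<in> W \<Longrightarrow> k \<sigma> = f (\<sigma>, s)"
  shows "(k has_vector_derivative frechet_derivative f (at (\<tau>, s)) (1, 0)) (at \<tau> within S)"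
    and "\<forall>\<^sub>F \<sigma> in at \<tau> within S. \<sigma> \<in> S \<and> (\<sigma>, s) \<in> W"
proof -
  have d: "((\<lambda>\<sigma>. (\<sigma>, s)) has_derivative (\<lambda>h. (h, 0))) (at \<tau> within S)"
    by (auto intro!: derivative_eq_intros)
  have "\<forall>\<^sub>F \<sigma> in at \<tau> within S. (\<sigma>, s) \<in> W"
    using has_derivative_continuous[OF d] W by (simp add: continuous_within topological_tendstoD)
  moreover have "\<forall>\<^sub>F \<sigma> in at \<tau> within S. \<sigma> \<in> S" by (simp add: eventually_at_filter)
  ultimately show ev: "\<forall>\<^sub>F \<sigma> in at \<tau> within S. \<sigma> \<in> S \<and> (\<sigma>, s) \<in> W" by eventually_elim simp
  have "((\<lambda>\<sigma>. f (\<sigma>, s)) has_derivative (\<lambda>h. frechet_derivative f (at (\<tau>, s)) (h, 0))) (at \<tau> within S)"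
    by (rule has_derivative_compose[OF d smooth_on_has_derivative[OF f W(2)]])
  then have "(k has_derivative (\<lambda>h. frechet_derivative f (at (\<tau>, s)) (h, 0))) (at \<tau> within S)"
  proof (rule has_derivative_transform_eventually)
    show "\<forall>\<^sub>F \<sigma> in at \<tau> within S. f (\<sigma>, s) = k \<sigma>" using ev by eventually_elim (simp add: k)
  qed (use k W \<tau> in auto)
  moreover have "frechet_derivative f (at (\<tau>, s)) (h, 0) = h *\<^sub>R frechet_derivative f (at (\<tau>, s)) (1, 0)" for h
    using linear_scale[OF smooth_on_linear[OF f W(2)], of h "(1, 0)"] by simp
  ultimately show "(k has_vector_derivative frechet_derivative f (at (\<tau>, s)) (1, 0)) (at \<tau> within S)"
    unfolding has_vector_derivative_def by (blast intro: has_derivative_eq_rhs)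
qed

lemma smooth_on_vertical_derivative:
  fixes f :: "real \<times> real \<Rightarrow> 'b::real_normed_vector"
  assumes W: "open W" "(\<tau>, s) \<in> W" and f: "smooth_on W f"
  shows "((\<lambda>\<sigma>. f (\<tau>, \<sigma>)) has_vector_derivative frechet_derivative f (at (\<tau>, s)) (0, 1)) (at s)"
    and "\<forall>\<^sub>F \<sigma> in nhds s. (\<tau>, \<sigma>) \<in> W"
proof -
  have d: "((\<lambda>\<sigma>. (\<tau>, \<sigma>)) has_derivative (\<lambda>h. (0, h))) (at s)"
    by (auto intro!: derivative_eq_intros)
  have "open ((\<lambda>\<sigma>. (\<tau>, \<sigma>)) -` W)"
    by (rule open_vimage[OF W(1)]) (simp add: continuous_on_Pair)
  then show "\<forall>\<^sub>F \<sigma> in nhds s. (\<tau>, \<sigma>) \<in> W" using W(2) by (auto simp: eventually_nhds)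
  have "((\<lambda>\<sigma>. f (\<tau>, \<sigma>)) has_derivative (\<lambda>h. frechet_derivative f (at (\<tau>, s)) (0, h))) (at s)"
    by (rule has_derivative_compose[OF d smooth_on_has_derivative[OF f W(2)]])
  moreover have "frechet_derivative f (at (\<tau>, s)) (0, h) = h *\<^sub>R frechet_derivative f (at (\<tau>, s)) (0, 1)" for h
    using linear_scale[OF smooth_on_linear[OF f W(2)], of h "(0, 1)"] by simp
  ultimately show "((\<lambda>\<sigma>. f (\<tau>, \<sigma>)) has_vector_derivative frechet_derivative f (at (\<tau>, s)) (0, 1)) (at s)"
    unfolding has_vector_derivative_def by (blast intro: has_derivative_eq_rhs)
qed

context aniso_manifold
begin

section \<open>The Jacobi equation\<close>

text \<open>The first conclusion is exported because the vanishing of torsion and P, like the chart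
  formulas of the tensors, is available at vectors of \<open>A\<close>.\<close>

lemma jacobi_equation:
  assumes ab: "a < b" and J: "jacobi_field \<A> A nab a b \<gamma> J" and t: "t \<in> {a..b}"
  defines "T \<equiv> velocity \<A> a b \<gamma>"
  defines "D \<equiv> cov_deriv_along \<A> nab a b \<gamma> T"
  defines "v \<equiv> (\<gamma> t, T t)"
  shows "v \<in> A"
    and "D (D J) t = curvature \<A> A nab v (T t) (J t) (T t)
      - vert_conn \<A> nab v (T t) (T t) (D J t + torsion \<A> nab v (J t) (T t))
      - conn_tensor_at \<A> A nab (torsion \<A> nab) v (T t) (J t) (T t)
      - torsion \<A> nab v (D J t) (T t)"
proof -
  obtain \<epsilon> \<Lambda> where \<epsilon>: "\<epsilon> > 0" and \<Lambda>: "smooth_into \<A> ({a..b} \<times> {-\<epsilon><..<\<epsilon>}) \<Lambda>"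
    and \<Lambda>\<gamma>: "\<And>t. t \<in> {a..b} \<Longrightarrow> \<Lambda> (t, 0) = \<gamma> t"
    and ap: "\<And>s. s \<in> {-\<epsilon><..<\<epsilon>} \<Longrightarrow> auto_parallel \<A> A nab a b (\<lambda>t. \<Lambda> (t, s))"
    and Jt: "\<And>t. t \<in> {a..b} \<Longrightarrow> J t = vector_derivative (\<lambda>s. map_of_chart (chart_at \<A> (\<gamma> t)) (\<Lambda> (t, s))) (at 0)"
    using J unfolding jacobi_field_def by blast
  define S where "S = {a..b} \<times> {-\<epsilon><..<\<epsilon>}"
  define c where "c = chart_at \<A> (\<gamma> t)"
  have c: "c \<in> \<A>" "\<gamma> t \<in> dom_of c" by (simp_all add: c_def chart_at_in mem_chart_at)
  have tS: "(t, 0) \<in> S" using t \<epsilon> by (simp add: S_def)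
  obtain W g where W: "open W" "(t, 0) \<in> W" and g: "smooth_on W g"
    and gW: "\<And>y. y \<in> W \<inter> S \<Longrightarrow> \<Lambda> y \<in> dom_of c \<and> map_of_chart c (\<Lambda> y) = g y"
    using smooth_into_chart[OF \<Lambda>[folded S_def] tS c(1)] c(2) \<Lambda>\<gamma>[OF t] by metis
  define gt where "gt z = frechet_derivative g (at z) (1, 0)" for z
  define gs where "gs z = frechet_derivative g (at z) (0, 1)" for z
  define gtt where "gtt z = frechet_derivative gt (at z) (1, 0)" for z
  define gst where "gst z = frechet_derivative gs (at z) (1, 0)" for z
  have sgt: "smooth_on W gt" and sgs: "smooth_on W gs" unfolding gt_def gs_def by (intro smooth_on_frechet_derivative g)+
  have sgtt: "smooth_on W gtt" and sgst: "smooth_on W gst"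
    unfolding gtt_def gst_def by (intro smooth_on_frechet_derivative sgt sgs)+
  define z0 where "z0 = (t, 0::real)"
  have z0: "z0 \<in> W" "z0 \<in> S" using W tS by (simp_all add: z0_def)
  \<comment> \<open>\<open>gst\<close> is the t-derivative of the s-derivative, the order in which D
    J produces it; the auto-parallel equation produces the other order.\<close>
  have mixed: "frechet_derivative gt (at z) (0, 1) = gst z" if "z \<in> W" for z
    using hessian_symmetric[OF W(1) that g, of "(0, 1)" "(1, 0)"] unfolding hessian_def gst_def gt_def gs_def .
  have inS: "(\<sigma>, s) \<in> S \<longleftrightarrow> \<sigma> \<in> {a..b} \<and> s \<in> {-\<epsilon><..<\<epsilon>}" for \<sigma> s by (simp add: S_def)
  have zero: "0 \<in> {-\<epsilon><..<\<epsilon>}" using \<epsilon> by simp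

  \<comment> \<open>Holding for all curves of the variation in the one chart \<open>c\<close>, this
    makes velocities at neighbouring times comparable and differentiable.\<close>
  have vel: "velocity \<A> a b (\<lambda>t. \<Lambda> (t, s)) \<tau> = from_coord \<A> c (\<Lambda> (\<tau>, s)) (gt (\<tau>, s))"
    if "(\<tau>, s) \<in> W \<inter> S" for \<tau> s
  proof -
    have \<tau>s: "\<tau> \<in> {a..b}" "s \<in> {-\<epsilon><..<\<epsilon>}" "(\<tau>, s) \<in> W" using that by (auto simp: inS)
    have "((\<lambda>\<sigma>. map_of_chart c (\<Lambda> (\<sigma>, s))) has_vector_derivative gt (\<tau>, s)) (at \<tau> within {a..b})"
      unfolding gt_def by (rule smooth_on_horizontal_derivative(1)[OF W(1) \<tau>s(3) g \<tau>s(1)]) (use gW \<tau>s in \<open>auto simp: inS\<close>)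
    moreover have "\<forall>\<^sub>F \<sigma> in at \<tau> within {a..b}. \<Lambda> (\<sigma>, s) \<in> dom_of c"
      using smooth_on_horizontal_derivative(2)[OF W(1) \<tau>s(3) g \<tau>s(1) refl]
      by eventually_elim (use gW \<tau>s in \<open>auto simp: inS\<close>)
    ultimately show ?thesis
      using gW[OF that] by (intro velocity_chart[OF ab \<tau>s(1) c(1), of "\<lambda>t. \<Lambda> (t, s)"]) auto
  qed
  have pt: "tchart \<A> c (\<Lambda> z, from_coord \<A> c (\<Lambda> z) y) = (g z, y)" if "z \<in> W \<inter> S" for z y
    using gW[OF that] by (simp add: tchart_def to_from_coord[OF c(1)])
  \<comment> \<open>The equation is available only on \<open>W \<inter> S\<close>, where
    \<open>g\<close> represents the variation; elsewhere in \<open>W\<close> it is merely some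
    smooth extension.\<close>
  have TA: "(g z, gt z) \<in> TA c" and geo: "gtt z + Gam c (g z, gt z) (gt z) (gt z) = 0" if zWS: "z \<in> W \<inter> S" for z
  proof -
    obtain \<tau> s where z: "z = (\<tau>, s)" by (cases z)
    have \<tau>s: "\<tau> \<in> {a..b}" "s \<in> {-\<epsilon><..<\<epsilon>}" "(\<tau>, s) \<in> W" using zWS by (auto simp: inS z)
    let ?\<gamma> = "\<lambda>t. \<Lambda> (t, s)"
    have \<Lambda>c: "\<Lambda> (\<tau>, s) \<in> dom_of c" using gW zWS by (simp add: z)
    note vel\<tau> = vel[OF zWS[unfolded z]]
    have inA: "(\<Lambda> (\<tau>, s), velocity \<A> a b ?\<gamma> \<tau>) \<in> A"
      and par: "cov_deriv \<A> nab a b ?\<gamma> (\<Lambda> (\<tau>, s), velocity \<A> a b ?\<gamma> \<tau>) (velocity \<A> a b ?\<gamma>) \<tau> = 0"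
      using ap[OF \<tau>s(2)] \<tau>s(1) unfolding auto_parallel_def cov_deriv_along_def by blast+
    show "(g z, gt z) \<in> TA c"
      using tchart_in_TA[OF inA, of c] \<Lambda>c pt[OF zWS] by (simp add: vel\<tau> z)
    have ev: "\<forall>\<^sub>F \<sigma> in at \<tau> within {a..b}. \<Lambda> (\<sigma>, s) \<in> dom_of c"
      using smooth_on_horizontal_derivative(2)[OF W(1) \<tau>s(3) g \<tau>s(1) refl]
      by eventually_elim (use gW \<tau>s in \<open>auto simp: inS\<close>)
    have x: "((\<lambda>\<sigma>. map_of_chart c (\<Lambda> (\<sigma>, s))) has_vector_derivative gt (\<tau>, s)) (at \<tau> within {a..b})"
      unfolding gt_def by (rule smooth_on_horizontal_derivative(1)[OF W(1) \<tau>s(3) g \<tau>s(1)]) (use gW \<tau>s in \<open>auto simp: inS\<close>)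
    have "((\<lambda>\<sigma>. to_coord \<A> c (\<Lambda> (\<sigma>, s)) (velocity \<A> a b ?\<gamma> \<sigma>)) has_vector_derivative gtt (\<tau>, s)) (at \<tau> within {a..b})"
      unfolding gtt_def by (rule smooth_on_horizontal_derivative(1)[OF W(1) \<tau>s(3) sgt \<tau>s(1)])
        (use gW \<tau>s vel in \<open>auto simp: inS to_from_coord[OF c(1)]\<close>)
    from cov_deriv_chart(2)[OF ab \<tau>s(1) c(1) \<Lambda>c ev x inA this]
    have "0 = from_coord \<A> c (\<Lambda> (\<tau>, s)) (gtt z + Gam c (g z, gt z) (gt z) (gt z))"
      using par pt[OF zWS] \<Lambda>c by (simp add: vel\<tau> z to_from_coord[OF c(1)])
    from arg_cong[OF this, of "to_coord \<A> c (\<Lambda> (\<tau>, s))"]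
    have "to_coord \<A> c (\<Lambda> (\<tau>, s)) 0 = gtt z + Gam c (g z, gt z) (gt z) (gt z)"
      by (simp add: to_from_coord[OF c(1) \<Lambda>c])
    then show "gtt z + Gam c (g z, gt z) (gt z) (gt z) = 0"
      by (simp add: linear_0[OF linear_to_coord[OF c(1) \<Lambda>c]])
  qed

  have near: "\<gamma> \<tau> \<in> dom_of c" "map_of_chart c (\<gamma> \<tau>) = g (\<tau>, 0)" "(\<tau>, 0) \<in> W \<inter> S"
    if "\<tau> \<in> {a..b}" "(\<tau>, 0) \<in> W" for \<tau>
    using gW[of "(\<tau>, 0)"] that \<Lambda>\<gamma>[OF that(1)] zero by (auto simp: inS)
  have ev\<gamma>: "\<forall>\<^sub>F \<sigma> in at \<tau> within {a..b}. \<gamma> \<sigma> \<in> dom_of c" and x\<gamma>: "((\<lambda>\<sigma>. map_of_chart c (\<gamma> \<sigma>)) has_vector_derivative gt (\<tau>, 0)) (at \<tau> within {a..b})"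
    if \<tau>: "\<tau> \<in> {a..b}" "(\<tau>, 0) \<in> W" for \<tau>
  proof -
    show "\<forall>\<^sub>F \<sigma> in at \<tau> within {a..b}. \<gamma> \<sigma> \<in> dom_of c"
      using smooth_on_horizontal_derivative(2)[OF W(1) \<tau>(2) g \<tau>(1) refl]
      by eventually_elim (use near in auto)
    show "((\<lambda>\<sigma>. map_of_chart c (\<gamma> \<sigma>)) has_vector_derivative gt (\<tau>, 0)) (at \<tau> within {a..b})"
      unfolding gt_def by (rule smooth_on_horizontal_derivative(1)[OF W(1) \<tau>(2) g \<tau>(1)]) (use near in auto)
  qed
  have vel\<gamma>: "T \<tau> = from_coord \<A> c (\<gamma> \<tau>) (gt (\<tau>, 0))" if \<tau>: "\<tau> \<in> {a..b}" "(\<tau>, 0) \<in> W" for \<tau>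
    unfolding T_def by (rule velocity_chart[OF ab \<tau>(1) c(1) near(1)[OF \<tau>] ev\<gamma>[OF \<tau>] x\<gamma>[OF \<tau>]])
  have tc: "tchart \<A> c (\<gamma> \<tau>, T \<tau>) = (g (\<tau>, 0), gt (\<tau>, 0))" and inA: "(\<gamma> \<tau>, T \<tau>) \<in> A" if \<tau>: "\<tau> \<in> {a..b}" "(\<tau>, 0) \<in> W" for \<tau>
  proof -
    show tc: "tchart \<A> c (\<gamma> \<tau>, T \<tau>) = (g (\<tau>, 0), gt (\<tau>, 0))"
      using pt[OF near(3)[OF \<tau>]] by (simp add: \<Lambda>\<gamma>[OF \<tau>(1)] vel\<gamma>[OF \<tau>])
    show "(\<gamma> \<tau>, T \<tau>) \<in> A"
      using in_A_iff[OF c(1), of "(\<gamma> \<tau>, T \<tau>)"] near(1)[OF \<tau>] TA[OF near(3)[OF \<tau>]] tc by simp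
  qed
  \<comment> \<open>J is defined at each time in the preferred chart of that time; the chain rule
    through the transition map moves it to \<open>c\<close>.\<close>
  have J\<gamma>: "J \<tau> = from_coord \<A> c (\<gamma> \<tau>) (gs (\<tau>, 0))" if \<tau>: "\<tau> \<in> {a..b}" "(\<tau>, 0) \<in> W" for \<tau>
  proof -
    let ?d = "chart_at \<A> (\<gamma> \<tau>)"
    let ?\<psi> = "map_of_chart ?d \<circ> chart_inv c"
    have d: "?d \<in> \<A>" "\<gamma> \<tau> \<in> dom_of ?d" by (simp_all add: chart_at_in mem_chart_at)
    have xO: "g (\<tau>, 0) = map_of_chart c (\<gamma> \<tau>)" using near[OF \<tau>] by simp
    note gv = smooth_on_vertical_derivative[OF W(1) \<tau>(2) g, folded gs_def]
    have gd: "((\<lambda>s. g (\<tau>, s)) has_derivative (\<lambda>h. h *\<^sub>R gs (\<tau>, 0))) (at 0)"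
      using gv(1) by (simp add: has_vector_derivative_def)
    have "\<forall>\<^sub>F s in nhds (0::real). s \<in> {-\<epsilon><..<\<epsilon>}" using zero by (intro eventually_nhds_in_open) auto
    with gv(2) have ev: "\<forall>\<^sub>F s in nhds 0. (\<tau>, s) \<in> W \<inter> S" by eventually_elim (use \<tau> in \<open>auto simp: inS\<close>)
    have "\<forall>\<^sub>F s in at 0. (\<tau>, s) \<in> W \<inter> S" using ev by (simp add: eventually_nhds_conv_at)
    moreover have "(g (\<tau>, 0)) \<in> map_of_chart c ` (dom_of c \<inter> dom_of ?d)" using near[OF \<tau>] d by (auto simp: xO)
    then have "\<forall>\<^sub>F s in at 0. g (\<tau>, s) \<in> map_of_chart c ` (dom_of c \<inter> dom_of ?d)"
      using has_derivative_continuous[OF gd] open_overlap[OF c(1) d(1)] by (simp add: continuous_within topological_tendstoD)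
    ultimately have eq: "\<forall>\<^sub>F s in at 0. ?\<psi> (g (\<tau>, s)) = map_of_chart ?d (\<Lambda> (\<tau>, s))"
    proof eventually_elim
      case (elim s)
      have "\<Lambda> (\<tau>, s) \<in> dom_of c" "map_of_chart c (\<Lambda> (\<tau>, s)) = g (\<tau>, s)" using gW elim(1) by auto
      then show ?case by (simp add: chart_inv_left[OF c(1)] flip: \<open>map_of_chart c (\<Lambda> (\<tau>, s)) = g (\<tau>, s)\<close>)
    qed
    have "((\<lambda>s. ?\<psi> (g (\<tau>, s))) has_derivative (\<lambda>h. transition_deriv c ?d (\<gamma> \<tau>) (h *\<^sub>R gs (\<tau>, 0)))) (at 0)"
      by (rule has_derivative_compose[OF gd])
        (unfold xO, rule transition_has_derivative[OF c(1) d(1) near(1)[OF \<tau>] d(2)])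
    then have "((\<lambda>s. map_of_chart ?d (\<Lambda> (\<tau>, s))) has_derivative (\<lambda>h. transition_deriv c ?d (\<gamma> \<tau>) (h *\<^sub>R gs (\<tau>, 0)))) (at 0)"
      by (rule has_derivative_transform_eventually[OF _ eq])
        (use near[OF \<tau>] \<Lambda>\<gamma>[OF \<tau>(1)] in \<open>simp_all add: xO chart_inv_left[OF c(1)]\<close>)
    then have "((\<lambda>s. map_of_chart ?d (\<Lambda> (\<tau>, s))) has_vector_derivative from_coord \<A> c (\<gamma> \<tau>) (gs (\<tau>, 0))) (at 0)"
      by (simp add: has_vector_derivative_def from_coord_def linear_scale[OF linear_transition_deriv[OF c(1) d(1) near(1)[OF \<tau>] d(2)]])
    then show ?thesis using Jt[OF \<tau>(1)] by (simp add: vector_derivative_at)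
  qed

  \<comment> \<open>Components of D J in \<open>c\<close>, written as a function of both variables;
    D (D J) then comes from the derivative of \<open>k\<close> along the line where s is 0.\<close>
  define k where "k z = gst z + Gam c (g z, gt z) (gt z) (gs z)" for z
  have DJ: "D J \<tau> = from_coord \<A> c (\<gamma> \<tau>) (k (\<tau>, 0))" if \<tau>: "\<tau> \<in> {a..b}" "(\<tau>, 0) \<in> W" for \<tau>
  proof -
    have "((\<lambda>\<sigma>. to_coord \<A> c (\<gamma> \<sigma>) (J \<sigma>)) has_vector_derivative gst (\<tau>, 0)) (at \<tau> within {a..b})"
      unfolding gst_def by (rule smooth_on_horizontal_derivative(1)[OF W(1) \<tau>(2) sgs \<tau>(1)])
        (use near J\<gamma> in \<open>auto simp: to_from_coord[OF c(1)]\<close>)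
    from cov_deriv_chart(2)[OF ab \<tau>(1) c(1) near(1)[OF \<tau>] ev\<gamma>[OF \<tau>] x\<gamma>[OF \<tau>] inA[OF \<tau>] this]
    show ?thesis
      by (simp add: D_def cov_deriv_along_def tc[OF \<tau>] k_def J\<gamma>[OF \<tau>] to_from_coord[OF c(1) near(1)[OF \<tau>]])
  qed
  \<comment> \<open>The only third derivative of \<open>g\<close> that occurs in D (D J). It is
    eliminated through \<open>lin\<close>.\<close>
  define \<eta> where "\<eta> = frechet_derivative gst (at z0) (1, 0)"
  define Z where "Z = (g z0, gt z0)"
  define u where "u = gt z0"
  define j where "j = gs z0"
  define j' where "j' = gst z0"
  have tW: "t \<in> {a..b}" "(t, 0) \<in> W" using t W by auto
  have id: "from_coord \<A> c (\<gamma> t) y = y" "to_coord \<A> c (\<gamma> t) y = y" for y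
    by (simp_all add: c_def from_coord_chart_at to_coord_chart_at)
  have Tt: "T t = u" and J0: "J t = j" and DJt: "D J t = j' + Gam c Z u j"
    using vel\<gamma>[OF tW] J\<gamma>[OF tW] DJ[OF tW] by (simp_all add: id u_def j_def j'_def k_def Z_def z0_def)
  have ZT: "Z \<in> TA c" using TA z0 by (simp add: Z_def)
  have g': "(g has_derivative frechet_derivative g (at z0)) (at z0)"
    and gt': "(gt has_derivative frechet_derivative gt (at z0)) (at z0)"
    and gs': "(gs has_derivative frechet_derivative gs (at z0)) (at z0)"
    and gtt': "(gtt has_derivative frechet_derivative gtt (at z0)) (at z0)"
    and gst': "(gst has_derivative frechet_derivative gst (at z0)) (at z0)"
    using smooth_on_has_derivative z0(1) g sgt sgs sgtt sgst by blast+
  have gtt0: "gtt z0 = - Gam c Z u u"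
    using geo z0 by (simp add: Z_def u_def eq_neg_iff_add_eq_0)

  \<comment> \<open>The acceleration of \<gamma>, which enters when the point and the velocity in
    \<Gamma> move, is replaced by \<open>- Gam c Z u u\<close> through \<open>gtt0\<close>.\<close>
  have DDJ: "D (D J) t = \<eta> + (DGam c Z (u, - Gam c Z u u) u j + Gam c Z (- Gam c Z u u) j + Gam c Z u j') + Gam c Z u (j' + Gam c Z u j)"
  proof -
    have "(k has_derivative (\<lambda>h. frechet_derivative gst (at z0) h +
        (DGam c (g z0, gt z0) (frechet_derivative g (at z0) h, frechet_derivative gt (at z0) h) (gt z0) (gs z0) +
         Gam c (g z0, gt z0) (frechet_derivative gt (at z0) h) (gs z0) +
         Gam c (g z0, gt z0) (gt z0) (frechet_derivative gs (at z0) h)))) (at z0)"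
      unfolding k_def
      by (intro has_derivative_add gst' Gam_has_derivative[OF c(1) has_derivative_Pair[OF g' gt'] _ gt' gs'])
        (use ZT in \<open>simp add: Z_def\<close>)
    then have kd: "(k has_derivative (\<lambda>h. frechet_derivative k (at z0) h)) (at z0)"
      and k': "frechet_derivative k (at z0) (1, 0) = \<eta> + (DGam c Z (u, - Gam c Z u u) u j + Gam c Z (- Gam c Z u u) j + Gam c Z u j')"
      using frechet_derivative_eqI[of k _ z0 "(1, 0)"] frechet_derivative_works[of k "at z0"] gtt0
      by (auto simp: differentiable_def \<eta>_def Z_def u_def j_def j'_def gt_def[symmetric] gtt_def[symmetric] gst_def[symmetric])
    have "((\<lambda>\<sigma>. (\<sigma>, 0)) has_derivative (\<lambda>h. (h, 0))) (at t within {a..b})"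
      by (auto intro!: derivative_eq_intros)
    from has_derivative_compose[OF this kd[unfolded z0_def], folded z0_def]
    have "((\<lambda>\<sigma>. k (\<sigma>, 0)) has_derivative (\<lambda>h. frechet_derivative k (at z0) (h, 0))) (at t within {a..b})" .
    then have "((\<lambda>\<sigma>. to_coord \<A> c (\<gamma> \<sigma>) (D J \<sigma>)) has_derivative (\<lambda>h. frechet_derivative k (at z0) (h, 0))) (at t within {a..b})"
    proof (rule has_derivative_transform_eventually)
      show "\<forall>\<^sub>F \<sigma> in at t within {a..b}. k (\<sigma>, 0) = to_coord \<A> c (\<gamma> \<sigma>) (D J \<sigma>)"
        using smooth_on_horizontal_derivative(2)[OF W(1) tW(2) g tW(1) refl]
        by eventually_elim (use near DJ in \<open>auto simp: to_from_coord[OF c(1)]\<close>)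
    qed (use tW near DJ in \<open>auto simp: to_from_coord[OF c(1)]\<close>)
    moreover have "frechet_derivative k (at z0) (h, 0) = h *\<^sub>R frechet_derivative k (at z0) (1, 0)" for h
      using linear_scale[OF bounded_linear.linear[OF has_derivative_bounded_linear[OF kd]], of h "(1, 0)"] by simp
    ultimately have "((\<lambda>\<sigma>. to_coord \<A> c (\<gamma> \<sigma>) (D J \<sigma>)) has_vector_derivative frechet_derivative k (at z0) (1, 0)) (at t within {a..b})"
      unfolding has_vector_derivative_def by (blast intro: has_derivative_eq_rhs)
    from cov_deriv_chart(2)[OF ab tW(1) c(1) near(1)[OF tW] ev\<gamma>[OF tW] x\<gamma>[OF tW] inA[OF tW] this]
    have "D (D J) t = frechet_derivative k (at z0) (1, 0) + Gam c Z u (D J t)"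
      by (simp add: D_def[unfolded cov_deriv_along_def] cov_deriv_along_def tc[OF tW] id Z_def u_def z0_def)
    then show ?thesis by (simp add: k' DJt)
  qed

  \<comment> \<open>The linearised auto-parallel equation. Its derivative in s at fixed
    \<open>t\<close> is two-sided even when \<open>t\<close> is an endpoint.\<close>
  have lin: "\<eta> + (DGam c Z (j, j') u u + Gam c Z j' u + Gam c Z u j') = 0"
  proof -
    let ?E = "\<lambda>z. gtt z + Gam c (g z, gt z) (gt z) (gt z)"
    let ?E' = "\<lambda>h. frechet_derivative gtt (at z0) h +
        (DGam c (g z0, gt z0) (frechet_derivative g (at z0) h, frechet_derivative gt (at z0) h) (gt z0) (gt z0) +
         Gam c (g z0, gt z0) (frechet_derivative gt (at z0) h) (gt z0) +
         Gam c (g z0, gt z0) (gt z0) (frechet_derivative gt (at z0) h))"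
    have E: "(?E has_derivative ?E') (at z0)"
      by (intro has_derivative_add gtt' Gam_has_derivative[OF c(1) has_derivative_Pair[OF g' gt'] _ gt' gt'])
        (use ZT in \<open>simp add: Z_def\<close>)
    have "((\<lambda>s::real. (t, s)) has_derivative (\<lambda>h. (0, h))) (at 0)"
      by (auto intro!: derivative_eq_intros)
    from has_derivative_compose[OF this E[unfolded z0_def], folded z0_def]
    have "((\<lambda>s. ?E (t, s)) has_derivative (\<lambda>h. ?E' (0, h))) (at 0)" .
    moreover have "((\<lambda>s. ?E (t, s)) has_derivative (\<lambda>h. 0)) (at 0)"
    proof -
      have "\<forall>\<^sub>F s in nhds (0::real). s \<in> {-\<epsilon><..<\<epsilon>}" using zero by (intro eventually_nhds_in_open) auto
      with smooth_on_vertical_derivative(2)[OF W(1) tW(2) g]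
      have "\<forall>\<^sub>F s in nhds 0. (t, s) \<in> W \<inter> S" by eventually_elim (use tW in \<open>auto simp: inS\<close>)
      then have "\<forall>\<^sub>F s in at 0. (t, s) \<in> W \<inter> S" by (simp add: eventually_nhds_conv_at)
      then have "\<forall>\<^sub>F s in at 0. 0 = ?E (t, s)" by eventually_elim (rule geo[symmetric])
      moreover have "0 = ?E (t, 0)" using geo[of z0] z0 by (simp add: z0_def)
      ultimately show ?thesis
        by (rule has_derivative_transform_eventually[OF has_derivative_const _ _ UNIV_I])
    qed
    ultimately have "(\<lambda>h. ?E' (0, h)) = (\<lambda>h. 0)" by (rule has_derivative_unique)
    from fun_cong[OF this, of 1] have "?E' (0, 1) = 0" .
    \<comment> \<open>Two exchanges: first of the two differentiations of \<open>gt\<close>, then,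
      inside, of those of \<open>g\<close> by \<open>mixed\<close>.\<close>
    moreover have "frechet_derivative gtt (at z0) (0, 1) = \<eta>"
    proof -
      have "frechet_derivative gtt (at z0) (0, 1) = hessian gt z0 (0, 1) (1, 0)"
        unfolding hessian_def gtt_def ..
      also have "\<dots> = hessian gt z0 (1, 0) (0, 1)" by (rule hessian_symmetric[OF W(1) z0(1) sgt])
      also have "\<dots> = \<eta>"
      proof -
        have "((\<lambda>z. frechet_derivative gt (at z) (0, 1)) has_derivative frechet_derivative gst (at z0)) (at z0)"
          by (rule has_derivative_transform_within_open[OF gst' W(1) z0(1)]) (simp add: mixed)
        then show ?thesis unfolding hessian_def \<eta>_def by (rule frechet_derivative_eqI)
      qed
      finally show ?thesis .
    qed
    ultimately show ?thesis
      using mixed[OF z0(1)] by (simp add: Z_def u_def j_def j'_def gs_def)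
  qed

  show vA: "v \<in> A" using inA[OF tW] by (simp add: v_def)
  have vc: "chart_at \<A> (\<gamma> t) = c" "chart_at \<A> (fst v) = c" "tchart \<A> c v = Z" "snd v = u" "fst v = \<gamma> t"
    using tc[OF tW] Tt by (simp_all add: v_def c_def Z_def z0_def)
  have tor: "torsion \<A> nab v x y = Gam c Z x y - Gam c Z y x" for x y
    using torsion_chart[OF vA c(1)] c(2) by (simp add: vc id)
  have DG: "DGam c Z (x, y) p q = DGam c Z (x, 0) p q + DGam c Z (0, y) p q" for x y p q
    using DGam_add[OF c(1) ZT, of "(x, 0)" "(0, y)"] by simp
  have DG2: "DGam c Z (0, x + y) p q = DGam c Z (0, x) p q + DGam c Z (0, y) p q" for x y p q
    using DGam_add[OF c(1) ZT, of "(0, x)" "(0, y)"] by simp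
  have DGm: "DGam c Z (0, - x) p q = - DGam c Z (0, x) p q" for x p q
  proof -
    have "DGam c Z (0, - x) p q + DGam c Z (0, x) p q = DGam c Z 0 p q + DGam c Z 0 p q - DGam c Z 0 p q"
      using DG2[of "- x" x p q] by (simp add: zero_prod_def)
    moreover have "DGam c Z 0 p q = 0" using DG2[of 0 0 p q] by (simp add: zero_prod_def)
    ultimately show ?thesis by (simp add: eq_neg_iff_add_eq_0)
  qed
  have G: "Gam c Z (x + y) q = Gam c Z x q + Gam c Z y q" "Gam c Z q (x + y) = Gam c Z q x + Gam c Z q y"
    "Gam c Z (- x) q = - Gam c Z x q" "Gam c Z q (- x) = - Gam c Z q x"
    "Gam c Z (x - y) q = Gam c Z x q - Gam c Z y q" "Gam c Z q (x - y) = Gam c Z q x - Gam c Z q y" for x y q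
    by (simp_all add: Gam_def bilin_add_left bilin_add_right bilin_minus_left bilin_minus_right bilin_diff_left bilin_diff_right)
  have \<eta>: "\<eta> = - (DGam c Z (j, 0) u u + DGam c Z (0, j') u u + Gam c Z j' u + Gam c Z u j')"
    using lin unfolding DG[of j j' u u] by (simp only: eq_neg_iff_add_eq_0)
  \<comment> \<open>The \<nabla>\<T> term exchanges the two vector slots in the derivative of
    \<Gamma> along the curve. In P, adding the torsion turns \<Gamma>(u,j) into \<Gamma>(j,u), so
    that part of P cancels the remaining fibre derivative in the curvature.\<close>
  show "D (D J) t = curvature \<A> A nab v (T t) (J t) (T t)
      - vert_conn \<A> nab v (T t) (T t) (D J t + torsion \<A> nab v (J t) (T t))
      - conn_tensor_at \<A> A nab (torsion \<A> nab) v (T t) (J t) (T t)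
      - torsion \<A> nab v (D J t) (T t)"
    unfolding DDJ Tt J0 DJt curvature_chart[OF vA, unfolded vc] vert_conn_chart[OF vA, unfolded vc]
      conn_tensor_torsion_chart[OF vA, unfolded vc] tor
      DG[of u "- Gam c Z u u"] G DG2 DGm \<eta>
    using DG2[of "Gam c Z u j" "Gam c Z j u - Gam c Z u j" u u] by (simp add: G DG2 DGm algebra_simps)
qed

end

theorem proposition2p11:
  fixes \<A> :: "('m::{t2_space, second_countable_topology}, 'e::euclidean_space) chart set"
    and A :: "('m \<times> 'e) set"
    and nab :: "('m, 'e) conn"
    and a b :: real
    and \<gamma> :: "real \<Rightarrow> 'm"
    and J :: "real \<Rightarrow> 'e"
  assumes "smooth_atlas \<A>"
    and "open_in_TM \<A> A"
    and "fst ` A = UNIV"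
    and "\<forall>p. (p, 0) \<notin> A"
    and "aniso_connection \<A> A nab"
    and "a < b"
    and "auto_parallel \<A> A nab a b \<gamma>"
    and "jacobi_field \<A> A nab a b \<gamma> J"
  shows
    "let T = velocity \<A> a b \<gamma>;
         D = cov_deriv_along \<A> nab a b \<gamma> T;
         R = curvature \<A> A nab;
         P = vert_conn \<A> nab;
         Tor = torsion \<A> nab
     in (\<forall>t\<in>{a..b}. let v = (\<gamma> t, T t) in
           D (D J) t = R v (T t) (J t) (T t)
             - P v (T t) (T t) (D J t + Tor v (J t) (T t))
             - conn_tensor_at \<A> A nab Tor v (T t) (J t) (T t)
             - Tor v (D J t) (T t)) \<and>
        (torsion_free \<A> A nab \<and> (\<forall>v\<in>A. \<forall>u. P v (snd v) (snd v) u = 0) \<longrightarrow>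
         (\<forall>t\<in>{a..b}. let v = (\<gamma> t, T t) in
           D (D J) t = R v (T t) (J t) (T t)))"
proof -
  interpret aniso_manifold \<A> A nab by unfold_locales (rule assms)+
  note eq = jacobi_equation[OF assms(6,8)]
  show ?thesis
    unfolding Let_def
  proof (intro conjI ballI impI)
    fix t assume t: "t \<in> {a..b}"
    assume h: "torsion_free \<A> A nab \<and> (\<forall>v\<in>A. \<forall>u. vert_conn \<A> nab v (snd v) (snd v) u = 0)"
    \<comment> \<open>The fibre component of
      \<open>(\<gamma> t, velocity \<A> a b \<gamma> t)\<close> is the velocity, which is the
      repeated argument in the hypothesis on P.\<close>
    have "vert_conn \<A> nab (\<gamma> t, velocity \<A> a b \<gamma> t) (velocity \<A> a b \<gamma> t) (velocity \<A> a b \<gamma> t) u = 0" for u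
      using h eq(1)[OF t] by (metis snd_conv)
    then show "cov_deriv_along \<A> nab a b \<gamma> (velocity \<A> a b \<gamma>) (cov_deriv_along \<A> nab a b \<gamma> (velocity \<A> a b \<gamma>) J) t =
        curvature \<A> A nab (\<gamma> t, velocity \<A> a b \<gamma> t) (velocity \<A> a b \<gamma> t) (J t) (velocity \<A> a b \<gamma> t)"
      using eq(2)[OF t] torsion_free_vanish[OF conjunct1[OF h] eq(1)[OF t]] by simp
  qed (rule eq(2))
qed

end
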